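(* Let $N\geq 5$ and let $\kappa,\mu_L,\mu_R$ be real numbers (independent of $\beta$) with $\mu_L>\kappa>0>\mu_R$ and $|\mu_R|>\kappa$. Let $\rho=\rho_\beta$ be the unique stationary distribution of the boundary driven Kawasaki process on $\{0,1\}^N$ at inverse temperature $\beta$. Then for $x\in\{0,1\}^N$, $$\rho_\beta(x)\asymp 1 \quad\text{if and only if}\quad x=\eta_{p,q}\ \text{for some } p\geq 3,\ q\geq 2,\ p+q=N,$$ where $\eta_{p,q}=(1,\dots,1,0,\dots,0)$ consists of $p$ occupied sites followed by $q$ vacant sites. For all other $x\in\{0,1\}^N$, $\rho_\beta(x)\asymp e^{-\beta\alpha}$ for some $\alpha>0$ (depending on $x$).
   Context: Configurations are $x\in\{0,1\}^N$ on sites $1,\dots,N$; $x(i)=1$ means site $i$ is occupied. Energy: $E(x)=-\kappa\sum_{i=1}^{N-1}x(i)x(i+1)$. For $i\neq j$, $x^{i,j}$ is $x$ with the occupations of sites $i$ and $j$ exchanged; for $i\in\{1,N\}$, $x^i$ is $x$ with the occupation of site $i$ flipped. The boundary driven Kawasaki process is the continuous-time Markov jump process on $\{0,1\}^N$ whose only transitions are: for nearest neighbours $|i-j|=1$ with $x(i)\neq x(j)$, $x\to x^{i,j}$ at rate $\exp[-\tfrac{\beta}{2}(E(x^{i,j})-E(x))]$; and for $i\in\{1,N\}$, $x\to x^i$ at rate $\exp[\tfrac{\beta\mu_i}{2}(1-2x(i))]\exp[-\tfrac{\beta}{2}(E(x^i)-E(x))]$, where $\mu_1=\mu_L$ and $\mu_N=\mu_R$.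 This process is irreducible and has a unique stationary distribution $\rho_\beta$. Notation: $f(\beta)\asymp e^{\beta h}$ means $\lim_{\beta\to\infty}\frac1\beta\log f(\beta)=h$; in particular $f(\beta)\asymp 1$ means this limit is $0$. *)

theory Defs
  imports "HOL-Analysis.Analysis"
begin

text \<open>Configurations on sites 1..N: functions nat => bool, False outside {1..N}.
  x i = True means site i is occupied.\<close>
type_synonym config = "nat \<Rightarrow> bool"

definition configs :: "nat \<Rightarrow> config set" where
  "configs N = {x. \<forall>i. i \<notin> {1..N} \<longrightarrow> \<not> x i}"

definition occ :: "config \<Rightarrow> nat \<Rightarrow> real" where
  "occ x i = (if x i then 1 else 0)"

definition energy :: "real \<Rightarrow> nat \<Rightarrow> config \<Rightarrow> real" where
  "energy \<kappa> N x = - \<kappa> * (\<Sum>i\<in>{1..<N}. occ x i * occ x (i+1))"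

definition swap_sites :: "config \<Rightarrow> nat \<Rightarrow> nat \<Rightarrow> config" where
  "swap_sites x i j = x(i := x j, j := x i)"

definition flip_site :: "config \<Rightarrow> nat \<Rightarrow> config" where
  "flip_site x i = x(i := \<not> x i)"

definition kaw_rate :: "nat \<Rightarrow> real \<Rightarrow> real \<Rightarrow> real \<Rightarrow> real \<Rightarrow> config \<Rightarrow> config \<Rightarrow> real" where
  "kaw_rate N \<kappa> \<mu>L \<mu>R \<beta> x y =
     (\<Sum>i\<in>{1..<N}. if x i \<noteq> x (i+1) \<and> y = swap_sites x i (i+1)
        then exp (- \<beta> / 2 * (energy \<kappa> N y - energy \<kappa> N x)) else 0)
   + (if y = flip_site x 1
        then exp (\<beta> * \<mu>L / 2 * (1 - 2 * occ x 1)) * exp (- \<beta> / 2 * (energy \<kappa> N y - energy \<kappa> N x))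
        else 0)
   + (if y = flip_site x N
        then exp (\<beta> * \<mu>R / 2 * (1 - 2 * occ x N)) * exp (- \<beta> / 2 * (energy \<kappa> N y - energy \<kappa> N x))
        else 0)"

definition stationary :: "nat \<Rightarrow> real \<Rightarrow> real \<Rightarrow> real \<Rightarrow> real \<Rightarrow> (config \<Rightarrow> real) \<Rightarrow> bool" where
  "stationary N \<kappa> \<mu>L \<mu>R \<beta> \<rho> \<longleftrightarrow>
     (\<forall>x\<in>configs N. \<rho> x \<ge> 0) \<and> (\<Sum>x\<in>configs N. \<rho> x) = 1 \<and>
     (\<forall>y\<in>configs N.
        (\<Sum>x\<in>configs N - {y}. \<rho> x * kaw_rate N \<kappa> \<mu>L \<mu>R \<beta> x y)
        = \<rho> y * (\<Sum>z\<in>configs N - {y}. kaw_rate N \<kappa> \<mu>L \<mu>R \<beta> y z))"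

definition log_asymp :: "(real \<Rightarrow> real) \<Rightarrow> real \<Rightarrow> bool" where
  "log_asymp f h \<longleftrightarrow> ((\<lambda>\<beta>. ln (f \<beta>) / \<beta>) \<longlongrightarrow> h) at_top"

definition eta :: "nat \<Rightarrow> nat \<Rightarrow> config" where
  "eta p q = (\<lambda>i. 1 \<le> i \<and> i \<le> p)"

end

theory Submission
  imports Defs
begin

text \<open>On the exponential scale the stationary weight of every configuration has a limit, because
  it can be computed by eliminating states without subtractions.  Let \<open>h x\<close> be twice this limit and
  call \<open>h x + c\<close> the flux exponent of a transition with rate \<open>exp (\<beta>/2 * c)\<close>.  Conservation of flux
  through all cuts implies that every transition lies on a cycle of transitions with at least
  the same flux.  Hence strong transitions cannot lead out of a region irreversibly, and this is used
  on two scales.  First, following the fastest transitions from any state leads to a trap, where all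
  runs have length at least three and which is left at rate \<open>exp (- \<beta>\<kappa>/2)\<close> only; so no flux exponent
  exceeds \<open>- \<kappa>\<close>, and only states that are left as slowly as a trap can have \<open>h x = 0\<close>.  Second, no flux
  exponent between the basins of the traps exceeds \<open>- 2 * \<kappa>\<close>.  A trap with \<open>h x = 0\<close> and several clusters has
  flux of this order into traps of lower rank and finally to a single block \<open>eta p q\<close>, but no such flux
  leads back, since a block together with one hole or one free particle is a closed set at this level.
  The blocks with \<open>p \<ge> 3\<close> and \<open>q \<ge> 2\<close> exchange holes and particles with the reservoirs at this level in both
  directions, so they all have \<open>h x = 0\<close>.\<close>

section \<open>Functions with a logarithmic limit\<close>

text \<open>Detailed balance fails, because the reservoirs have different chemical potentials, and
  \<open>h\<close> is never computed. A bound on \<open>h\<close> at an unknown state is found by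
  following its flux to a trap, where \<open>h\<close> is at most 0 and all exits are known.
  Conversely, flux that enters a state has to leave it, so the fastest exit carries at least as
  much; this continues a path without knowing \<open>h\<close> on the way. The two levels come from
  breaking one bond. From a state with \<open>h\<close> equal to 0 this has flux
  \<open>- \<kappa>\<close>. The resulting state returns with exponent \<open>\<kappa>\<close>, so
  its \<open>h\<close> is \<open>- 2 * \<kappa>\<close>, and this is the flux of a neutral step that
  lets the defect escape. The bounds 3 and 2 also come from the level \<open>- \<kappa>\<close>: a
  first block of two gains a third particle, a last gap of one loses the particle beside it, and
  inner clusters or gaps of length two can be shifted. Runs of length three resist all of this. Of
  the reservoirs only \<open>m > \<kappa>\<close> and \<open>n > \<kappa>\<close> is known, so each
  comparison with them has to work with these bounds alone.\<close>

definition pos_asymp :: "(real \<Rightarrow> real) \<Rightarrow> bool" where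
  "pos_asymp f \<longleftrightarrow> (\<forall>\<beta>>0. f \<beta> > 0) \<and> (\<exists>h. log_asymp f h)"

text \<open>The first alternative is for absent transitions, whose rate vanishes for every
  \<open>\<beta>\<close>. The class is closed under sums, products and division by
  \<open>pos_asymp\<close> functions, the only operations in the elimination of states.\<close>

definition zero_or_asymp :: "(real \<Rightarrow> real) \<Rightarrow> bool" where
  "zero_or_asymp f \<longleftrightarrow> (\<forall>\<beta>>0. f \<beta> = 0) \<or> pos_asymp f"

lemma log_asymp_cong:
  assumes "\<And>\<beta>. \<beta> > 0 \<Longrightarrow> f \<beta> = g \<beta>"
  shows "log_asymp f h \<longleftrightarrow> log_asymp g h"
  unfolding log_asymp_def
  by (intro filterlim_cong refl eventually_mono[OF eventually_gt_at_top[of 0]]) (simp add: assms)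

lemma log_asymp_unique: "log_asymp f h \<Longrightarrow> log_asymp f h' \<Longrightarrow> h = h'"
  unfolding log_asymp_def by (rule tendsto_unique) auto

lemma log_asymp_mult:
  assumes "\<And>\<beta>. \<beta> > 0 \<Longrightarrow> f \<beta> > 0" "\<And>\<beta>. \<beta> > 0 \<Longrightarrow> g \<beta> > 0"
    and "log_asymp f a" "log_asymp g b"
  shows "log_asymp (\<lambda>\<beta>. f \<beta> * g \<beta>) (a + b)"
proof -
  have "((\<lambda>\<beta>. ln (f \<beta>) / \<beta> + ln (g \<beta>) / \<beta>) \<longlongrightarrow> a + b) at_top"
    using assms(3,4) unfolding log_asymp_def by (rule tendsto_add)
  moreover have "eventually (\<lambda>\<beta>. ln (f \<beta>) / \<beta> + ln (g \<beta>) / \<beta> = ln (f \<beta> * g \<beta>) / \<beta>) at_top"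
    using eventually_gt_at_top[of 0]
  proof eventually_elim
    case (elim \<beta>)
    with assms(1,2)[of \<beta>] show ?case by (simp add: ln_mult add_divide_distrib)
  qed
  ultimately show ?thesis
    unfolding log_asymp_def by (rule Lim_transform_eventually)
qed

lemma log_asymp_inverse:
  assumes "\<And>\<beta>. \<beta> > 0 \<Longrightarrow> f \<beta> > 0" and "log_asymp f a"
  shows "log_asymp (\<lambda>\<beta>. inverse (f \<beta>)) (- a)"
proof -
  have "((\<lambda>\<beta>. - (ln (f \<beta>) / \<beta>)) \<longlongrightarrow> - a) at_top"
    using assms(2) unfolding log_asymp_def by (rule tendsto_minus)
  moreover have "eventually (\<lambda>\<beta>. - (ln (f \<beta>) / \<beta>) = ln (inverse (f \<beta>)) / \<beta>) at_top"
    using eventually_gt_at_top[of 0]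
  proof eventually_elim
    case (elim \<beta>)
    with assms(1)[of \<beta>] show ?case by (simp add: ln_inverse)
  qed
  ultimately show ?thesis
    unfolding log_asymp_def by (rule Lim_transform_eventually)
qed

text \<open>The sum lies between the larger summand and twice the larger summand, and
  \<open>ln 2 / \<beta>\<close> vanishes in the limit.\<close>

lemma log_asymp_add:
  assumes f: "\<And>\<beta>. \<beta> > 0 \<Longrightarrow> f \<beta> > 0" and g: "\<And>\<beta>. \<beta> > 0 \<Longrightarrow> g \<beta> > 0"
    and "log_asymp f a" "log_asymp g b"
  shows "log_asymp (\<lambda>\<beta>. f \<beta> + g \<beta>) (max a b)"
proof -
  let ?m = "\<lambda>\<beta>. max (ln (f \<beta>) / \<beta>) (ln (g \<beta>) / \<beta>)"
  have m: "(?m \<longlongrightarrow> max a b) at_top"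
    using assms(3,4) unfolding log_asymp_def by (rule tendsto_max)
  have z: "((\<lambda>\<beta>::real. ln 2 / \<beta>) \<longlongrightarrow> 0) at_top"
    by (rule real_tendsto_divide_at_top[OF tendsto_const filterlim_ident])
  have m': "((\<lambda>\<beta>. ?m \<beta> + ln 2 / \<beta>) \<longlongrightarrow> max a b) at_top"
    using tendsto_add[OF m z] by simp
  have lo: "eventually (\<lambda>\<beta>. ?m \<beta> \<le> ln (f \<beta> + g \<beta>) / \<beta>) at_top"
    using eventually_gt_at_top[of 0]
  proof eventually_elim
    case (elim \<beta>)
    have "ln (f \<beta>) \<le> ln (f \<beta> + g \<beta>)" "ln (g \<beta>) \<le> ln (f \<beta> + g \<beta>)"
      using f[OF elim] g[OF elim] by auto
    then show ?case using elim by (simp add: divide_right_mono)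
  qed
  have hi: "eventually (\<lambda>\<beta>. ln (f \<beta> + g \<beta>) / \<beta> \<le> ?m \<beta> + ln 2 / \<beta>) at_top"
    using eventually_gt_at_top[of 0]
  proof eventually_elim
    case (elim \<beta>)
    have fg: "f \<beta> > 0" "g \<beta> > 0" using f[OF elim] g[OF elim] by auto
    show ?case
    proof (cases "f \<beta> \<le> g \<beta>")
      case True
      then have "ln (f \<beta> + g \<beta>) \<le> ln (2 * g \<beta>)" using fg by simp
      also have "\<dots> = ln 2 + ln (g \<beta>)" using fg by (simp add: ln_mult)
      finally have "ln (f \<beta> + g \<beta>) / \<beta> \<le> (ln 2 + ln (g \<beta>)) / \<beta>"
        using elim by (simp add: divide_right_mono)
      also have "\<dots> = ln (g \<beta>) / \<beta> + ln 2 / \<beta>" by (simp add: add_divide_distrib)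
      also have "\<dots> \<le> ?m \<beta> + ln 2 / \<beta>" by simp
      finally show ?thesis .
    next
      case False
      then have "ln (f \<beta> + g \<beta>) \<le> ln (2 * f \<beta>)" using fg by simp
      also have "\<dots> = ln 2 + ln (f \<beta>)" using fg by (simp add: ln_mult)
      finally have "ln (f \<beta> + g \<beta>) / \<beta> \<le> (ln 2 + ln (f \<beta>)) / \<beta>"
        using elim by (simp add: divide_right_mono)
      also have "\<dots> = ln (f \<beta>) / \<beta> + ln 2 / \<beta>" by (simp add: add_divide_distrib)
      also have "\<dots> \<le> ?m \<beta> + ln 2 / \<beta>" by simp
      finally show ?thesis .
    qed
  qed
  show ?thesis unfolding log_asymp_def
    by (rule tendsto_sandwich[OF lo hi m m'])
qed

lemma pos_asymp_pos: "pos_asymp f \<Longrightarrow> \<beta> > 0 \<Longrightarrow> f \<beta> > 0"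
  by (simp add: pos_asymp_def)

lemma pos_asymp_mult: "pos_asymp f \<Longrightarrow> pos_asymp g \<Longrightarrow> pos_asymp (\<lambda>\<beta>. f \<beta> * g \<beta>)"
  unfolding pos_asymp_def by (auto intro: log_asymp_mult)

lemma pos_asymp_inverse: "pos_asymp f \<Longrightarrow> pos_asymp (\<lambda>\<beta>. inverse (f \<beta>))"
  unfolding pos_asymp_def by (auto intro: log_asymp_inverse)

lemma pos_asymp_divide: "pos_asymp f \<Longrightarrow> pos_asymp g \<Longrightarrow> pos_asymp (\<lambda>\<beta>. f \<beta> / g \<beta>)"
  unfolding divide_inverse by (intro pos_asymp_mult pos_asymp_inverse)

lemma pos_asymp_add: "pos_asymp f \<Longrightarrow> pos_asymp g \<Longrightarrow> pos_asymp (\<lambda>\<beta>. f \<beta> + g \<beta>)"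
  unfolding pos_asymp_def by (auto intro: log_asymp_add add_pos_pos)

lemma pos_asymp_cong:
  assumes "\<And>\<beta>. \<beta> > 0 \<Longrightarrow> f \<beta> = g \<beta>"
  shows "pos_asymp f \<longleftrightarrow> pos_asymp g"
  unfolding pos_asymp_def using log_asymp_cong[of f g, OF assms] assms by auto

lemma zero_or_asymp_nonneg: "zero_or_asymp f \<Longrightarrow> \<beta> > 0 \<Longrightarrow> f \<beta> \<ge> 0"
  by (force simp: zero_or_asymp_def pos_asymp_def)

lemma zero_or_asymp_mult:
  "zero_or_asymp f \<Longrightarrow> zero_or_asymp g \<Longrightarrow> zero_or_asymp (\<lambda>\<beta>. f \<beta> * g \<beta>)"
  by (auto simp: zero_or_asymp_def intro: pos_asymp_mult)

lemma zero_or_asymp_divide: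
  "zero_or_asymp f \<Longrightarrow> pos_asymp g \<Longrightarrow> zero_or_asymp (\<lambda>\<beta>. f \<beta> / g \<beta>)"
  by (auto simp: zero_or_asymp_def intro: pos_asymp_divide)

lemma pos_asymp_add_zero_or_asymp:
  assumes "pos_asymp f" "zero_or_asymp g"
  shows "pos_asymp (\<lambda>\<beta>. f \<beta> + g \<beta>)"
  using assms(2) unfolding zero_or_asymp_def
proof
  assume "\<forall>\<beta>>0. g \<beta> = 0"
  then show ?thesis using assms(1) pos_asymp_cong[of "\<lambda>\<beta>. f \<beta> + g \<beta>" f] by simp
qed (use assms(1) pos_asymp_add in blast)

lemma zero_or_asymp_add:
  assumes "zero_or_asymp f" "zero_or_asymp g"
  shows "zero_or_asymp (\<lambda>\<beta>. f \<beta> + g \<beta>)"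
proof (cases "\<forall>\<beta>>0. f \<beta> = 0")
  case True
  then show ?thesis using assms(2) pos_asymp_cong[of "\<lambda>\<beta>. f \<beta> + g \<beta>" g]
    by (auto simp: zero_or_asymp_def)
next
  case False
  then show ?thesis using assms pos_asymp_add_zero_or_asymp
    by (auto simp: zero_or_asymp_def)
qed

lemma zero_or_asymp_sum:
  "finite A \<Longrightarrow> (\<And>x. x \<in> A \<Longrightarrow> zero_or_asymp (f x)) \<Longrightarrow> zero_or_asymp (\<lambda>\<beta>. \<Sum>x\<in>A. f x \<beta>)"
  by (induction A rule: finite_induct) (auto simp: zero_or_asymp_def[of "\<lambda>_. 0"] intro: zero_or_asymp_add)

lemma pos_asymp_sum:
  assumes "finite A" "\<And>x. x \<in> A \<Longrightarrow> zero_or_asymp (f x)" "a \<in> A" "pos_asymp (f a)"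
  shows "pos_asymp (\<lambda>\<beta>. \<Sum>x\<in>A. f x \<beta>)"
proof -
  have "zero_or_asymp (\<lambda>\<beta>. \<Sum>x\<in>A-{a}. f x \<beta>)"
    using assms by (intro zero_or_asymp_sum) auto
  with assms(4) have "pos_asymp (\<lambda>\<beta>. f a \<beta> + (\<Sum>x\<in>A-{a}. f x \<beta>))"
    by (rule pos_asymp_add_zero_or_asymp)
  then show ?thesis using assms(1,3) by (simp add: sum.remove[of A a])
qed

text \<open>Induction on the number of states.  A state \<open>z\<close> is eliminated by rerouting its traffic,
  \<open>r'(x,y) = r(x,y) + r(x,z) r(z,y) / R(z)\<close>, where \<open>R(z)\<close> is the total exit rate of \<open>z\<close>.  The
  formula contains no subtraction, so it stays inside the class of functions with a
  logarithmic limit.\<close>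

lemma stationary_ratio_asymp:
  fixes r :: "'a \<Rightarrow> 'a \<Rightarrow> real \<Rightarrow> real" and w :: "'a \<Rightarrow> real \<Rightarrow> real"
  assumes "finite S" "S \<noteq> {}"
    and "\<And>x y. x \<in> S \<Longrightarrow> y \<in> S \<Longrightarrow> x \<noteq> y \<Longrightarrow> zero_or_asymp (r x y)"
    and "\<And>A. A \<subset> S \<Longrightarrow> A \<noteq> {} \<Longrightarrow> \<exists>x\<in>A. \<exists>y\<in>S-A. pos_asymp (r x y)"
    and "\<And>x \<beta>. x \<in> S \<Longrightarrow> \<beta> > 0 \<Longrightarrow> w x \<beta> \<ge> 0"
    and "\<And>\<beta>. \<beta> > 0 \<Longrightarrow> \<exists>x\<in>S. w x \<beta> \<noteq> 0"
    and "\<And>y \<beta>. y \<in> S \<Longrightarrow> \<beta> > 0 \<Longrightarrow>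
           (\<Sum>x\<in>S-{y}. w x \<beta> * r x y \<beta>) = w y \<beta> * (\<Sum>z\<in>S-{y}. r y z \<beta>)"
    and "x \<in> S" "y \<in> S"
  shows "(\<forall>\<beta>>0. w x \<beta> > 0) \<and> pos_asymp (\<lambda>\<beta>. w x \<beta> / w y \<beta>)"
  using assms
proof (induction "card S" arbitrary: S r x y rule: less_induct)
  case less
  note fin = less.prems(1) and rates = less.prems(3) and irred = less.prems(4)
    and nonneg = less.prems(5) and nz = less.prems(6) and bal = less.prems(7)
  have one: "pos_asymp (\<lambda>_. 1)"
    by (auto simp: pos_asymp_def log_asymp_def intro!: exI[of _ 0])
  show ?case
  proof (cases "S = {x}")
    case True
    then have xx: "y = x" using less.prems by auto
    have pos: "w x \<beta> > 0" if "\<beta> > 0" for \<beta>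
      using nz[OF that] nonneg[OF _ that] True by force
    then show ?thesis using one pos_asymp_cong[of "\<lambda>\<beta>. w x \<beta> / w y \<beta>" "\<lambda>_. 1"]
      by (force simp: xx)
  next
    case False
    obtain z where z: "z \<in> S" "z \<noteq> x" using False less.prems(8) by auto
    define S' where "S' = S - {z}"
    have S': "finite S'" "S' \<noteq> {}" "card S' < card S" "x \<in> S'" "z \<notin> S'" "S = insert z S'"
      using z fin less.prems(8) card_Diff1_less[OF fin z(1)] by (auto simp: S'_def)
    define R where "R = (\<lambda>\<beta>. \<Sum>u\<in>S'. r z u \<beta>)"
    define r' where "r' = (\<lambda>x y \<beta>. r x y \<beta> + r x z \<beta> * r z y \<beta> / R \<beta>)"
    have zS: "zero_or_asymp (r z u)" "zero_or_asymp (r u z)" if "u \<in> S'" for u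
      using that rates[of z u] rates[of u z] S' by auto
    have posR: "pos_asymp R"
    proof -
      have "\<exists>x\<in>{z}. \<exists>y\<in>S-{z}. pos_asymp (r x y)" using irred[of "{z}"] S' by auto
      then obtain u where "u \<in> S'" "pos_asymp (r z u)" by (auto simp: S'_def)
      then show ?thesis unfolding R_def by (intro pos_asymp_sum[of S' "r z" u]) (use S' zS in auto)
    qed
    have balz: "(\<Sum>u\<in>S'. w u \<beta> * r u z \<beta>) = w z \<beta> * R \<beta>" if "\<beta> > 0" for \<beta>
      using bal[OF z(1) that] by (simp add: R_def S'_def)
    have r'_zoa: "zero_or_asymp (r' u v)" if "u \<in> S'" "v \<in> S'" "u \<noteq> v" for u v
      unfolding r'_def
      by (intro zero_or_asymp_add zero_or_asymp_divide zero_or_asymp_mult posR zS that)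
         (use that S' rates in auto)
    have irred': "\<exists>u\<in>A. \<exists>v\<in>S'-A. pos_asymp (r' u v)" if A: "A \<subset> S'" "A \<noteq> {}" for A
    proof -
      have direct: ?thesis if uv: "u \<in> A" "v \<in> S' - A" "pos_asymp (r u v)" for u v
      proof -
        have "zero_or_asymp (\<lambda>\<beta>. r u z \<beta> * r z v \<beta> / R \<beta>)"
          using uv A by (intro zero_or_asymp_divide zero_or_asymp_mult posR zS) auto
        then have "pos_asymp (r' u v)" unfolding r'_def
          by (rule pos_asymp_add_zero_or_asymp[OF uv(3)])
        then show ?thesis using uv by blast
      qed
      obtain u v where uv: "u \<in> A" "v \<in> S - A" "pos_asymp (r u v)"
        using irred[of A] A unfolding S'_def by blast
      \<comment> \<open>Irreducibility is applied to both \<open>A\<close> and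
        \<open>insert z A\<close>. If one of the two edges avoids \<open>z\<close>, it survives in
        \<open>S'\<close>; otherwise they form a path \<open>u\<close>, \<open>z\<close>,
        \<open>v'\<close>, which the rerouted rate shortcuts.\<close>
      have sub: "insert z A \<subset> S" using A z(1) unfolding S'_def by blast
      obtain u' v' where uv': "u' \<in> insert z A" "v' \<in> S - insert z A" "pos_asymp (r u' v')"
        using irred[OF sub] by blast
      show ?thesis
      proof (cases "v = z \<and> u' = z")
        case False
        then consider "v \<noteq> z" | "u' \<noteq> z" by blast
        then show ?thesis
          by cases (use direct[of u v] direct[of u' v'] uv uv' in \<open>auto simp: S'_def\<close>)
      next
        case True
        have v': "v' \<in> S' - A" using uv' by (auto simp: S'_def)
        have ne: "u \<noteq> v'" using uv v' by auto
        have "pos_asymp (\<lambda>\<beta>. r u z \<beta> * r z v' \<beta> / R \<beta>)"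
          using uv uv' True by (intro pos_asymp_divide pos_asymp_mult posR) auto
        moreover have "zero_or_asymp (r u v')" using rates[of u v'] uv v' ne A by (auto simp: S'_def)
        ultimately have "pos_asymp (\<lambda>\<beta>. r u z \<beta> * r z v' \<beta> / R \<beta> + r u v' \<beta>)"
          by (rule pos_asymp_add_zero_or_asymp)
        then have "pos_asymp (r' u v')" by (simp add: r'_def add.commute)
        then show ?thesis using uv v' by blast
      qed
    qed
    \<comment> \<open>The restricted weights no longer add up to one, so the induction carries only
      that some weight is nonzero. If all weights on \<open>S'\<close> vanished, balance at
      \<open>z\<close> would force \<open>w z\<close> to vanish too.\<close>
    have nz': "\<exists>u\<in>S'. w u \<beta> \<noteq> 0" if b: "\<beta> > 0" for \<beta>
    proof (rule ccontr)
      assume "\<not> ?thesis"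
      then have all0: "\<And>u. u \<in> S' \<Longrightarrow> w u \<beta> = 0" by auto
      then have "w z \<beta> * R \<beta> = 0" using balz[OF b] by simp
      then have "w z \<beta> = 0" using pos_asymp_pos[OF posR b] by auto
      with all0 nz[OF b] S' show False by auto
    qed
    have bal': "(\<Sum>u\<in>S'-{v}. w u \<beta> * r' u v \<beta>) = w v \<beta> * (\<Sum>u\<in>S'-{v}. r' v u \<beta>)"
      if v: "v \<in> S'" and b: "\<beta> > 0" for v \<beta>
    proof -
      have R0: "R \<beta> \<noteq> 0" using pos_asymp_pos[OF posR b] by auto
      have Sv: "S - {v} = insert z (S' - {v})" "z \<notin> S' - {v}" "finite (S' - {v})" using v S' by auto
      \<comment> \<open>Subtractions are harmless here, since \<open>\<beta>\<close> is fixed. The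
        loops from \<open>v\<close> through \<open>z\<close> back to \<open>v\<close> are absent on
        both sides of the reduced equation.\<close>
      have in1: "(\<Sum>u\<in>S'-{v}. w u \<beta> * r u v \<beta>)
          = w v \<beta> * (r v z \<beta> + (\<Sum>u\<in>S'-{v}. r v u \<beta>)) - w z \<beta> * r z v \<beta>"
        using bal[of v \<beta>] v b S' Sv by simp
      have in2: "(\<Sum>u\<in>S'-{v}. w u \<beta> * r u z \<beta>) = w z \<beta> * R \<beta> - w v \<beta> * r v z \<beta>"
        using balz[OF b] v S' by (simp add: sum.remove[of S' v])
      have out2: "(\<Sum>u\<in>S'-{v}. r z u \<beta>) = R \<beta> - r z v \<beta>"
        using v S' by (simp add: R_def sum.remove[of S' v])
      have "(\<Sum>u\<in>S'-{v}. w u \<beta> * r' u v \<beta>)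
          = (\<Sum>u\<in>S'-{v}. w u \<beta> * r u v \<beta>) + (\<Sum>u\<in>S'-{v}. w u \<beta> * r u z \<beta>) * (r z v \<beta> / R \<beta>)"
        by (simp add: r'_def distrib_left sum.distrib sum_distrib_right sum_divide_distrib mult.assoc)
      also have "\<dots> = w v \<beta> * ((r v z \<beta> + (\<Sum>u\<in>S'-{v}. r v u \<beta>)) - r v z \<beta> * r z v \<beta> / R \<beta>)"
        unfolding in1 in2 using R0 by (simp add: field_simps)
      also have "\<dots> = w v \<beta> * ((\<Sum>u\<in>S'-{v}. r v u \<beta>) + r v z \<beta> / R \<beta> * (\<Sum>u\<in>S'-{v}. r z u \<beta>))"
        unfolding out2 using R0 by (simp add: field_simps)
      also have "\<dots> = w v \<beta> * (\<Sum>u\<in>S'-{v}. r' v u \<beta>)"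
        by (simp add: r'_def sum.distrib sum_distrib_left sum_divide_distrib)
      finally show ?thesis .
    qed
    have IH: "(\<forall>\<beta>>0. w u \<beta> > 0) \<and> pos_asymp (\<lambda>\<beta>. w u \<beta> / w v \<beta>)" if "u \<in> S'" "v \<in> S'" for u v
      by (rule less.hyps[OF S'(3,1,2) r'_zoa irred' _ nz' bal' that]) (use nonneg S' in auto)
    have wpos: "w u \<beta> > 0" if "u \<in> S'" "\<beta> > 0" for u \<beta> using IH[OF that(1) that(1)] that by auto
    \<comment> \<open>The balance equation at \<open>z\<close> recovers its weight as a sum of
      nonnegative inflows divided by \<open>R\<close>; irreducibility supplies one inflow that is
      positive.\<close>
    have zx: "pos_asymp (\<lambda>\<beta>. w z \<beta> / w x \<beta>)"
    proof -
      have "S' \<subset> S" using z by (auto simp: S'_def)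
      then obtain u v where "u \<in> S'" "v \<in> S - S'" "pos_asymp (r u v)"
        using irred S'(2) by blast
      then have u: "u \<in> S'" "pos_asymp (r u z)" by (auto simp: S'_def)
      have "pos_asymp (\<lambda>\<beta>. \<Sum>u\<in>S'. w u \<beta> / w x \<beta> * r u z \<beta>)"
      proof (rule pos_asymp_sum[of S' "\<lambda>u \<beta>. w u \<beta> / w x \<beta> * r u z \<beta>" u])
        have q: "pos_asymp (\<lambda>\<beta>. w v \<beta> / w x \<beta>)" if "v \<in> S'" for v
          using IH[OF that S'(4)] by blast
        show "zero_or_asymp (\<lambda>\<beta>. w v \<beta> / w x \<beta> * r v z \<beta>)" if "v \<in> S'" for v
          using q[OF that] zS(2)[OF that] by (intro zero_or_asymp_mult) (auto simp: zero_or_asymp_def)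
        show "pos_asymp (\<lambda>\<beta>. w u \<beta> / w x \<beta> * r u z \<beta>)"
          by (rule pos_asymp_mult[OF q[OF u(1)] u(2)])
      qed (use u S' in auto)
      then have "pos_asymp (\<lambda>\<beta>. (\<Sum>u\<in>S'. w u \<beta> / w x \<beta> * r u z \<beta>) / R \<beta>)"
        by (rule pos_asymp_divide[OF _ posR])
      moreover have "(\<Sum>u\<in>S'. w u \<beta> / w x \<beta> * r u z \<beta>) / R \<beta> = w z \<beta> / w x \<beta>" if "\<beta> > 0" for \<beta>
      proof -
        have "(\<Sum>u\<in>S'. w u \<beta> / w x \<beta> * r u z \<beta>) = (\<Sum>u\<in>S'. w u \<beta> * r u z \<beta>) / w x \<beta>"
          by (simp add: sum_divide_distrib)
        then show ?thesis using balz[OF that] pos_asymp_pos[OF posR that] by simp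
      qed
      ultimately show ?thesis using pos_asymp_cong by (metis (mono_tags, lifting))
    qed
    have xy: "pos_asymp (\<lambda>\<beta>. w x \<beta> / w y \<beta>)"
    proof (cases "y = z")
      case True
      then show ?thesis using pos_asymp_inverse[OF zx] by simp
    next
      case False
      then show ?thesis using IH less.prems S' by auto
    qed
    then show ?thesis using wpos S' by auto
  qed
qed

text \<open>Normalisation turns ratios into weights: \<open>w x\<close> is the reciprocal of the sum
  of all \<open>w u / w x\<close>, again without subtraction.\<close>

lemma stationary_asymp:
  fixes r :: "'a \<Rightarrow> 'a \<Rightarrow> real \<Rightarrow> real" and w :: "'a \<Rightarrow> real \<Rightarrow> real"
  assumes fin: "finite S" and ne: "S \<noteq> {}"
    and rates: "\<And>x y. x \<in> S \<Longrightarrow> y \<in> S \<Longrightarrow> x \<noteq> y \<Longrightarrow> zero_or_asymp (r x y)"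
    and irred: "\<And>A. A \<subset> S \<Longrightarrow> A \<noteq> {} \<Longrightarrow> \<exists>x\<in>A. \<exists>y\<in>S-A. pos_asymp (r x y)"
    and nonneg: "\<And>x \<beta>. x \<in> S \<Longrightarrow> \<beta> > 0 \<Longrightarrow> w x \<beta> \<ge> 0"
    and one: "\<And>\<beta>. \<beta> > 0 \<Longrightarrow> (\<Sum>x\<in>S. w x \<beta>) = 1"
    and bal: "\<And>y \<beta>. y \<in> S \<Longrightarrow> \<beta> > 0 \<Longrightarrow>
           (\<Sum>x\<in>S-{y}. w x \<beta> * r x y \<beta>) = w y \<beta> * (\<Sum>z\<in>S-{y}. r y z \<beta>)"
    and x: "x \<in> S"
  shows "pos_asymp (w x)"
proof -
  have nz: "\<exists>x\<in>S. w x \<beta> \<noteq> 0" if "\<beta> > 0" for \<beta>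
    using one[OF that] by (metis sum.neutral zero_neq_one)
  have A: "(\<forall>\<beta>>0. w u \<beta> > 0) \<and> pos_asymp (\<lambda>\<beta>. w u \<beta> / w v \<beta>)" if "u \<in> S" "v \<in> S" for u v
    by (rule stationary_ratio_asymp[OF fin ne rates irred nonneg nz bal that]) auto
  have "pos_asymp (\<lambda>\<beta>. \<Sum>u\<in>S. w u \<beta> / w x \<beta>)"
    by (rule pos_asymp_sum[of S "\<lambda>u \<beta>. w u \<beta> / w x \<beta>" x])
       (use fin x A[of x x] A[OF _ x] in \<open>auto simp: zero_or_asymp_def simp del: divide_self_if\<close>)
  then have "pos_asymp (\<lambda>\<beta>. inverse (\<Sum>u\<in>S. w u \<beta> / w x \<beta>))" by (rule pos_asymp_inverse)
  moreover have "inverse (\<Sum>u\<in>S. w u \<beta> / w x \<beta>) = w x \<beta>" if "\<beta> > 0" for \<beta>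
    using one[OF that] by (simp flip: sum_divide_distrib)
  ultimately show ?thesis using pos_asymp_cong by (metis (mono_tags, lifting))
qed

section \<open>Transitions and the rank of a configuration\<close>

lemma occ_simps [simp]: "x i \<Longrightarrow> occ x i = 1" "\<not> x i \<Longrightarrow> occ x i = 0"
  by (auto simp: occ_def)

lemma occ_bounds: "0 \<le> occ x i" "occ x i \<le> 1"
  by (auto simp: occ_def)

lemma occ_upd [simp]: "occ (x(i := b)) j = (if j = i then (if b then 1 else 0) else occ x j)"
  by (simp add: occ_def)

lemma configs_outside: "x \<in> configs N \<Longrightarrow> i = 0 \<or> i > N \<Longrightarrow> \<not> x i"
  by (auto simp: configs_def)

lemma configs_upd: "x \<in> configs N \<Longrightarrow> 1 \<le> i \<Longrightarrow> i \<le> N \<Longrightarrow> x(i := b) \<in> configs N"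
  by (auto simp: configs_def)

lemma finite_configs: "finite (configs N)"
proof (rule finite_subset)
  show "configs N \<subseteq> (\<lambda>S i. i \<in> S) ` Pow {1..N}"
  proof
    fix x assume "x \<in> configs N"
    then have "x = (\<lambda>i. i \<in> {i. x i})" "{i. x i} \<in> Pow {1..N}" by (auto simp: configs_def)
    then show "x \<in> (\<lambda>S i. i \<in> S) ` Pow {1..N}" by blast
  qed
qed auto

section \<open>Counting bonds, particles and the moment\<close>

definition bonds :: "nat \<Rightarrow> config \<Rightarrow> real" where
  "bonds N x = (\<Sum>i\<in>{1..<N}. occ x i * occ x (i+1))"

definition particles :: "nat \<Rightarrow> config \<Rightarrow> real" where
  "particles N x = (\<Sum>i\<in>{1..N}. occ x i)"

definition moment :: "nat \<Rightarrow> config \<Rightarrow> real" where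
  "moment N x = (\<Sum>i\<in>{1..<N}. real i * occ x i)"

lemma sum_occ_add:
  fixes f :: "nat \<Rightarrow> real"
  assumes "finite A" "i \<in> A" "\<not> x i"
  shows "(\<Sum>k\<in>A. f k * occ (x(i := True)) k) = (\<Sum>k\<in>A. f k * occ x k) + f i"
proof -
  have "(\<Sum>k\<in>A - {i}. f k * occ (x(i := True)) k) = (\<Sum>k\<in>A - {i}. f k * occ x k)"
    by (intro sum.cong) auto
  then show ?thesis
    using sum.remove[OF assms(1,2), of "\<lambda>k. f k * occ (x(i := True)) k"]
      sum.remove[OF assms(1,2), of "\<lambda>k. f k * occ x k"] assms(3) by simp
qed

lemma particles_add: "1 \<le> i \<Longrightarrow> i \<le> N \<Longrightarrow> \<not> x i \<Longrightarrow> particles N (x(i := True)) = particles N x + 1"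
  using sum_occ_add[of "{1..N}" i x "\<lambda>_. 1"] unfolding particles_def by (simp del: occ_upd)

lemma moment_add:
  assumes "1 \<le> i" "\<not> x i"
  shows "moment N (x(i := True)) = moment N x + (if i < N then real i else 0)"
proof (cases "i < N")
  case True
  then show ?thesis using sum_occ_add[of "{1..<N}" i x real] assms unfolding moment_def
    by (simp del: occ_upd)
next
  case False
  then have "(\<Sum>k\<in>{1..<N}. real k * occ (x(i := True)) k) = (\<Sum>k\<in>{1..<N}. real k * occ x k)"
    by (intro sum.cong) auto
  then show ?thesis using False by (simp add: moment_def)
qed

text \<open>With the vacant sites \<open>0\<close> and \<open>N + 1\<close> included, the end sites
  have two neighbours like all others, so \<open>bonds_add\<close> needs no boundary cases.\<close>

lemma bonds_eq:
  assumes "x \<in> configs N"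
  shows "bonds N x = (\<Sum>i\<le>N. occ x i * occ x (Suc i))"
proof -
  have "(\<Sum>i\<in>{1..<N}. occ x i * occ x (Suc i)) = (\<Sum>i\<le>N. occ x i * occ x (Suc i))"
  proof (rule sum.mono_neutral_left)
    show "\<forall>i\<in>{..N} - {1..<N}. occ x i * occ x (Suc i) = 0"
    proof
      fix i assume "i \<in> {..N} - {1..<N}"
      then have "i = 0 \<or> Suc i > N" by auto
      then show "occ x i * occ x (Suc i) = 0" using configs_outside[OF assms] by fastforce
    qed
  qed auto
  then show ?thesis by (simp add: bonds_def)
qed

lemma bonds_add:
  assumes x: "x \<in> configs N" and j: "Suc j \<le> N" "\<not> x (Suc j)"
  shows "bonds N (x(Suc j := True)) = bonds N x + occ x j + occ x (Suc (Suc j))"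
proof -
  let ?y = "x(Suc j := True)"
  have y: "?y \<in> configs N" using x j by (intro configs_upd) auto
  have "(\<Sum>i\<in>{..N} - {Suc j} - {j}. occ ?y i * occ ?y (Suc i))
      = (\<Sum>i\<in>{..N} - {Suc j} - {j}. occ x i * occ x (Suc i))"
    by (intro sum.cong) auto
  then show ?thesis using j unfolding bonds_eq[OF x] bonds_eq[OF y]
    by (simp add: sum.remove[of "{..N}" "Suc j"] sum.remove[of "{..N} - {Suc j}" j])
qed

text \<open>The transitions with their rates in the form \<open>exp (\<beta>/2 * c)\<close>, with
  \<open>m\<close> standing for \<open>\<mu>L\<close> and \<open>n\<close> for \<open>- \<mu>R\<close>.\<close>

inductive step :: "nat \<Rightarrow> real \<Rightarrow> real \<Rightarrow> real \<Rightarrow> config \<Rightarrow> config \<Rightarrow> real \<Rightarrow> bool"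
  for N \<kappa> m n where
  hopR: "x \<in> configs N \<Longrightarrow> Suc (Suc j) \<le> N \<Longrightarrow> x (Suc j) \<Longrightarrow> \<not> x (Suc (Suc j)) \<Longrightarrow>
    step N \<kappa> m n x (x(Suc j := False, Suc (Suc j) := True)) (\<kappa> * (occ x (Suc (Suc (Suc j))) - occ x j))"
| hopL: "x \<in> configs N \<Longrightarrow> Suc (Suc j) \<le> N \<Longrightarrow> \<not> x (Suc j) \<Longrightarrow> x (Suc (Suc j)) \<Longrightarrow>
    step N \<kappa> m n x (x(Suc j := True, Suc (Suc j) := False)) (\<kappa> * (occ x j - occ x (Suc (Suc (Suc j)))))"
| fill: "x \<in> configs N \<Longrightarrow> \<not> x 1 \<Longrightarrow> step N \<kappa> m n x (x(1 := True)) (m + \<kappa> * occ x 2)"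
| unfill: "x \<in> configs N \<Longrightarrow> x 1 \<Longrightarrow> step N \<kappa> m n x (x(1 := False)) (- (m + \<kappa> * occ x 2))"
| kill: "x \<in> configs N \<Longrightarrow> x N \<Longrightarrow> step N \<kappa> m n x (x(N := False)) (n - \<kappa> * occ x (N - 1))"
| create: "x \<in> configs N \<Longrightarrow> \<not> x N \<Longrightarrow> step N \<kappa> m n x (x(N := True)) (- (n - \<kappa> * occ x (N - 1)))"

lemma step_configs:
  assumes "step N \<kappa> m n x y c" "1 \<le> N"
  shows "x \<in> configs N" "y \<in> configs N"
  using assms by (auto elim!: step.cases intro!: configs_upd)

text \<open>Both \<open>x\<close> and \<open>y\<close> arise from the configuration \<open>b\<close>
  without the hopping particle by adding one particle. A particle that arrives at \<open>N\<close>
  loses its whole contribution \<open>Suc j\<close> to the moment.\<close>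

lemma hopR_change:
  assumes x: "x \<in> configs N" and j: "Suc (Suc j) \<le> N" "x (Suc j)" "\<not> x (Suc (Suc j))"
    and y: "y = x(Suc j := False, Suc (Suc j) := True)"
  shows "bonds N y = bonds N x + occ x (Suc (Suc (Suc j))) - occ x j"
    and "particles N y = particles N x"
    and "moment N y = moment N x + (if Suc (Suc j) < N then 1 else - real (Suc j))"
proof -
  define b where "b = x(Suc j := False)"
  have b: "b \<in> configs N" using x j unfolding b_def by (intro configs_upd) auto
  have x': "x = b(Suc j := True)" using j by (auto simp: b_def fun_eq_iff)
  have y': "y = b(Suc (Suc j) := True)" by (auto simp: b_def y)
  have nb: "\<not> b (Suc j)" "\<not> b (Suc (Suc j))" using j by (auto simp: b_def)
  have o: "occ b j = occ x j" "occ b (Suc (Suc (Suc j))) = occ x (Suc (Suc (Suc j)))" by (auto simp: b_def)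
  show "bonds N y = bonds N x + occ x (Suc (Suc (Suc j))) - occ x j"
    using bonds_add[of b N j] bonds_add[of b N "Suc j"] b nb j o unfolding x'[symmetric] y'[symmetric]
    by simp
  show "particles N y = particles N x"
    using particles_add[of "Suc j" N b] particles_add[of "Suc (Suc j)" N b] nb j
    unfolding x'[symmetric] y'[symmetric] by simp
  show "moment N y = moment N x + (if Suc (Suc j) < N then 1 else - real (Suc j))"
    using moment_add[of "Suc j" b N] moment_add[of "Suc (Suc j)" b N] nb j
    unfolding x'[symmetric] y'[symmetric] by simp
qed

lemma hopL_change:
  assumes x: "x \<in> configs N" and j: "Suc (Suc j) \<le> N" "\<not> x (Suc j)" "x (Suc (Suc j))"
    and y: "y = x(Suc j := True, Suc (Suc j) := False)"
  shows "bonds N y = bonds N x + occ x j - occ x (Suc (Suc (Suc j)))"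
    and "particles N y = particles N x"
    and "moment N y = moment N x - (if Suc (Suc j) < N then 1 else - real (Suc j))"
proof -
  have y': "y \<in> configs N" unfolding y using x j by (intro configs_upd) auto
  have x': "x = y(Suc j := False, Suc (Suc j) := True)" using j y by (auto simp: fun_eq_iff)
  have yj: "y (Suc j)" "\<not> y (Suc (Suc j))" "occ y j = occ x j" "occ y (Suc (Suc (Suc j))) = occ x (Suc (Suc (Suc j)))"
    by (auto simp: y)
  note c = hopR_change[OF y' j(1) yj(1,2) x']
  show "bonds N y = bonds N x + occ x j - occ x (Suc (Suc (Suc j)))" using c(1) yj by simp
  show "particles N y = particles N x" using c(2) by simp
  show "moment N y = moment N x - (if Suc (Suc j) < N then 1 else - real (Suc j))" using c(3) by simp
qed

text \<open>A Lyapunov function for the fastest transitions.  Up to bounded corrections it is six times the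
  number of clusters (particles minus bonds), which only the filling of the left end can increase
  among the fast moves.  The second
  summand and the vacancy weights at the first three sites take care of the filling of the left end,
  and the moment decreases when particles move to the left.  Site \<open>N\<close> is left out of
  the moment so that the rank does not see the right flip next to an occupied site.\<close>

definition config_rank :: "nat \<Rightarrow> config \<Rightarrow> real" where
  "config_rank N x = 6 * (particles N x - bonds N x + (if x 1 \<or> x 2 then 0 else 1))
     - 4 * (occ x 1 + 2 * occ x 2 + occ x 3) + moment N x"

section \<open>Change of the rank under single transitions\<close>

lemma rank_kill:
  assumes "5 \<le> N" "x \<in> configs N" "x N"
  shows "config_rank N (x(N := False)) = config_rank N x - 6 * (1 - occ x (N - 1))"
proof -
  define b where "b = x(N := False)"
  obtain j where j: "N = Suc j" using assms by (cases N) auto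
  have b: "b \<in> configs N" using assms unfolding b_def by (intro configs_upd) auto
  have x': "x = b(N := True)" using assms by (auto simp: b_def fun_eq_iff)
  have nb: "\<not> b N" by (simp add: b_def)
  have out: "occ b (Suc N) = 0" using configs_outside[OF b] by simp
  have "bonds N x = bonds N b + occ x (N - 1)"
    using bonds_add[of b N j, folded j] b nb out j unfolding x'[symmetric] by (simp add: b_def)
  moreover have "particles N x = particles N b + 1"
    using particles_add[of N N b] nb assms(1) unfolding x'[symmetric] by simp
  moreover have "moment N x = moment N b"
    using moment_add[of N b N] nb assms(1) unfolding x'[symmetric] by simp
  moreover have "x 1 = b 1" "x 2 = b 2" "occ x 1 = occ b 1" "occ x 2 = occ b 2" "occ x 3 = occ b 3"
    using assms(1) by (auto simp: b_def)
  ultimately show ?thesis unfolding b_def[symmetric] config_rank_def by simp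
qed

text \<open>If site 2 is vacant, the new cluster costs 6, but the vacancy of sites 1 and 2 is no
  longer charged 6; if site 2 is occupied, neither term changes. What remains is 1 from the moment
  and -4 from the weight of site 1.\<close>

lemma rank_fill:
  assumes "5 \<le> N" "x \<in> configs N" "\<not> x 1"
  shows "config_rank N (x(1 := True)) = config_rank N x - 3"
proof -
  define y where "y = x(1 := True)"
  have o: "occ x 0 = 0" using configs_outside[OF assms(2)] by simp
  have "bonds N y = bonds N x + occ x 2"
    using bonds_add[of x N 0] assms o by (simp add: y_def numeral_2_eq_2)
  moreover have "particles N y = particles N x + 1"
    using particles_add[of 1 N x] assms by (simp add: y_def)
  moreover have "moment N y = moment N x + 1"
    using moment_add[of 1 x N] assms by (simp add: y_def)
  moreover have "y 1" "occ y 1 = 1" "occ y 2 = occ x 2" "occ y 3 = occ x 3" "occ x 1 = 0"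
    using assms by (auto simp: y_def)
  ultimately show ?thesis unfolding y_def[symmetric] config_rank_def using assms(3) by (cases "x 2") auto
qed

text \<open>The last summand is the change of the weights 4, 8, 4 of the first three sites. For
  \<open>j = 1\<close> and site 1 vacant, the hop leaves sites 1 and 2 both vacant, which adds
  6.\<close>

lemma rank_hopR:
  assumes "5 \<le> N" "x \<in> configs N" "Suc (Suc j) \<le> N" "x (Suc j)" "\<not> x (Suc (Suc j))"
    and y: "y = x(Suc j := False, Suc (Suc j) := True)"
  shows "config_rank N y = config_rank N x - 6 * (occ x (Suc (Suc (Suc j))) - occ x j)
           + (if Suc (Suc j) < N then 1 else - real (Suc j))
           + (if j = 0 then - 4 else if j = 1 then 4 + (if x 1 then 0 else 6) else if j = 2 then 4 else 0)"
proof -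
  note c = hopR_change[OF assms(2-6)]
  consider "j = 0" | "j = 1" | "j = 2" | "j \<ge> 3" by linarith
  then show ?thesis
    unfolding config_rank_def c using assms(4,5)
    by cases (auto simp: y numeral_2_eq_2 numeral_3_eq_3)
qed

lemma rank_hopL:
  assumes "5 \<le> N" "x \<in> configs N" "Suc (Suc j) \<le> N" "\<not> x (Suc j)" "x (Suc (Suc j))"
    and y: "y = x(Suc j := True, Suc (Suc j) := False)"
  shows "config_rank N y = config_rank N x - 6 * (occ x j - occ x (Suc (Suc (Suc j))))
           - (if Suc (Suc j) < N then 1 else - real (Suc j))
           - (if j = 0 then - 4 else if j = 1 then 4 + (if x 1 then 0 else 6) else if j = 2 then 4 else 0)"
proof -
  note c = hopL_change[OF assms(2-6)]
  consider "j = 0" | "j = 1" | "j = 2" | "j \<ge> 3" by linarith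
  then show ?thesis
    unfolding config_rank_def c using assms(4,5)
    by cases (auto simp: y numeral_2_eq_2 numeral_3_eq_3)
qed

text \<open>All runs have length at least three, the first one being occupied; the vacancies to the
  right of site \<open>N\<close> count for the last run.\<close>

definition long_runs :: "config \<Rightarrow> bool" where
  "long_runs x \<longleftrightarrow> x 1 \<and> x 2 \<and> x 3 \<and>
     (\<forall>j. x (Suc j) \<noteq> x (Suc (Suc j)) \<longrightarrow>
        x (Suc (Suc (Suc j))) = x (Suc (Suc j)) \<and> x (Suc (Suc (Suc (Suc j)))) = x (Suc (Suc j)))"

lemma long_runs_right:
  assumes "long_runs x" "x (Suc j) \<noteq> x (Suc (Suc j))"
  shows "x (Suc (Suc (Suc j))) = x (Suc (Suc j))" "x (Suc (Suc (Suc (Suc j)))) = x (Suc (Suc j))"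
  using assms by (auto simp: long_runs_def)

lemma long_runs_left:
  assumes x: "long_runs x" and j: "x (Suc j) \<noteq> x (Suc (Suc j))"
  shows "\<exists>i. j = Suc (Suc i) \<and> x j = x (Suc j) \<and> x (Suc i) = x (Suc j)"
proof -
  have "j \<noteq> 0" "j \<noteq> 1" using x j by (auto simp: long_runs_def eval_nat_numeral intro: ccontr)
  then obtain i where i: "j = Suc (Suc i)" by (metis One_nat_def not0_implies_Suc)
  have "x j = x (Suc j)" using long_runs_right(1)[OF x, of "Suc i"] j i by auto
  moreover have "x (Suc i) = x j" using long_runs_right(2)[OF x, of i] j i calculation by auto
  ultimately show ?thesis using i by auto
qed

text \<open>The last occupied run only grows, and the infinitely many vacancies beyond it keep the
  last gap long.\<close>

lemma long_runs_extend:
  assumes x: "long_runs x" and j: "x j" "\<And>i. i > j \<Longrightarrow> \<not> x i"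
  shows "long_runs (x(Suc j := True))"
proof -
  have j3: "3 \<le> j" using x j(2)[of 3] by (force simp: long_runs_def not_less)
  then obtain j0 where j0: "j = Suc j0" by (cases j) auto
  obtain i where i: "j0 = Suc (Suc i)" "x j0" "x (Suc i)"
    using long_runs_left[OF x, of j0] j j0 by auto
  have far: "x (Suc (Suc (Suc k))) = x (Suc (Suc k)) \<and> x (Suc (Suc (Suc (Suc k)))) = x (Suc (Suc k))"
    if "x (Suc k) \<noteq> x (Suc (Suc k))" for k using x that by (auto simp: long_runs_def)
  let ?y = "x(Suc j := True)"
  have "?y (Suc (Suc (Suc k))) = ?y (Suc (Suc k)) \<and> ?y (Suc (Suc (Suc (Suc k)))) = ?y (Suc (Suc k))"
    if c: "?y (Suc k) \<noteq> ?y (Suc (Suc k))" for k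
  proof -
    consider "k < i" | "k = i \<or> k = Suc i \<or> k = Suc (Suc i)" | "k = j" | "k > j"
      using i j0 by linarith
    then show ?thesis
    proof cases
      case 1
      then show ?thesis using c far[of k] i j0 by auto
    next
      case 2
      then show ?thesis using c i j0 j by auto
    next
      case 3
      then show ?thesis using c j by auto
    next
      case 4
      then show ?thesis using c j by auto
    qed
  qed
  then show ?thesis using x j3 by (auto simp: long_runs_def)
qed

text \<open>A hop has exponent \<open>\<kappa>\<close> exactly on an alternating pattern of four
  sites. After an exchange across an interface of long runs the only such pattern is the one just
  created, so the only gaining hop is the way back.\<close>

lemma swapped_alternating:
  assumes u: "long_runs u" "u (Suc j) \<noteq> u (Suc (Suc j))"
    and y: "y = u(Suc j := u (Suc (Suc j)), Suc (Suc j) := u (Suc j))"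
    and alt: "y (Suc i) \<noteq> y (Suc (Suc i))" "y i = y (Suc (Suc i))" "y (Suc (Suc (Suc i))) = y (Suc i)"
  shows "i = j"
proof (rule ccontr)
  assume ne: "i \<noteq> j"
  obtain p where p: "j = Suc (Suc p)" "u j = u (Suc j)" "u (Suc p) = u (Suc j)"
    using long_runs_left[OF u] by blast
  note r = long_runs_right[OF u]
  have eqs: "y (Suc p) = y (Suc (Suc p))"
    "y (Suc (Suc (Suc j))) = y (Suc (Suc (Suc (Suc j))))"
    using p r by (auto simp: y)
  consider "Suc (Suc (Suc i)) < Suc j \<or> Suc (Suc j) < i" | "i = p \<or> i = Suc p"
    | "i = Suc j \<or> i = Suc (Suc j)" using ne p by linarith
  then show False
  proof cases
    case 1
    then have "u (Suc i) = y (Suc i)" "u (Suc (Suc i)) = y (Suc (Suc i))"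
       "u (Suc (Suc (Suc i))) = y (Suc (Suc (Suc i)))" by (auto simp: y)
    then show False using long_runs_right(1)[OF u(1), of i] alt by auto
  next
    case 2
    then show False using eqs alt by auto
  next
    case 3
    then show False using eqs alt by auto
  qed
qed

text \<open>Every run that ends at an interface has length at least two. This one-sided condition
  already excludes alternating patterns of four sites, hence gaining hops.\<close>

definition smooth :: "config \<Rightarrow> bool" where
  "smooth b \<longleftrightarrow> (\<forall>k. b (Suc k) \<noteq> b (Suc (Suc k)) \<longrightarrow> b k = b (Suc k))"

lemma smooth_eta: "2 \<le> p \<Longrightarrow> smooth (eta p q)"
  unfolding smooth_def
proof (intro allI impI)
  fix k assume p: "2 \<le> p" and "eta p q (Suc k) \<noteq> eta p q (Suc (Suc k))"
  then have "Suc k = p" by (auto simp: eta_def)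
  then show "eta p q k = eta p q (Suc k)" using p by (auto simp: eta_def)
qed

section \<open>Fluxes and cycles\<close>

text \<open>\<open>h x / 2\<close> is the logarithmic limit of the weight of \<open>x\<close>, so \<open>h x + c\<close> is the
  exponent of the stationary flux along a transition of rate \<open>exp (\<beta>/2 * c)\<close>.  The assumption
  \<open>cut\<close> is what remains of stationarity on the exponential scale.\<close>

locale kawasaki_exponents =
  fixes N :: nat and \<kappa> m n :: real and h :: "config \<Rightarrow> real"
  assumes N5: "5 \<le> N" and k0: "0 < \<kappa>" and mk: "\<kappa> < m" and nk: "\<kappa> < n"
    and h_le: "x \<in> configs N \<Longrightarrow> h x \<le> 0"
    and cut: "step N \<kappa> m n x y c \<Longrightarrow> x \<in> A \<Longrightarrow> y \<notin> A \<Longrightarrow>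
      \<exists>x' y' c'. step N \<kappa> m n x' y' c' \<and> x' \<notin> A \<and> y' \<in> A \<and> h x + c \<le> h x' + c'"
begin

abbreviation st :: "config \<Rightarrow> config \<Rightarrow> real \<Rightarrow> bool" where
  "st \<equiv> step N \<kappa> m n"

definition reach :: "real \<Rightarrow> config \<Rightarrow> config \<Rightarrow> bool" where
  "reach \<theta> = (\<lambda>x y. \<exists>c. st x y c \<and> \<theta> \<le> h x + c)\<^sup>*\<^sup>*"

definition active :: "real \<Rightarrow> config \<Rightarrow> bool" where
  "active \<theta> x \<longleftrightarrow> (\<exists>y c. st x y c \<and> \<theta> \<le> h x + c)"

text \<open>The right flip next to an occupied site \<open>N - 1\<close> has the exponents \<open>n - \<kappa>\<close> and \<open>- (n - \<kappa>)\<close>, which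
  may be arbitrarily close to \<open>0\<close>, so neither direction is negligible.  Such pairs of configurations
  are merged.\<close>

definition paired :: "config \<Rightarrow> config \<Rightarrow> bool" where
  "paired x y \<longleftrightarrow> x (N - 1) \<and> y = x(N := \<not> x N)"

definition nactive :: "real \<Rightarrow> config \<Rightarrow> bool" where
  "nactive \<theta> x \<longleftrightarrow> (\<exists>y c. st x y c \<and> \<not> paired x y \<and> \<theta> \<le> h x + c)"

lemma st_configs: "st x y c \<Longrightarrow> x \<in> configs N" "st x y c \<Longrightarrow> y \<in> configs N"
  using step_configs N5 by auto

lemma reach_refl [simp]: "reach \<theta> x x"
  by (simp add: reach_def)

lemma reach_trans: "reach \<theta> x y \<Longrightarrow> reach \<theta> y z \<Longrightarrow> reach \<theta> x z"
  unfolding reach_def by (rule rtranclp_trans)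

lemma reach_edge: "st x y c \<Longrightarrow> \<theta> \<le> h x + c \<Longrightarrow> reach \<theta> x y"
  unfolding reach_def by (intro r_into_rtranclp) blast

lemma reach_configs: "reach \<theta> x y \<Longrightarrow> x \<in> configs N \<Longrightarrow> y \<in> configs N"
  unfolding reach_def by (induction rule: rtranclp_induct) (auto dest: st_configs)

lemma reach_leaves:
  "reach \<theta> x y \<Longrightarrow> x \<in> A \<Longrightarrow> y \<notin> A \<Longrightarrow>
    \<exists>u v c. u \<in> A \<and> v \<notin> A \<and> reach \<theta> x u \<and> st u v c \<and> \<theta> \<le> h u + c"
  unfolding reach_def
proof (induction rule: rtranclp_induct)
  case (step y z)
  then show ?case by (cases "y \<in> A") blast+
qed simp

text \<open>Every edge lies on a cycle with at least the same flux: the set of states that can be reached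
  from its end point has no strong outgoing edge, hence no strong incoming one.\<close>

lemma reach_back:
  assumes "st x y c" "\<theta> \<le> h x + c"
  shows "reach \<theta> y x"
proof (rule ccontr)
  assume no: "\<not> reach \<theta> y x"
  obtain x' y' c' where e: "st x' y' c'" "\<not> \<not> reach \<theta> y x'" "\<not> reach \<theta> y y'" "h x + c \<le> h x' + c'"
    using cut[OF assms(1), of "{z. \<not> reach \<theta> y z}"] no by auto
  then have "reach \<theta> x' y'" using assms(2) by (intro reach_edge) auto
  with e(2,3) reach_trans show False by blast
qed

text \<open>Thus \<open>reach \<theta>\<close> is an equivalence relation, and paths may be followed
  in either direction.\<close>

lemma reach_sym: "reach \<theta> x y \<Longrightarrow> reach \<theta> y x"
proof -
  assume "reach \<theta> x y"
  then have "(\<lambda>x y. \<exists>c. st x y c \<and> \<theta> \<le> h x + c)\<^sup>*\<^sup>* x y" by (simp add: reach_def)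
  then show ?thesis
    by (induction rule: rtranclp_induct) (auto intro: reach_trans reach_back)
qed

lemma reach_active: "reach \<theta> x y \<Longrightarrow> x \<noteq> y \<Longrightarrow> active \<theta> x"
  using reach_leaves[of \<theta> x y "{x}"] by (auto simp: active_def)

lemma active_reach: "active \<theta> x \<Longrightarrow> reach \<theta> x y \<Longrightarrow> active \<theta> y"
  using reach_active[of \<theta> y x] reach_sym by (cases "x = y") auto

lemma edge_active: "st x y c \<Longrightarrow> \<theta> \<le> h x + c \<Longrightarrow> active \<theta> y"
  using active_reach[of \<theta> x y] reach_edge[of x y c \<theta>] by (auto simp: active_def)

text \<open>Some exit of an active state has flux at least \<open>\<theta>\<close>, and the fastest
  exit has at least that flux because both start with the same \<open>h x\<close>. This allows paths
  to be continued through states whose \<open>h\<close> is unknown.\<close>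

lemma steepest_edge:
  assumes "active \<theta> x" "\<And>y' c'. st x y' c' \<Longrightarrow> c' \<le> c" "st x y c"
  shows "reach \<theta> x y" "\<theta> \<le> h x + c" "active \<theta> y"
proof -
  show "\<theta> \<le> h x + c" using assms(1,2) unfolding active_def by force
  then show "reach \<theta> x y" "active \<theta> y" using assms(3) reach_edge edge_active by blast+
qed

lemma nactive_active: "nactive \<theta> x \<Longrightarrow> active \<theta> x"
  by (auto simp: nactive_def active_def)

text \<open>If \<open>x\<close> is outside the merged pair of \<open>y\<close>, a path from
  \<open>y\<close> to \<open>x\<close> leaves the pair, and the edge on which it does so is
  unpaired.\<close>

lemma nactive_reach:
  assumes "nactive \<theta> x" "reach \<theta> x y"
  shows "\<exists>y'. nactive \<theta> y' \<and> reach \<theta> x y' \<and> (y' = y \<or> y (N - 1) \<and> y' = y(N := \<not> y N))"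
proof -
  let ?A = "{z. z = y \<or> y (N - 1) \<and> z = y(N := \<not> y N)}"
  have np: "\<not> paired u v" if uv: "u \<in> ?A" "v \<notin> ?A" for u v
  proof
    assume p: "paired u v"
    consider "u = y" | "y (N - 1)" "u = y(N := \<not> y N)" using uv(1) by blast
    then have "v \<in> ?A" by cases (use p in \<open>auto simp: paired_def\<close>)
    then show False using uv(2) by blast
  qed
  show ?thesis
  proof (cases "x \<in> ?A")
    case True
    then show ?thesis using assms(1) by auto
  next
    case False
    obtain u v c where "u \<in> ?A" "v \<notin> ?A" "reach \<theta> y u" "st u v c" "\<theta> \<le> h u + c"
      using reach_leaves[OF reach_sym[OF assms(2)], of ?A] False by blast
    then show ?thesis using np[of u v] reach_trans[OF assms(2), of u] by (auto simp: nactive_def)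
  qed
qed

section \<open>Bounds on exit exponents and descent of the rank\<close>

lemma hop_le: "\<kappa> * (occ x i - occ x j) \<le> \<kappa>" "- \<kappa> \<le> \<kappa> * (occ x i - occ x j)"
  using k0 by (auto simp: occ_def)

lemma st_le_n:
  assumes "st x y c" "x 1"
  shows "c \<le> n"
  using assms(1)
proof (cases rule: step.cases)
  case (hopR j)
  then show ?thesis using hop_le(1)[of x "Suc (Suc (Suc j))" j] nk by simp
next
  case (hopL j)
  then show ?thesis using hop_le(1)[of x j "Suc (Suc (Suc j))"] nk by simp
qed (use assms(2) mk nk k0 in \<open>auto simp: occ_def split: if_splits\<close>)

lemma st_le_k:
  assumes "st x y c" "x 1" "\<not> x N"
  shows "c \<le> \<kappa>"
  using assms(1)
proof (cases rule: step.cases)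
  case (hopR j)
  then show ?thesis using hop_le(1)[of x "Suc (Suc (Suc j))" j] by simp
next
  case (hopL j)
  then show ?thesis using hop_le(1)[of x j "Suc (Suc (Suc j))"] by simp
qed (use assms(2,3) mk nk k0 in \<open>auto simp: occ_def split: if_splits\<close>)

text \<open>Hops have exponent \<open>- \<kappa>\<close>, \<open>0\<close> or
  \<open>\<kappa>\<close>. With site 1 occupied, no isolated particle at \<open>N\<close> and pairs
  merged, every reservoir move has exponent below \<open>- \<kappa>\<close>.\<close>

lemma st_hop:
  assumes "st x y c" "x 1" "\<not> paired x y" "x N \<Longrightarrow> x (N - 1)" "- \<kappa> < c"
  shows "\<exists>j. Suc (Suc j) \<le> N \<and> x (Suc j) \<noteq> x (Suc (Suc j)) \<and>
    (c = \<kappa> \<and> x j = x (Suc (Suc j)) \<and> x (Suc (Suc (Suc j))) = x (Suc j) \<or> c = 0 \<and> x j = x (Suc (Suc (Suc j))))"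
  using assms(1)
proof (cases rule: step.cases)
  case (hopR j)
  then show ?thesis using assms(5) by (intro exI[of _ j]) (auto simp: occ_def split: if_splits)
next
  case (hopL j)
  then show ?thesis using assms(5) by (intro exI[of _ j]) (auto simp: occ_def split: if_splits)
next
  case unfill
  then show ?thesis using assms(5) mk k0 by (auto simp: occ_def split: if_splits)
next
  case kill
  then show ?thesis using assms(3,4) by (auto simp: paired_def)
next
  case create
  then show ?thesis using assms(3,5) nk k0 by (auto simp: paired_def split: if_splits)
qed (use assms(2) in auto)

lemma hop_not_paired:
  "Suc (Suc j) \<le> N \<Longrightarrow> x (Suc j) \<noteq> x (Suc (Suc j)) \<Longrightarrow>
    \<not> paired x (x(Suc j := b, Suc (Suc j) := \<not> b))" if "x (Suc j) \<noteq> b" for b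
proof -
  assume a: "Suc (Suc j) \<le> N" "x (Suc j) \<noteq> x (Suc (Suc j))"
  show ?thesis
  proof
    assume "paired x (x(Suc j := b, Suc (Suc j) := \<not> b))"
    then have "(x(Suc j := b, Suc (Suc j) := \<not> b)) (Suc j) = (x(N := \<not> x N)) (Suc j)"
      by (simp add: paired_def)
    then show False using a that by simp
  qed
qed

lemma hopR_not_paired:
  "Suc (Suc j) \<le> N \<Longrightarrow> x (Suc j) \<Longrightarrow> \<not> x (Suc (Suc j)) \<Longrightarrow>
    \<not> paired x (x(Suc j := False, Suc (Suc j) := True))"
  using hop_not_paired[of x j False] by simp

lemma hopL_not_paired:
  "Suc (Suc j) \<le> N \<Longrightarrow> \<not> x (Suc j) \<Longrightarrow> x (Suc (Suc j)) \<Longrightarrow>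
    \<not> paired x (x(Suc j := True, Suc (Suc j) := False))"
  using hop_not_paired[of x j True] by simp

text \<open>The given exit need not lower the rank itself, but it can be replaced by one at least as
  fast that does. In order of preference these are reservoir moves, gaining hops, and neutral hops,
  normally to the left.\<close>

lemma rank_descent:
  assumes "st x y0 c0" "\<not> paired x y0" "- \<kappa> < c0"
  shows "\<exists>y c. st x y c \<and> \<not> paired x y \<and> c0 \<le> c \<and> config_rank N y < config_rank N x"
proof -
  have x: "x \<in> configs N" using assms(1) st_configs by blast
  have x0: "\<not> x 0" "\<not> x (Suc N)" using configs_outside[OF x] by auto
  have kill_ok: "\<exists>y c. st x y c \<and> \<not> paired x y \<and> c0 \<le> c \<and> config_rank N y < config_rank N x"
    if "x N" "\<not> x (N - 1)" "c0 \<le> n"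
    using step.kill[OF x that(1), of \<kappa> m n] rank_kill[OF N5 x that(1)] that
    by (intro exI[of _ "x(N := False)"] exI[of _ n]) (auto simp: paired_def)
  show ?thesis
  proof (cases "x 1")
    case False
    \<comment> \<open>Either of the fast reservoir moves may be the faster one, since
      \<open>m\<close> and \<open>n\<close> are not compared. Both lower the rank.\<close>
    have c0: "c0 \<le> m + \<kappa> * occ x 2 \<or> x N \<and> \<not> x (N - 1) \<and> c0 \<le> n"
      using assms(1)
    proof (cases rule: step.cases)
      case (hopR j)
      then show ?thesis using hop_le(1)[of x "Suc (Suc (Suc j))" j] mk k0 by (auto simp: occ_def)
    next
      case (hopL j)
      then show ?thesis using hop_le(1)[of x j "Suc (Suc (Suc j))"] mk k0 by (auto simp: occ_def)
    next
      case kill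
      then show ?thesis using assms(2) by (auto simp: paired_def)
    qed (use assms(2,3) False mk nk k0 in \<open>auto simp: occ_def paired_def split: if_splits\<close>)
    show ?thesis
    proof (cases "x N \<and> \<not> x (N - 1) \<and> c0 \<le> n")
      case True
      then show ?thesis using kill_ok by blast
    next
      case F: False
      have "\<not> paired x (x(1 := True))" using False N5 by (auto simp: paired_def fun_eq_iff)
      then show ?thesis
        using c0 F step.fill[OF x False, of \<kappa> m n] rank_fill[OF N5 x False] by fastforce
    qed
  next
    case x1: True
    show ?thesis
    proof (cases "x N \<and> \<not> x (N - 1)")
      case True
      then show ?thesis using kill_ok st_le_n[OF assms(1) x1] by blast
    next
      case iso: False
      obtain j0 where j0: "Suc (Suc j0) \<le> N" "x (Suc j0) \<noteq> x (Suc (Suc j0))"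
        "c0 = \<kappa> \<and> x j0 = x (Suc (Suc j0)) \<and> x (Suc (Suc (Suc j0))) = x (Suc j0) \<or> c0 = 0 \<and> x j0 = x (Suc (Suc (Suc j0)))"
        using st_hop[OF assms(1) x1 assms(2) _ assms(3)] iso by blast
      have c0k: "c0 \<le> \<kappa>" using j0 k0 by auto
      \<comment> \<open>A hop to the left from \<open>N\<close> would raise the moment, as site
        \<open>N\<close> does not count there. It needs an isolated particle at \<open>N\<close>,
        which has been treated by removing it.\<close>
      have notN: "Suc (Suc j) < N" if "Suc (Suc j) \<le> N" "\<not> x (Suc j)" "x (Suc (Suc j))" for j
        using iso that N5 by (cases "Suc (Suc j) = N") auto
      show ?thesis
      proof (cases "\<exists>j. Suc (Suc j) \<le> N \<and> x (Suc j) \<noteq> x (Suc (Suc j)) \<and>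
                 x j = x (Suc (Suc j)) \<and> x (Suc (Suc (Suc j))) = x (Suc j)")
        case True
        then obtain j where j: "Suc (Suc j) \<le> N" "x (Suc j) \<noteq> x (Suc (Suc j))"
          "x j = x (Suc (Suc j))" "x (Suc (Suc (Suc j))) = x (Suc j)" by blast
        show ?thesis
        proof (cases "x (Suc j)")
          case xj: True
          define y where "y = x(Suc j := False, Suc (Suc j) := True)"
          \<comment> \<open>The tight case is \<open>j = 2\<close>, with change -6 + 1 + 4 = -1. The
            case \<open>j = 1\<close> cannot occur, as site \<open>j\<close> is vacant and site 1 is
            occupied.\<close>
          have g: "config_rank N y < config_rank N x"
            using rank_hopR[OF N5 x j(1) xj _ y_def] j xj x1 by (auto split: if_splits)
          have "st x y \<kappa>" using step.hopR[OF x j(1), of \<kappa> m n] j xj by (simp add: y_def)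
          then show ?thesis using g c0k hopR_not_paired[OF j(1), of x] j xj unfolding y_def by blast
        next
          case xj: False
          define y where "y = x(Suc j := True, Suc (Suc j) := False)"
          have "j \<noteq> 0" using j xj x0 by (cases j) auto
          then have g: "config_rank N y < config_rank N x"
            using rank_hopL[OF N5 x j(1) xj _ y_def] j xj x1 notN[OF j(1)] by (auto split: if_splits)
          have "st x y \<kappa>" using step.hopL[OF x j(1), of \<kappa> m n] j xj by (simp add: y_def)
          then show ?thesis using g c0k hopL_not_paired[OF j(1), of x] j xj unfolding y_def by blast
        qed
      next
        case nogain: False
        then have nogain': "\<not> (x j = x (Suc (Suc j)) \<and> x (Suc (Suc (Suc j))) = x (Suc j))"
          if "Suc (Suc j) \<le> N" "x (Suc j) \<noteq> x (Suc (Suc j))" for j using that by blast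
        have c0z: "c0 = 0" and j0z: "x j0 = x (Suc (Suc (Suc j0)))" using j0 nogain'[OF j0(1,2)] by auto
        \<comment> \<open>One neutral hop to the left suffices. If only a neutral hop to the right
          is given, the pattern around it provides one to the left, except for a lone particle at
          site 1.\<close>
        have left: ?thesis if j: "Suc (Suc j) \<le> N" "\<not> x (Suc j)" "x (Suc (Suc j))" "x j = x (Suc (Suc (Suc j)))" for j
        proof -
          define y where "y = x(Suc j := True, Suc (Suc j) := False)"
          have "j \<noteq> 0" using j x1 by (cases j) auto
          then have g: "config_rank N y < config_rank N x"
            using rank_hopL[OF N5 x j(1,2,3) y_def] j x1 notN[OF j(1)]
            by (auto split: if_splits simp: occ_def)
          have z: "st x y 0" using step.hopL[OF x j(1), of \<kappa> m n] j by (simp add: y_def occ_def)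
          then show ?thesis using g z c0z hopL_not_paired[OF j(1), of x] j unfolding y_def
            by (metis order_refl)
        qed
        show ?thesis
        proof (cases "x (Suc j0)")
          case False
          then show ?thesis using left[of j0] j0z j0 by auto
        next
          case xj: True
          then have xj2: "\<not> x (Suc (Suc j0))" using j0 by auto
          show ?thesis
          proof (cases "x (Suc (Suc (Suc j0)))")
            case True
            \<comment> \<open>The sites from \<open>j0\<close> on read 1 1 0 1 1, the last entry
              because no hop gains; the hole can then be filled from the right.\<close>
            then have "Suc (Suc (Suc j0)) \<le> N" using configs_outside[OF x, of "Suc (Suc (Suc j0))"] by force
            moreover have "x (Suc (Suc (Suc (Suc j0))))"
              using nogain'[of "Suc j0"] True xj xj2 calculation by (auto simp: eval_nat_numeral)
            ultimately show ?thesis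
              using left[of "Suc j0"] xj xj2 True by (auto simp: eval_nat_numeral)
          next
            case x3: False
            then have xj0: "\<not> x j0" using j0z by simp
            show ?thesis
            proof (cases j0)
              case 0
              \<comment> \<open>The lone particle at site 1 moves to site 2: the moment rises by 1,
                but site 2 has the larger weight, so the rank falls by 3.\<close>
              define y where "y = x(Suc j0 := False, Suc (Suc j0) := True)"
              have "config_rank N y < config_rank N x"
                using rank_hopR[OF N5 x j0(1) xj xj2 y_def] 0 x3 xj0 N5 by (auto split: if_splits)
              moreover have "st x y 0"
                using step.hopR[OF x j0(1) xj xj2, of \<kappa> m n] x3 xj0 by (simp add: y_def)
              ultimately show ?thesis
                using c0z hopR_not_paired[OF j0(1) xj xj2] unfolding y_def by (metis order_refl)
            next
              case (Suc i)
              have "\<not> x i" using nogain'[of i] Suc xj xj0 xj2 j0(1) by (auto simp: eval_nat_numeral)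
              then show ?thesis using left[of i] Suc xj xj0 xj2 j0(1) by (auto simp: eval_nat_numeral)
            qed
          qed
        qed
      qed
    qed
  qed
qed

section \<open>Descent to the traps\<close>

text \<open>Inner gaps need length three, but a last gap of length two is already stable, since the
  vacancies beyond \<open>N\<close> count for it. With length one, the particle beside it escapes
  through \<open>N\<close> (\<open>slow_exit_right\<close>).\<close>

definition trap :: "config \<Rightarrow> bool" where
  "trap t \<longleftrightarrow> t \<in> configs N \<and> long_runs t \<and> \<not> t (N - 1) \<and> \<not> t N"

definition slow :: "config \<Rightarrow> bool" where
  "slow x \<longleftrightarrow> (\<forall>y c. st x y c \<and> \<not> paired x y \<longrightarrow> c \<le> - \<kappa>)"

lemma stR: "x \<in> configs N \<Longrightarrow> Suc (Suc j) \<le> N \<Longrightarrow> x (Suc j) \<Longrightarrow> \<not> x (Suc (Suc j)) \<Longrightarrow>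
    y = x(Suc j := False, Suc (Suc j) := True) \<Longrightarrow> c = \<kappa> * (occ x (Suc (Suc (Suc j))) - occ x j) \<Longrightarrow>
    st x y c"
  by (simp add: step.hopR)

lemma stL: "x \<in> configs N \<Longrightarrow> Suc (Suc j) \<le> N \<Longrightarrow> \<not> x (Suc j) \<Longrightarrow> x (Suc (Suc j)) \<Longrightarrow>
    y = x(Suc j := True, Suc (Suc j) := False) \<Longrightarrow> c = \<kappa> * (occ x j - occ x (Suc (Suc (Suc j)))) \<Longrightarrow>
    st x y c"
  by (simp add: step.hopL)

lemma st_kill: "x \<in> configs N \<Longrightarrow> x N \<Longrightarrow> y = x(N := False) \<Longrightarrow> c = n - \<kappa> * occ x (N - 1) \<Longrightarrow> st x y c"
  using step.kill[of x N \<kappa> m n] by simp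

lemma st_fill: "x \<in> configs N \<Longrightarrow> \<not> x 1 \<Longrightarrow> y = x(1 := True) \<Longrightarrow> c = m + \<kappa> * occ x 2 \<Longrightarrow> st x y c"
  using step.fill[of x N \<kappa> m n] by simp

lemma st_le_fill:
  assumes "st x y c" "\<not> x 1" "x 2" "\<not> x N"
  shows "c \<le> m + \<kappa>"
  using assms(1)
proof (cases rule: step.cases)
  case (hopR j)
  then have "c \<le> \<kappa>" using hop_le(1) by simp
  then show ?thesis using mk k0 by linarith
next
  case (hopL j)
  then have "c \<le> \<kappa>" using hop_le(1) by simp
  then show ?thesis using mk k0 by linarith
qed (use assms(2-) mk nk k0 in \<open>auto simp: occ_def split: if_splits\<close>)

lemma slow_first:
  assumes x: "x \<in> configs N" and s: "slow x"
  shows "x 1"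
proof (rule ccontr)
  assume "\<not> x 1"
  moreover from this have "\<not> paired x (x(1 := True))" using N5 by (auto simp: paired_def fun_eq_iff)
  ultimately show False using s step.fill[OF x, of \<kappa> m n] mk k0 occ_bounds(1)[of x 2]
    unfolding slow_def by (smt (verit) mult_nonneg_nonneg)
qed

lemma slow_hop:
  assumes x: "x \<in> configs N" and s: "slow x" and j: "Suc (Suc j) \<le> N" "x (Suc j) \<noteq> x (Suc (Suc j))"
  shows "x j = x (Suc j)" "x (Suc (Suc (Suc j))) = x (Suc (Suc j))"
proof -
  have "x j = x (Suc j) \<and> x (Suc (Suc (Suc j))) = x (Suc (Suc j))"
  proof (cases "x (Suc j)")
    case True
    then have "\<kappa> * (occ x (Suc (Suc (Suc j))) - occ x j) \<le> - \<kappa>"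
      using s step.hopR[OF x j(1), of \<kappa> m n] hopR_not_paired[OF j(1), of x] j(2) unfolding slow_def by blast
    then show ?thesis using True j(2) k0 by (auto simp: occ_def split: if_splits)
  next
    case False
    then have "\<kappa> * (occ x j - occ x (Suc (Suc (Suc j)))) \<le> - \<kappa>"
      using s step.hopL[OF x j(1), of \<kappa> m n] hopL_not_paired[OF j(1), of x] j(2) unfolding slow_def by blast
    then show ?thesis using False j(2) k0 by (auto simp: occ_def split: if_splits)
  qed
  then show "x j = x (Suc j)" "x (Suc (Suc (Suc j))) = x (Suc (Suc j))" by auto
qed

lemma slow_last:
  assumes x: "x \<in> configs N" and s: "slow x" and "x N"
  shows "x (N - 1)"
proof (rule ccontr)
  assume "\<not> x (N - 1)"
  then have "n \<le> - \<kappa>"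
    using s step.kill[OF x assms(3), of \<kappa> m n] unfolding slow_def paired_def by auto
  then show False using nk k0 by simp
qed

text \<open>The faster of the two available exits has both flux at least \<open>\<theta>\<close> and
  exponent above \<open>- \<kappa>\<close>, so \<open>rank_descent\<close> applies to it.\<close>

lemma nactive_fast:
  assumes "nactive \<theta> z" "\<not> slow z"
  shows "\<exists>z'. reach \<theta> z z' \<and> config_rank N z' < config_rank N z"
proof -
  obtain y c where y: "st z y c" "\<not> paired z y" "\<theta> \<le> h z + c" using assms(1) by (auto simp: nactive_def)
  obtain y' c' where y': "st z y' c'" "\<not> paired z y'" "- \<kappa> < c'" using assms(2) by (auto simp: slow_def not_le)
  obtain y'' c'' where y'': "st z y'' c''" "\<not> paired z y''" "- \<kappa> < c''" "\<theta> \<le> h z + c''"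
  proof (cases "c \<le> c'")
    case True
    then show ?thesis using that[of y' c'] y' y by auto
  next
    case False
    then show ?thesis using that[of y c] y' y by auto
  qed
  then obtain w d where "st z w d" "c'' \<le> d" "config_rank N w < config_rank N z" using rank_descent by blast
  then show ?thesis using reach_edge[of z w d \<theta>] y'' by auto
qed

lemma nactive_slow:
  assumes "nactive \<theta> z" "slow z" shows "\<theta> \<le> h z - \<kappa>"
  using assms unfolding nactive_def slow_def by force

text \<open>The composite moves below start with a hop of exponent \<open>- \<kappa>\<close> and continue with the fastest exit
  of each intermediate state, so that no flux is lost.\<close>

lemma slow_exit_right:
  assumes z: "z \<in> configs N" "slow z" "\<not> z N" "z (N - 1)" and \<theta>: "\<theta> \<le> h z - \<kappa>"
  shows "reach \<theta> z (z(N - 1 := False))" "config_rank N (z(N - 1 := False)) < config_rank N z"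
proof -
  obtain j where j: "N = Suc (Suc j)" "3 \<le> j" using N5 by (intro that[of "N - 2"]) auto
  have zj: "z (Suc j)" "\<not> z (Suc (Suc j))" "\<not> z (Suc (Suc (Suc j)))"
    using z j configs_outside[OF z(1), of "Suc N"] by auto
  then have zj': "z j" using slow_hop(1)[OF z(1,2), of j] j by simp
  have z1: "z 1" using slow_first z by blast
  define w where "w = z(Suc j := False, Suc (Suc j) := True)"
  have e1: "st z w (- \<kappa>)"
    by (rule stR[OF z(1), of j]) (use zj zj' j in \<open>simp_all add: w_def\<close>)
  then have w: "reach \<theta> z w" "active \<theta> w" "w \<in> configs N"
    using \<theta> reach_edge edge_active st_configs by force+
  have w1: "w 1" "w N" "\<not> w (N - 1)" using z1 j by (auto simp: w_def)
  have e2: "st w (w(N := False)) n"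
    by (rule st_kill[OF w(3)]) (use w1 in simp_all)
  have zw: "z(N - 1 := False) = w(N := False)" using zj j by (auto simp: w_def fun_eq_iff)
  show "reach \<theta> z (z(N - 1 := False))"
    using w(1) steepest_edge(1)[OF w(2) _ e2] st_le_n[of w] w1(1) reach_trans unfolding zw by blast
  have "config_rank N w = config_rank N z + 6 - real (Suc j)"
    using rank_hopR[OF N5 z(1) _ zj(1,2) w_def] zj zj' j by simp
  then show "config_rank N (z(N - 1 := False)) < config_rank N z"
    using rank_kill[OF N5 w(3) w1(2)] w1(3) unfolding zw by simp
qed

text \<open>The first sites pass through 110, 101, 011, 111. In total a particle is added at site 3,
  whose weight 4 exceeds its moment 3.\<close>

lemma slow_first_pair:
  assumes z: "z \<in> configs N" "slow z" "\<not> z N" "z 2" "\<not> z 3" and \<theta>: "\<theta> \<le> h z - \<kappa>"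
  shows "reach \<theta> z (z(3 := True))" "config_rank N (z(3 := True)) < config_rank N z"
proof -
  define y1 where "y1 = z(Suc 1 := False, Suc (Suc 1) := True)"
  define y2 where "y2 = y1(Suc 0 := False, Suc (Suc 0) := True)"
  have z1: "z 1" using slow_first z by blast
  have z0: "\<not> z 0" using configs_outside z by blast
  have z4: "\<not> z (Suc (Suc (Suc 1)))"
    using slow_hop(2)[OF z(1,2), of 1] z N5 by (auto simp: eval_nat_numeral)
  have e1: "st z y1 (- \<kappa>)"
    by (rule stR[OF z(1), of 1]) (use z z1 z4 N5 in \<open>simp_all add: y1_def eval_nat_numeral\<close>)
  then have r1: "reach \<theta> z y1" "active \<theta> y1" "y1 \<in> configs N"
    using \<theta> reach_edge edge_active st_configs by force+
  have y1: "y1 1" "\<not> y1 N" using z1 z N5 by (auto simp: y1_def)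
  have e2: "st y1 y2 \<kappa>"
    by (rule stR[OF r1(3), of 0]) (use z z1 z0 N5 in \<open>auto simp: y1_def y2_def eval_nat_numeral\<close>)
  then have r2: "reach \<theta> y1 y2" "active \<theta> y2" "y2 \<in> configs N"
    using steepest_edge[OF r1(2) _ e2] st_le_k[OF _ y1] st_configs by auto
  have y2: "\<not> y2 1" "y2 2" "\<not> y2 N" using y1 N5 by (auto simp: y2_def)
  have e3: "st y2 (y2(1 := True)) (m + \<kappa>)"
    by (rule st_fill[OF r2(3)]) (use y2 in simp_all)
  have zy: "z(3 := True) = y2(1 := True)" using z1 z by (auto simp: y2_def y1_def fun_eq_iff eval_nat_numeral)
  show "reach \<theta> z (z(3 := True))"
    using r1(1) r2(1) steepest_edge(1)[OF r2(2) _ e3] st_le_fill[OF _ y2] reach_trans unfolding zy by blast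
  have "config_rank N y1 = config_rank N z + 11"
    using rank_hopR[OF N5 z(1), of 1 y1] z z1 z4 N5 by (simp add: y1_def eval_nat_numeral)
  moreover have "config_rank N y2 = config_rank N y1 - 9"
    using rank_hopR[OF N5 r1(3), of 0 y2] y1 z1 z0 N5 z by (simp add: y2_def y1_def eval_nat_numeral)
  ultimately show "config_rank N (z(3 := True)) < config_rank N z"
    using rank_fill[OF N5 r2(3) y2(1)] unfolding zy by simp
qed

text \<open>A cluster of two moves one site to the left: the front particle breaks the bond and the
  other follows with gain \<open>\<kappa>\<close>. Only the moment changes in total, by -2.\<close>

lemma slow_pair:
  assumes z: "z \<in> configs N" "slow z" "\<not> z N" "\<not> z (N - 1)" "z 1" "z 2" "z 3"
    and j: "\<not> z (Suc j)" "z (Suc (Suc j))" "\<not> z (Suc (Suc (Suc (Suc j))))"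
    and \<theta>: "\<theta> \<le> h z - \<kappa>"
  shows "\<exists>z'. reach \<theta> z z' \<and> config_rank N z' < config_rank N z"
proof -
  have j3: "3 \<le> j"
  proof (rule ccontr)
    assume "\<not> 3 \<le> j"
    then have "j = 0 \<or> j = 1 \<or> j = 2" by auto
    then show False using j z by (auto simp: eval_nat_numeral)
  qed
  have le: "Suc (Suc j) \<le> N" using configs_outside[OF z(1), of "Suc (Suc j)"] j by force
  have zj: "\<not> z j" "z (Suc (Suc (Suc j)))" using slow_hop[OF z(1,2) le] j by auto
  have ne: "Suc (Suc (Suc j)) \<noteq> N" "Suc (Suc (Suc j)) \<noteq> N - 1" using zj z by auto
  have lt: "Suc (Suc (Suc j)) < N - 1"
    using configs_outside[OF z(1), of "Suc (Suc (Suc j))"] zj ne by force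
  define y1 where "y1 = z(Suc j := True, Suc (Suc j) := False)"
  define y2 where "y2 = y1(Suc (Suc j) := True, Suc (Suc (Suc j)) := False)"
  have e1: "st z y1 (- \<kappa>)"
    by (rule stL[OF z(1), of j]) (use j zj lt in \<open>simp_all add: y1_def\<close>)
  then have r1: "reach \<theta> z y1" "active \<theta> y1" "y1 \<in> configs N"
    using \<theta> reach_edge edge_active st_configs by force+
  have y1: "y1 1" "\<not> y1 N" using z j3 lt by (auto simp: y1_def)
  have e2: "st y1 y2 \<kappa>"
    by (rule stL[OF r1(3), of "Suc j"]) (use j zj lt in \<open>auto simp: y1_def y2_def\<close>)
  then have r2: "reach \<theta> y1 y2"
    using steepest_edge[OF r1(2) _ e2] st_le_k[OF _ y1] by auto
  have "config_rank N y1 = config_rank N z + 5"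
    using rank_hopL[OF N5 z(1), of j y1] j zj j3 lt by (simp add: y1_def)
  moreover have "config_rank N y2 = config_rank N y1 - 7"
    using rank_hopL[OF N5 r1(3), of "Suc j" y2] j zj j3 lt by (simp add: y2_def y1_def)
  ultimately show ?thesis using reach_trans[OF r1(1) r2] by (intro exI[of _ y2]) auto
qed

text \<open>The mirror situation: a particle crosses a gap of two and attaches to the cluster on its
  left, so the gap moves to the right and the moment falls by 2.\<close>

lemma slow_gap:
  assumes z: "z \<in> configs N" "slow z" "\<not> z N" "\<not> z (N - 1)" "z 1" "z 2" "z 3"
    and j: "z (Suc j)" "\<not> z (Suc (Suc j))" "z (Suc (Suc (Suc (Suc j))))"
    and \<theta>: "\<theta> \<le> h z - \<kappa>"
  shows "\<exists>z'. reach \<theta> z z' \<and> config_rank N z' < config_rank N z"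
proof -
  have j2: "2 \<le> j"
  proof (rule ccontr)
    assume "\<not> 2 \<le> j"
    then have "j = 0 \<or> j = 1" by auto
    then show False using j z by (auto simp: eval_nat_numeral)
  qed
  have ne: "Suc (Suc (Suc (Suc j))) \<noteq> N" "Suc (Suc (Suc (Suc j))) \<noteq> N - 1" using j z by auto
  have lt: "Suc (Suc (Suc (Suc j))) < N - 1"
    using configs_outside[OF z(1), of "Suc (Suc (Suc (Suc j)))"] j ne by force
  have zj3: "\<not> z (Suc (Suc (Suc j)))" using slow_hop(2)[OF z(1,2), of j] lt j by auto
  have zj5: "z (Suc (Suc (Suc (Suc (Suc j)))))"
    using slow_hop(2)[OF z(1,2), of "Suc (Suc j)"] lt zj3 j by auto
  define y1 where "y1 = z(Suc (Suc (Suc j)) := True, Suc (Suc (Suc (Suc j))) := False)"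
  define y2 where "y2 = y1(Suc (Suc j) := True, Suc (Suc (Suc j)) := False)"
  have e1: "st z y1 (- \<kappa>)"
    by (rule stL[OF z(1), of "Suc (Suc j)"]) (use j zj3 zj5 lt in \<open>simp_all add: y1_def\<close>)
  then have r1: "reach \<theta> z y1" "active \<theta> y1" "y1 \<in> configs N"
    using \<theta> reach_edge edge_active st_configs by force+
  have y1: "y1 1" "\<not> y1 N" using z lt by (auto simp: y1_def)
  have e2: "st y1 y2 \<kappa>"
    by (rule stL[OF r1(3), of "Suc j"]) (use j zj3 lt in \<open>auto simp: y1_def y2_def\<close>)
  then have r2: "reach \<theta> y1 y2"
    using steepest_edge[OF r1(2) _ e2] st_le_k[OF _ y1] by auto
  have "config_rank N y1 = config_rank N z + 5"
    using rank_hopL[OF N5 z(1), of "Suc (Suc j)" y1] j zj3 zj5 j2 lt by (simp add: y1_def)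
  moreover have "config_rank N y2 = config_rank N y1 - 7"
    using rank_hopL[OF N5 r1(3), of "Suc j" y2] j zj3 j2 lt by (simp add: y2_def y1_def)
  ultimately show ?thesis using reach_trans[OF r1(1) r2] by (intro exI[of _ y2]) auto
qed

lemma lower_rank_vacant:
  assumes z: "z \<in> configs N" "\<not> z N" and a: "nactive \<theta> z"
  shows "trap z \<or> (\<exists>z'. reach \<theta> z z' \<and> config_rank N z' < config_rank N z)"
proof (cases "slow z")
  case False
  then show ?thesis using nactive_fast a by blast
next
  case s: True
  have \<theta>: "\<theta> \<le> h z - \<kappa>" using nactive_slow a s by blast
  have z1: "z 1" using slow_first z s by blast
  have z2: "z 2"
    using slow_hop(1)[OF z(1) s, of 0] z1 configs_outside[OF z(1), of 0] N5 by (auto simp: eval_nat_numeral)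
  show ?thesis
  proof (cases "z (N - 1)")
    case True
    then show ?thesis using slow_exit_right[OF z(1) s z(2) _ \<theta>] by blast
  next
    case zN: False
    show ?thesis
    proof (cases "z 3")
      case False
      then show ?thesis using slow_first_pair[OF z(1) s z(2) z2 _ \<theta>] by blast
    next
      case z3: True
      show ?thesis
      proof (cases "long_runs z")
        case True
        then show ?thesis using z zN by (simp add: trap_def)
      next
        case False
        then obtain j where j: "z (Suc j) \<noteq> z (Suc (Suc j))"
          "\<not> (z (Suc (Suc (Suc j))) = z (Suc (Suc j)) \<and> z (Suc (Suc (Suc (Suc j)))) = z (Suc (Suc j)))"
          using z1 z2 z3 by (auto simp: long_runs_def)
        have le: "Suc (Suc j) \<le> N"
        proof (rule ccontr)
          assume "\<not> Suc (Suc j) \<le> N"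
          then have "\<not> z (Suc (Suc j))" "Suc j = N \<or> Suc j > N"
            using configs_outside[OF z(1), of "Suc (Suc j)"] by auto
          then show False using j(1) z(2) configs_outside[OF z(1), of "Suc j"] by auto
        qed
        have j4: "z (Suc (Suc (Suc (Suc j)))) \<noteq> z (Suc (Suc j))"
          using slow_hop(2)[OF z(1) s le j(1)] j(2) by auto
        show ?thesis
          using slow_pair[OF z(1) s z(2) zN z1 z2 z3 _ _ _ \<theta>, of j]
            slow_gap[OF z(1) s z(2) zN z1 z2 z3 _ _ _ \<theta>, of j] j(1) j4 by blast
      qed
    qed
  qed
qed

lemma flip_last_rank: "x \<in> configs N \<Longrightarrow> x (N - 1) \<Longrightarrow> config_rank N (x(N := b)) = config_rank N x"
proof -
  assume x: "x \<in> configs N" "x (N - 1)"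
  have y: "x(N := True) \<in> configs N" using x N5 by (intro configs_upd) auto
  have "N - 1 \<noteq> N" using N5 by auto
  then have *: "config_rank N (x(N := False)) = config_rank N (x(N := True))"
    using rank_kill[OF N5 y] x by simp
  have "x(N := x N) = x" by simp
  then show ?thesis using * by (cases b; cases "x N") (metis (full_types))+
qed

text \<open>The new case is a slow state with site \<open>N\<close> occupied. It passes to its
  partner with \<open>N\<close> vacant, which has the same rank and cannot be a trap.\<close>

lemma lower_rank:
  assumes z: "z \<in> configs N" and a: "nactive \<theta> z"
  shows "trap z \<or> (\<exists>z'. reach \<theta> z z' \<and> config_rank N z' < config_rank N z)"
proof (cases "z N \<and> slow z")
  case False
  then show ?thesis using lower_rank_vacant[OF z _ a] nactive_fast[OF a] by blast
next
  case True
  then have zN: "z N" and s: "slow z" by auto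
  have z1: "z 1" and zN1: "z (N - 1)" using slow_first slow_last z s zN by auto
  have \<theta>: "\<theta> \<le> h z - \<kappa>" using nactive_slow a s by blast
  define y where "y = z(N := False)"
  have e: "st z y (n - \<kappa>)" by (rule st_kill[OF z zN]) (use zN1 in \<open>simp_all add: y_def\<close>)
  have y: "y \<in> configs N" "\<not> y N" "y 1" "y (N - 1)" using st_configs[OF e] z1 zN1 N5 by (auto simp: y_def)
  obtain j where j: "N = Suc (Suc j)" "3 \<le> j" using N5 by (intro that[of "N - 2"]) auto
  have out: "\<not> y (Suc N)" using configs_outside[OF y(1)] by auto
  have c0: "c \<le> 0" if "st y w c" for w c
    using that
  proof (cases rule: step.cases)
    case (hopR i)
    show ?thesis
    proof (cases "i = j")
      case True
      then show ?thesis using hopR k0 out j by (auto simp: occ_def)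
    next
      case False
      then have i: "Suc (Suc i) < N" using hopR j by auto
      have "z (Suc i) \<noteq> z (Suc (Suc i))" using hopR i by (auto simp: y_def)
      then have "z i" using slow_hop(1)[OF z s, of i] hopR i by (auto simp: y_def)
      then show ?thesis using hopR k0 i by (auto simp: y_def occ_def)
    qed
  next
    case (hopL i)
    then have i: "Suc (Suc i) < N" using y(2) by (cases "Suc (Suc i) = N") auto
    have "z (Suc i) \<noteq> z (Suc (Suc i))" using hopL i by (auto simp: y_def)
    then have "\<not> z i" using slow_hop(1)[OF z s, of i] hopL i by (auto simp: y_def)
    then show ?thesis using hopL k0 i by (auto simp: y_def occ_def)
  qed (use y mk nk k0 in \<open>auto simp: occ_def split: if_splits\<close>)
  \<comment> \<open>The flux \<open>h z + (n - \<kappa>)\<close> into \<open>y\<close> must leave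
    through exits of exponent at most 0, so \<open>h y\<close> is at least \<open>h z\<close>. Hence
    \<open>y\<close> still has an unpaired exit of flux at least \<open>\<theta>\<close>.\<close>
  have act: "active (h z + (n - \<kappa>)) y" using edge_active[OF e order_refl] .
  then obtain w c where "st y w c" "h z + (n - \<kappa>) \<le> h y + c" by (auto simp: active_def)
  then have hy: "h z \<le> h y" using c0[of w c] nk by linarith
  define w where "w = y(Suc j := False, Suc (Suc j) := True)"
  have yj: "y (Suc j)" "\<not> y (Suc (Suc j))" using y j by auto
  have "st y w (\<kappa> * (occ y (Suc (Suc (Suc j))) - occ y j))"
    by (rule stR[OF y(1), of j]) (use yj j in \<open>simp_all add: w_def\<close>)
  moreover have "\<not> paired y w" using hopR_not_paired[of j y] yj j by (simp add: w_def)
  moreover have "- \<kappa> \<le> \<kappa> * (occ y (Suc (Suc (Suc j))) - occ y j)" by (rule hop_le)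
  ultimately have "nactive \<theta> y" unfolding nactive_def using hy \<theta>
    by (intro exI[of _ w] exI conjI) (assumption+, linarith)
  moreover have "\<not> trap y" using y by (simp add: trap_def)
  ultimately obtain z' where "reach \<theta> y z'" "config_rank N z' < config_rank N y"
    using lower_rank_vacant[OF y(1,2)] by blast
  moreover have "reach \<theta> z y" using reach_edge[OF e] \<theta> nk k0 by auto
  moreover have "config_rank N y = config_rank N z" unfolding y_def by (rule flip_last_rank[OF z zN1])
  ultimately show ?thesis using reach_trans by metis
qed

text \<open>A state of least rank in the class has the same rank as its partner, and one of them is
  \<open>nactive\<close>; minimality then leaves only the trap alternative of
  \<open>lower_rank\<close>.\<close>

lemma minimal_rank:
  assumes "x \<in> configs N" "nactive \<theta> x"
  obtains t where "reach \<theta> x t" "trap t" "\<And>z. reach \<theta> x z \<Longrightarrow> config_rank N t \<le> config_rank N z"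
proof -
  let ?K = "{z. reach \<theta> x z}"
  have "?K \<subseteq> configs N" using reach_configs assms(1) by auto
  then have fin: "finite ?K" using finite_configs finite_subset by blast
  have "x \<in> ?K" by simp
  then obtain t where "is_arg_min (config_rank N) (\<lambda>z. z \<in> ?K) t"
    using ex_is_arg_min_if_finite[OF fin] by blast
  then have t: "reach \<theta> x t" and min: "\<And>z. reach \<theta> x z \<Longrightarrow> config_rank N t \<le> config_rank N z"
    by (auto simp: is_arg_min_def not_less)
  obtain y where y: "nactive \<theta> y" "reach \<theta> x y" "y = t \<or> t (N - 1) \<and> y = t(N := \<not> t N)"
    using nactive_reach[OF assms(2) t] by blast
  have conf: "t \<in> configs N" "y \<in> configs N" using reach_configs t y assms(1) by auto
  have "config_rank N y = config_rank N t" using y(3) flip_last_rank[OF conf(1)] by auto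
  then have "trap y" using lower_rank[OF conf(2) y(1)] min reach_trans[OF y(2)] by force
  moreover have "N - Suc 0 \<noteq> N" using N5 by simp
  ultimately have "y = t" "trap y" using y(3) by (auto simp: trap_def)
  then show ?thesis using that t min by blast
qed

lemma long_runs_slow:
  assumes x: "long_runs x" "x N \<Longrightarrow> x (N - 1)" and e: "st x y c" "\<not> paired x y"
  shows "c \<le> - \<kappa>"
  using e(1)
proof (cases rule: step.cases)
  case (hopR j)
  then show ?thesis using long_runs_left[OF x(1), of j] long_runs_right(1)[OF x(1), of j] by auto
next
  case (hopL j)
  then show ?thesis using long_runs_left[OF x(1), of j] long_runs_right(1)[OF x(1), of j] by auto
qed (use x e(2) mk nk k0 in \<open>auto simp: long_runs_def paired_def occ_def split: if_splits\<close>)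

lemma trap_slow: "trap t \<Longrightarrow> st t y c \<Longrightarrow> c \<le> - \<kappa>"
  by (rule long_runs_slow) (auto simp: trap_def paired_def)

text \<open>The class of this flux contains a trap, where \<open>h\<close> is at most 0 and every
  exit has exponent at most \<open>- \<kappa>\<close>.\<close>

lemma flux_le:
  assumes "st x y c" "\<not> paired x y"
  shows "h x + c \<le> - \<kappa>"
proof -
  have x: "x \<in> configs N" using st_configs assms by blast
  have a: "nactive (h x + c) x" using assms by (auto simp: nactive_def)
  obtain t where t: "reach (h x + c) x t" "trap t" using minimal_rank[OF x a] by blast
  then have "active (h x + c) t" using active_reach nactive_active a by blast
  then obtain y' c' where "st t y' c'" "h x + c \<le> h t + c'" by (auto simp: active_def)
  moreover have "h t \<le> 0" using h_le t by (auto simp: trap_def)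
  ultimately show ?thesis using trap_slow[OF t(2)] by fastforce
qed

section \<open>Basins of the traps\<close>

definition hops :: "config \<Rightarrow> config \<Rightarrow> bool" where
  "hops u y \<longleftrightarrow> (\<exists>j. Suc (Suc j) \<le> N \<and> u (Suc j) \<noteq> u (Suc (Suc j)) \<and>
     y = u(Suc j := u (Suc (Suc j)), Suc (Suc j) := u (Suc j)))"

text \<open>The basin of a trap must also contain its extension by one particle when the last gap has
  length two: a particle that enters at \<open>N\<close> and hops to the left makes this transition
  at rate \<open>exp (\<beta>/2 * (\<kappa> - 2 * n))\<close>, which may be faster than the motion between the traps.\<close>

definition core :: "config \<Rightarrow> config set" where
  "core t = insert t (if t (N - 2) then {t(N - 1 := True), t(N - 1 := True, N := True)} else {})"

definition basin :: "config \<Rightarrow> config set" where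
  "basin t = core t \<union> {y. \<exists>u\<in>core t. hops u y} \<union> {t(N := True)}"

lemma hops_sym: "hops u y \<Longrightarrow> hops y u"
  unfolding hops_def
proof (elim exE conjE)
  fix j assume "Suc (Suc j) \<le> N" "u (Suc j) \<noteq> u (Suc (Suc j))"
    "y = u(Suc j := u (Suc (Suc j)), Suc (Suc j) := u (Suc j))"
  then show "\<exists>j. Suc (Suc j) \<le> N \<and> y (Suc j) \<noteq> y (Suc (Suc j)) \<and>
      u = y(Suc j := y (Suc (Suc j)), Suc (Suc j) := y (Suc j))"
    by (intro exI[of _ j]) (auto simp: fun_eq_iff)
qed

lemma hops_not_paired: "hops u y \<Longrightarrow> \<not> paired u y"
proof
  assume "hops u y" "paired u y"
  then obtain j where j: "Suc (Suc j) \<le> N" "u (Suc j) \<noteq> u (Suc (Suc j))"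
    "y = u(Suc j := u (Suc (Suc j)), Suc (Suc j) := u (Suc j))" unfolding hops_def by blast
  have "y (Suc j) = (u(N := \<not> u N)) (Suc j)" using \<open>paired u y\<close> by (simp add: paired_def)
  then show False using j by simp
qed

lemma core_long_runs:
  assumes t: "trap t" and u: "u \<in> core t"
  shows "u \<in> configs N" "long_runs u" "u N \<Longrightarrow> u (N - 1)"
proof -
  have t': "t \<in> configs N" "long_runs t" "\<not> t (N - 1)" "\<not> t N" using t by (auto simp: trap_def)
  have "u \<in> configs N \<and> long_runs u \<and> (u N \<longrightarrow> u (N - 1))"
  proof (cases "u = t")
    case True
    then show ?thesis using t' by auto
  next
    case False
    define v where "v = t(N - 1 := True)"
    have N2: "t (N - 2)" and uv: "u = v \<or> u = v(N := True)"
      using False u by (auto simp: core_def v_def split: if_splits)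
    have S: "Suc (N - 2) = N - 1" "Suc (N - 1) = N" using N5 by auto
    have "\<not> t i" if "i > N - 2" for i
    proof -
      have "i = N - 1 \<or> i = N \<or> i > N" using that by linarith
      then show ?thesis using t' configs_outside[OF t'(1), of i] by auto
    qed
    then have "long_runs (t(Suc (N - 2) := True))" using long_runs_extend[OF t'(2), of "N - 2"] N2 by blast
    then have v: "long_runs v" "v \<in> configs N" "v (N - 1)"
      using S t'(1) N5 by (auto simp: v_def intro: configs_upd)
    have "\<not> v i" if "i > N - 1" for i
    proof -
      have "i = N \<or> i > N" using that by linarith
      then show ?thesis using t'(4) that configs_outside[OF v(2), of i] by (auto simp: v_def)
    qed
    then have "long_runs (v(Suc (N - 1) := True))" using long_runs_extend[OF v(1), of "N - 1"] v(3) by blast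
    then have "long_runs (v(N := True))" "v(N := True) \<in> configs N" "(v(N := True)) (N - 1)"
      using S v N5 by (auto intro: configs_upd)
    then show ?thesis using uv v by auto
  qed
  then show "u \<in> configs N" "long_runs u" "u N \<Longrightarrow> u (N - 1)" by auto
qed

lemma hops_step_back:
  assumes u: "u \<in> configs N" "long_runs u" and y: "hops u y"
  shows "st y u \<kappa>"
proof -
  obtain j where j: "Suc (Suc j) \<le> N" "u (Suc j) \<noteq> u (Suc (Suc j))"
    "y = u(Suc j := u (Suc (Suc j)), Suc (Suc j) := u (Suc j))" using y unfolding hops_def by blast
  have yc: "y \<in> configs N" unfolding j(3) using u(1) j(1) by (intro configs_upd) auto
  obtain p where p: "j = Suc (Suc p)" "u j = u (Suc j)" using long_runs_left[OF u(2) j(2)] by blast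
  have r: "u (Suc (Suc (Suc j))) = u (Suc (Suc j))" using long_runs_right(1)[OF u(2) j(2)] .
  show ?thesis
  proof (cases "u (Suc j)")
    case True
    show ?thesis by (rule stL[OF yc j(1)]) (use True j p r in \<open>auto simp: fun_eq_iff\<close>)
  next
    case False
    show ?thesis by (rule stR[OF yc j(1)]) (use False j p r in \<open>auto simp: fun_eq_iff\<close>)
  qed
qed

lemma hops_exits:
  assumes u: "u \<in> configs N" "long_runs u" and y: "hops u y" and e: "st y v c" "0 < c"
  shows "v = u \<or> y N \<and> v = y(N := False)"
proof -
  obtain j where j: "Suc (Suc j) \<le> N" "u (Suc j) \<noteq> u (Suc (Suc j))"
    "y = u(Suc j := u (Suc (Suc j)), Suc (Suc j) := u (Suc j))" using y unfolding hops_def by blast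
  obtain p where p: "j = Suc (Suc p)" using long_runs_left[OF u(2) j(2)] by blast
  have y1: "y 1" using u(2) j(3) p by (auto simp: long_runs_def)
  from e(1) show ?thesis
  proof (cases rule: step.cases)
    case (hopR i)
    then have "y (Suc (Suc (Suc i)))" "\<not> y i" using e(2) k0 by (auto simp: occ_def split: if_splits)
    then have "i = j" using swapped_alternating[OF u(2) j(2,3), of i] hopR by auto
    then show ?thesis using hopR j by (auto simp: fun_eq_iff)
  next
    case (hopL i)
    then have "y i" "\<not> y (Suc (Suc (Suc i)))" using e(2) k0 by (auto simp: occ_def split: if_splits)
    then have "i = j" using swapped_alternating[OF u(2) j(2,3), of i] hopL by auto
    then show ?thesis using hopL j by (auto simp: fun_eq_iff)
  qed (use y1 e(2) mk nk k0 in \<open>auto simp: occ_def split: if_splits\<close>)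
qed

text \<open>The reverse hop has exponent \<open>\<kappa>\<close> and its flux is at most
  \<open>- \<kappa>\<close>.\<close>

lemma hops_h_le:
  assumes "u \<in> configs N" "long_runs u" "hops u y"
  shows "h y \<le> - 2 * \<kappa>"
  using flux_le[OF hops_step_back[OF assms] hops_not_paired[OF hops_sym[OF assms(3)]]] by simp

lemma trap_plus_h_le:
  assumes "trap t" shows "h (t(N := True)) \<le> - \<kappa> - n"
proof -
  have y: "t(N := True) \<in> configs N" using assms N5 by (auto simp: trap_def intro!: configs_upd)
  have "N - Suc 0 \<noteq> N" using N5 by simp
  then have "st (t(N := True)) t n" "\<not> paired (t(N := True)) t"
    using assms by (auto simp: trap_def paired_def fun_eq_iff intro!: st_kill[OF y])
  then show ?thesis using flux_le by fastforce
qed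

text \<open>Emptying site 1 of a core state has exponent \<open>- (m + \<kappa>)\<close>, and
  \<open>t(N := True)\<close> has \<open>h\<close> below \<open>- 2 * \<kappa>\<close> and no
  positive exit out of the basin. Only states one hop away from the core can therefore leak at level
  \<open>- 2 * \<kappa>\<close>; that alternative is kept separate for
  \<open>basin_exit_h\<close>.\<close>

lemma basin_exit:
  assumes t: "trap t" and u: "u \<in> basin t" and v: "v \<notin> basin t" and e: "st u v c"
  shows "h u + c < - 2 * \<kappa> \<or> c \<le> 0 \<and> (\<exists>u'\<in>core t. hops u' u)"
proof -
  have t': "t \<in> configs N" "long_runs t" "\<not> t (N - 1)" "\<not> t N" using t by (auto simp: trap_def)
  obtain q where q: "N = Suc (Suc q)" "3 \<le> q" using N5 by (intro that[of "N - 2"]) auto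
  have uc: "u \<in> configs N" using e st_configs by blast
  have hu: "h u \<le> 0" using h_le uc by blast
  consider (core) "u \<in> core t" | (exc) u' where "u' \<in> core t" "hops u' u" "u \<noteq> t(N := True)"
    | (plus) "u = t(N := True)" using u unfolding basin_def by blast
  then show ?thesis
  proof cases
    case core
    note l = core_long_runs[OF t core]
    have nohop: "\<not> hops u v" using v core unfolding basin_def by blast
    from e show ?thesis
    proof (cases rule: step.cases)
      case (hopR j)
      then have "hops u v" unfolding hops_def by (intro exI[of _ j]) auto
      then show ?thesis using nohop by blast
    next
      case (hopL j)
      then have "hops u v" unfolding hops_def by (intro exI[of _ j]) auto
      then show ?thesis using nohop by blast
    next
      case unfill
      then have "c = - (m + \<kappa>)" using l(2) by (simp add: long_runs_def)
      then show ?thesis using hu mk by simp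
    next
      case kill
      then have "v \<in> core t" using core t' N5 by (auto simp: core_def fun_eq_iff split: if_splits)
      then show ?thesis using v by (simp add: basin_def)
    next
      case create
      then have "v \<in> core t \<or> v = t(N := True)"
        using core t' N5 by (auto simp: core_def fun_eq_iff split: if_splits)
      then show ?thesis using v by (auto simp: basin_def)
    qed (use l(2) in \<open>auto simp: long_runs_def\<close>)
  next
    case (exc u')
    note l = core_long_runs[OF t exc(1)]
    show ?thesis
    proof (cases "c \<le> 0")
      case True
      then show ?thesis using exc by blast
    next
      case False
      have "v \<noteq> u'" using v exc by (auto simp: basin_def)
      then have uN: "u N" and vu: "v = u(N := False)"
        using hops_exits[OF l(1,2) exc(2) e] False by auto
      obtain j where j: "Suc (Suc j) \<le> N" "u' (Suc j) \<noteq> u' (Suc (Suc j))"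
        "u = u'(Suc j := u' (Suc (Suc j)), Suc (Suc j) := u' (Suc j))" using exc(2) unfolding hops_def by blast
      have "v \<in> basin t"
      proof (cases "u' N")
        case True
        then have u': "t (N - 2)" "u' = t(N - 1 := True, N := True)"
          using exc(1) True t' N5 unfolding core_def by (auto split: if_splits)
        then have "Suc (Suc j) < N - 1" using j(1,2) t' q by (cases "j = q"; cases "Suc j = q") auto
        then have "hops (t(N - 1 := True)) v"
          unfolding hops_def using j u' vu t' by (intro exI[of _ j]) (auto simp: fun_eq_iff)
        moreover have "t(N - 1 := True) \<in> core t" using u' by (simp add: core_def)
        ultimately show ?thesis by (auto simp: basin_def)
      next
        case F: False
        then have jN: "Suc (Suc j) = N" using uN j by (cases "Suc (Suc j) = N") auto
        then have "u' = t(N - 1 := True)"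
          using exc(1) j(2) F jN t' N5 unfolding core_def by (auto split: if_splits)
        then have "u = t(N := True)" using j(3) jN t' q by (auto simp: fun_eq_iff)
        then show ?thesis using exc by blast
      qed
      then show ?thesis using v by blast
    qed
  next
    case plus
    have hu': "h u \<le> - \<kappa> - n" using trap_plus_h_le[OF t] plus by simp
    have "c \<le> 0"
      using e
    proof (cases rule: step.cases)
      case (hopR j)
      then have j: "Suc (Suc j) < N" using plus by (cases "Suc (Suc j) = N") auto
      then have "t (Suc j)" "\<not> t (Suc (Suc j))" using hopR plus by auto
      then have "t j" using long_runs_left[OF t'(2), of j] by auto
      then show ?thesis using hopR plus j k0 by (auto simp: occ_def)
    next
      case (hopL j)
      show ?thesis
      proof (cases "Suc (Suc j) = N")
        case True
        \<comment> \<open>If site \<open>N - 2\<close> were occupied, this hop would have exponent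
          \<open>\<kappa>\<close>, but it would end in the extension contained in the core.\<close>
        have "\<not> t (N - 2)"
        proof
          assume "t (N - 2)"
          then have "v \<in> core t" using hopL plus True t' by (auto simp: core_def fun_eq_iff)
          then show False using v by (simp add: basin_def)
        qed
        then show ?thesis using hopL True plus q k0 by (auto simp: occ_def)
      next
        case False
        then have j: "Suc (Suc j) < N" using hopL by auto
        then have "\<not> t (Suc j)" "t (Suc (Suc j))" using hopL plus by auto
        then have "\<not> t j" using long_runs_left[OF t'(2), of j] by auto
        then show ?thesis using hopL plus j k0 by (auto simp: occ_def)
      qed
    next
      case fill
      then show ?thesis using plus t'(2) q by (auto simp: long_runs_def)
    next
      case kill
      then have "v = t" using plus t' by (auto simp: fun_eq_iff)
      then show ?thesis using v by (simp add: basin_def core_def)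
    qed (use plus mk k0 in \<open>auto simp: occ_def\<close>)
    then show ?thesis using hu' nk by simp
  qed
qed

lemma basin_flux_le:
  assumes "trap t" "u \<in> basin t" "v \<notin> basin t" "st u v c"
  shows "h u + c \<le> - 2 * \<kappa>"
proof -
  have "h u \<le> - 2 * \<kappa>" if "u' \<in> core t" "hops u' u" for u'
    using hops_h_le core_long_runs[OF assms(1) that(1)] that(2) by blast
  then show ?thesis using basin_exit[OF assms] by fastforce
qed

lemma active_trap_h:
  assumes "trap t" "active (- \<kappa>) t" shows "h t = 0"
proof -
  obtain y c where "st t y c" "- \<kappa> \<le> h t + c" using assms(2) by (auto simp: active_def)
  moreover have "h t \<le> 0" using h_le assms(1) by (auto simp: trap_def)
  ultimately show ?thesis using trap_slow[OF assms(1)] by fastforce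
qed

text \<open>For the last claim: if the state with \<open>N\<close> occupied had \<open>h\<close>
  equal to 0, a flux \<open>n - \<kappa> > 0\<close> would enter \<open>v\<close>, whose exits all
  have exponent at most 0.\<close>

lemma core_extension:
  assumes t: "trap t" and N2: "t (N - 2)" and v: "v = t(N - 1 := True)"
  shows "slow v" "v \<in> configs N" "\<not> v N" "v (N - 1)" "v(N - 1 := False) = t"
    "v \<noteq> t" "v(N := True) = t(N - 1 := True, N := True)" "h (v(N := True)) < 0"
proof -
  have t': "\<not> t (N - 1)" "\<not> t N" "N - Suc 0 \<noteq> N" using t N5 by (auto simp: trap_def)
  have core: "v \<in> core t" "v(N := True) \<in> core t" using N2 by (auto simp: core_def v)
  note l = core_long_runs[OF t core(1)]
  show s: "slow v" unfolding slow_def using long_runs_slow[OF l(2,3)] by blast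
  show "v \<in> configs N" by (rule l)
  show vN: "\<not> v N" and vN1: "v (N - 1)" and "v(N - 1 := False) = t" and ne: "v \<noteq> t"
    and "v(N := True) = t(N - 1 := True, N := True)" using t' by (auto simp: v fun_eq_iff)
  show "h (v(N := True)) < 0"
  proof (rule ccontr)
    assume "\<not> h (v(N := True)) < 0"
    moreover have c: "v(N := True) \<in> configs N" using l(1) N5 by (intro configs_upd) auto
    ultimately have h0: "h (v(N := True)) = 0" using h_le by force
    have "st (v(N := True)) v (n - \<kappa>)"
      by (rule st_kill[OF c]) (use vN vN1 t'(3) in \<open>auto simp: fun_eq_iff\<close>)
    then have "active (n - \<kappa>) v" using h0 edge_active by force
    then obtain w d where w: "st v w d" "n - \<kappa> \<le> h v + d" by (auto simp: active_def)
    then have d: "d > 0" using h_le[OF l(1)] nk by linarith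
    have "d \<le> - \<kappa> \<or> d \<le> 0"
    proof (cases "paired v w")
      case False
      then show ?thesis using s w(1) by (auto simp: slow_def)
    next
      case True
      from w(1) show ?thesis
      proof (cases rule: step.cases)
        case create
        then show ?thesis using vN1 nk by simp
      next
        case (hopR i)
        then show ?thesis using True hopR_not_paired[of i v] by simp
      next
        case (hopL i)
        then show ?thesis using True hopL_not_paired[of i v] by simp
      qed (use vN l(2) mk k0 in \<open>auto simp: long_runs_def occ_def\<close>)
    qed
    then show False using d k0 by auto
  qed
qed

text \<open>If \<open>u\<close> is not \<open>t\<close>, it or its partner is slow and carries level
  \<open>- \<kappa>\<close>, so its \<open>h\<close> is 0. By \<open>core_extension\<close> it is
  then the extension with \<open>N\<close> vacant, which drains into \<open>t\<close> at the same
  level.\<close>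

lemma core_active_h:
  assumes t: "trap t" and u: "u \<in> core t" and w: "nactive (- \<kappa>) w" "reach (- \<kappa>) w u"
  shows "h t = 0"
proof (cases "u = t")
  case True
  then show ?thesis using active_trap_h[OF t] active_reach[OF nactive_active] w by blast
next
  case False
  define v where "v = t(N - 1 := True)"
  have N2: "t (N - 2)" and uv: "u = v \<or> u = v(N := True)"
    using False u by (auto simp: core_def v_def split: if_splits)
  note v = core_extension[OF t N2 v_def]
  obtain y where y: "nactive (- \<kappa>) y" "reach (- \<kappa>) w y" "y = u \<or> y = u(N := \<not> u N)"
    using nactive_reach[OF w] by blast
  have "v(N := False) = v" using v(3) by (simp add: fun_upd_idem)
  then have yv: "y = v \<or> y = v(N := True)" using y(3) uv v(3) by auto
  have vNc: "v(N := True) \<in> core t" using N2 by (simp add: core_def v_def)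
  have "slow y" using yv v(1) long_runs_slow core_long_runs[OF t vNc] unfolding slow_def by blast
  then have "- \<kappa> \<le> h y - \<kappa>" using nactive_slow y(1) by blast
  then have "y = v" using yv v(8) by auto
  then have "reach (- \<kappa>) y t"
    using slow_exit_right(1)[OF v(2,1,3,4), of "- \<kappa>"] \<open>- \<kappa> \<le> h y - \<kappa>\<close> v(5) by simp
  then show ?thesis
    using active_trap_h[OF t] active_reach[OF nactive_active[OF y(1)]] by blast
qed

text \<open>The exit starts one hop from the core with \<open>h\<close> at least
  \<open>- 2 * \<kappa>\<close>, so the hop back has flux at least \<open>- \<kappa>\<close> and the
  core is active at that level.\<close>

lemma basin_exit_h:
  assumes t: "trap t" and u: "u \<in> basin t" and v: "v \<notin> basin t" and e: "st u v c" "- 2 * \<kappa> \<le> h u + c"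
  shows "h t = 0"
proof -
  obtain u' where u': "u' \<in> core t" "hops u' u" and c: "c \<le> 0"
    using basin_exit[OF t u v e(1)] e(2) by auto
  note l = core_long_runs[OF t u'(1)]
  have b: "st u u' \<kappa>" using hops_step_back[OF l(1,2) u'(2)] .
  have "- \<kappa> \<le> h u + \<kappa>" using e(2) c by simp
  moreover have "\<not> paired u u'" using hops_not_paired[OF hops_sym[OF u'(2)]] .
  ultimately have "nactive (- \<kappa>) u" "reach (- \<kappa>) u u'" using b reach_edge unfolding nactive_def by blast+
  then show ?thesis using core_active_h[OF t u'(1)] by blast
qed

text \<open>If \<open>x\<close> lies outside the basin, the path from \<open>t\<close> to
  \<open>x\<close> leaves it at level \<open>- 2 * \<kappa>\<close>. Inside the basin, only
  \<open>t\<close> and its extension by one particle can have \<open>h\<close> equal to 0.\<close>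

lemma reach_trap_h:
  assumes x: "x \<in> configs N" "h x = 0" and r: "reach (- 2 * \<kappa>) x t" and t: "trap t"
  shows "h t = 0"
proof (cases "x \<in> basin t")
  case False
  have "t \<in> basin t" by (simp add: basin_def core_def)
  then obtain u v c where "u \<in> basin t" "v \<notin> basin t" "st u v c" "- 2 * \<kappa> \<le> h u + c"
    using reach_leaves[OF reach_sym[OF r], of "basin t"] False by blast
  then show ?thesis using basin_exit_h[OF t] by blast
next
  case True
  then consider "x = t" | (ext) "t (N - 2)" "x = t(N - 1 := True) \<or> x = t(N - 1 := True, N := True)"
    | (exc) u where "u \<in> core t" "hops u x" | (plus) "x = t(N := True)"
    by (auto simp: basin_def core_def split: if_splits)
  then show ?thesis
  proof cases
    case ext
    define v where "v = t(N - 1 := True)"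
    note v = core_extension[OF t ext(1) v_def]
    have "x = v" using ext(2) v(7,8) x(2) by (auto simp: v_def)
    then have "reach (- \<kappa>) v t" using slow_exit_right(1)[OF v(2,1,3,4), of "- \<kappa>"] x(2) v(5) by simp
    then show ?thesis using active_trap_h[OF t] reach_active reach_sym v(6) by blast
  next
    case exc
    then show ?thesis using hops_h_le core_long_runs[OF t exc(1)] x(2) k0 by fastforce
  next
    case plus
    then show ?thesis using trap_plus_h_le[OF t] x(2) k0 nk by auto
  qed (use x in simp)
qed

text \<open>The bound of the second scale: the class of the flux contains a trap, and the path from
  there to \<open>x\<close> must leave the basin of that trap.\<close>

lemma flux_le_outside:
  assumes e: "st x y c" "\<not> paired x y" and out: "\<And>t. trap t \<Longrightarrow> x \<notin> basin t"
  shows "h x + c \<le> - 2 * \<kappa>"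
proof -
  have x: "x \<in> configs N" using e st_configs by blast
  have "nactive (h x + c) x" using e by (auto simp: nactive_def)
  then obtain t where t: "reach (h x + c) x t" "trap t" using minimal_rank[OF x] by blast
  have "t \<in> basin t" by (simp add: basin_def core_def)
  then obtain u v d where "u \<in> basin t" "v \<notin> basin t" "st u v d" "h x + c \<le> h u + d"
    using reach_leaves[OF reach_sym[OF t(1)], of "basin t"] out[OF t(2)] by blast
  then show ?thesis using basin_flux_le[OF t(2)] by fastforce
qed

section \<open>Walkers\<close>

text \<open>An isolated particle or hole away from all interfaces does a random walk at rate one.\<close>

lemma walker_le:
  assumes b: "smooth b" and y: "y = b(Suc (Suc p) := v)"
    and p: "b p = b (Suc p)" "b (Suc (Suc (Suc p))) = b (Suc (Suc (Suc (Suc p))))"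
    and y1: "y 1" "\<not> y N" and e: "st y z c"
  shows "c \<le> 0"
proof -
  have yp: "y p = y (Suc p)" "y (Suc (Suc (Suc p))) = y (Suc (Suc (Suc (Suc p))))"
    using p by (simp_all add: y)
  \<comment> \<open>Away from the defect, alternating patterns are excluded by smoothness of
    \<open>b\<close>; near it, by the equal pair of sites on either side.\<close>
  have no: "\<not> (y k = y (Suc (Suc k)) \<and> y (Suc (Suc (Suc k))) = y (Suc k) \<and> y (Suc k) \<noteq> y (Suc (Suc k)))" for k
  proof
    assume a: "y k = y (Suc (Suc k)) \<and> y (Suc (Suc (Suc k))) = y (Suc k) \<and> y (Suc k) \<noteq> y (Suc (Suc k))"
    consider "Suc (Suc p) < k \<or> Suc (Suc (Suc k)) < Suc (Suc p)" | "k = Suc (Suc p)" | "k = Suc p" | "k = p"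
      | "p = Suc k" by linarith
    then show False
    proof cases
      case 1
      then have "y k = b k" "y (Suc k) = b (Suc k)" "y (Suc (Suc k)) = b (Suc (Suc k))" by (auto simp: y)
      then show False using a b[unfolded smooth_def, rule_format, of k] by auto
    next
      case 2
      then have "y (Suc k) = y (Suc (Suc k))" using yp by simp
      then show False using a by blast
    next
      case 3
      then have "y (Suc (Suc k)) = y (Suc (Suc (Suc k)))" using yp by simp
      then show False using a by blast
    next
      case 4
      then have "y k = y (Suc k)" using yp by simp
      then show False using a by blast
    next
      case 5
      then have "y (Suc k) = y (Suc (Suc k))" using yp by simp
      then show False using a by blast
    qed
  qed
  from e show ?thesis
  proof (cases rule: step.cases)
    case (hopR k)
    then show ?thesis using no[of k] k0 by (auto simp: occ_def)
  next
    case (hopL k)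
    then show ?thesis using no[of k] k0 by (auto simp: occ_def)
  qed (use y1 mk nk k0 in \<open>auto simp: occ_def\<close>)
qed

lemma walk_step:
  assumes r: "reach \<theta> t y" "t \<noteq> y" and b: "smooth b" and y: "y = b(Suc (Suc p) := v)"
    and p: "b p = b (Suc p)" "b (Suc (Suc (Suc p))) = b (Suc (Suc (Suc (Suc p))))"
    and y1: "y 1" "\<not> y N" and e: "st y z 0"
  shows "reach \<theta> t z"
proof -
  have "active \<theta> y" using reach_active reach_sym r by blast
  then show ?thesis
    using steepest_edge(1)[OF _ _ e] walker_le[OF b y p y1] reach_trans[OF r(1)] by blast
qed

text \<open>The neutral step is not the fastest exit, because the particle can fall back. But
  \<open>y\<close> is active at \<open>- \<kappa>\<close> with exits at most
  \<open>\<kappa>\<close>, which gives \<open>h y\<close> at least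
  \<open>- 2 * \<kappa>\<close>.\<close>

lemma emit_step:
  assumes t: "h t = 0" and e: "st t y (- \<kappa>)" "st y z 0" and y: "y 1" "\<not> y N"
  shows "reach (- 2 * \<kappa>) t z"
proof -
  have "active (- \<kappa>) y" using edge_active[OF e(1), of "- \<kappa>"] t by simp
  then obtain w c where "st y w c" "- \<kappa> \<le> h y + c" by (auto simp: active_def)
  then have "- 2 * \<kappa> \<le> h y + 0" using st_le_k[OF _ y] by fastforce
  then have "reach (- 2 * \<kappa>) y z" using reach_edge e(2) by blast
  moreover have "reach (- 2 * \<kappa>) t y" using reach_edge[OF e(1)] t k0 by auto
  ultimately show ?thesis using reach_trans by blast
qed

text \<open>The first particle of a later cluster detaches, walks across the gap and attaches to the
  cluster before it. The rank rises by at most 5, falls by 1 per neutral step, and falls by 7 on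
  attachment.\<close>

lemma trap_lower_rank:
  assumes t: "trap t" "h t = 0" and j: "\<not> t (Suc j)" "t (Suc (Suc j))"
  shows "\<exists>t'. reach (- 2 * \<kappa>) t t' \<and> config_rank N t' < config_rank N t"
proof -
  have t': "t \<in> configs N" "long_runs t" "\<not> t (N - 1)" "\<not> t N" using t by (auto simp: trap_def)
  have t123: "t 1" "t 2" "t 3" using t'(2) by (auto simp: long_runs_def)
  have jj: "t (Suc j) \<noteq> t (Suc (Suc j))" using j by auto
  obtain p where p: "j = Suc (Suc p)" "\<not> t j" "\<not> t (Suc p)" using long_runs_left[OF t'(2) jj] j by blast
  have r: "t (Suc (Suc (Suc j)))" "t (Suc (Suc (Suc (Suc j))))" using long_runs_right[OF t'(2) jj] j by auto
  have "Suc (Suc j) \<le> N" using configs_outside[OF t'(1), of "Suc (Suc j)"] j by force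
  moreover have "Suc (Suc j) \<noteq> N" "Suc (Suc j) \<noteq> N - 1" using j t' by auto
  ultimately have jN: "Suc (Suc j) < N - 1" by linarith
  \<comment> \<open>The right end of the preceding cluster; \<open>w i\<close> below has the
    detached particle at site \<open>i\<close>.\<close>
  define e where "e = Max {i. i \<le> j \<and> t i}"
  have j3: "3 < j" using p t123 by (cases "j = 2"; cases "j = 3") (auto simp: eval_nat_numeral)
  have in3: "3 \<in> {i. i \<le> j \<and> t i}" using t123 j3 by auto
  have E: "finite {i. i \<le> j \<and> t i}" "{i. i \<le> j \<and> t i} \<noteq> {}" using in3 by (simp, blast)
  have e: "t e" "e \<le> j" using Max_in[OF E] by (auto simp: e_def)
  have e3: "3 \<le> e" unfolding e_def by (rule Max_ge[OF E(1) in3])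
  have vac: "\<not> t i" if "e < i" "i \<le> j" for i
  proof
    assume "t i"
    then have "i \<le> e" unfolding e_def using that(2) by (intro Max_ge[OF E(1)]) auto
    then show False using that(1) by simp
  qed
  have ep: "e \<le> p"
  proof -
    have "e \<noteq> j" "e \<noteq> Suc p" using e p by auto
    then show ?thesis using e(2) p(1) by linarith
  qed
  define b where "b = t(Suc (Suc j) := False)"
  have vacb: "\<not> b i" if "e < i" "i \<le> Suc (Suc j)" for i
    using vac[of i] that j by (cases "i \<le> j"; cases "i = Suc j") (auto simp: b_def)
  have be: "b e" "b 1" "\<not> b N" using e ep p t123 t' jN by (auto simp: b_def)
  have sm: "smooth b"
    unfolding smooth_def
  proof (intro allI impI)
    fix k assume k: "b (Suc k) \<noteq> b (Suc (Suc k))"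
    consider "Suc k = j \<or> k = j \<or> k = Suc (Suc j)" | "k = Suc j" | "Suc (Suc k) \<le> j" | "k > Suc (Suc j)"
      by linarith
    then show "b k = b (Suc k)"
    proof cases
      case 1
      then show ?thesis using k j p r by (auto simp: b_def)
    next
      case 2
      then show ?thesis using j by (auto simp: b_def)
    next
      case 3
      then have "t (Suc k) \<noteq> t (Suc (Suc k))" using k by (auto simp: b_def)
      then show ?thesis using long_runs_left[OF t'(2)] 3 by (force simp: b_def)
    next
      case 4
      then have "t (Suc k) \<noteq> t (Suc (Suc k))" using k by (auto simp: b_def)
      then show ?thesis using long_runs_left[OF t'(2)] 4 by (force simp: b_def)
    qed
  qed
  have bc: "b \<in> configs N" unfolding b_def using t'(1) jN by (intro configs_upd) auto
  define w where "w = (\<lambda>i. b(i := True))"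
  have wc: "w i \<in> configs N" if "1 \<le> i" "i \<le> N" for i unfolding w_def using bc that by (intro configs_upd)
  have w1: "w i 1" "i < N \<Longrightarrow> \<not> w i N" for i using be by (auto simp: w_def)
  have wt: "w (Suc (Suc i)) \<noteq> t" if "Suc (Suc i) < Suc (Suc j)" for i
    using j that by (auto simp: w_def b_def fun_eq_iff)
  have move: "st (w (Suc (Suc i))) (w (Suc i)) (\<kappa> * (occ b i - occ b (Suc (Suc (Suc i)))))"
    "config_rank N (w (Suc i)) = config_rank N (w (Suc (Suc i))) - 6 * (occ b i - occ b (Suc (Suc (Suc i)))) - 1"
    if i: "e \<le> i" "i < j" for i
  proof -
    have w: "w (Suc i) = (w (Suc (Suc i)))(Suc i := True, Suc (Suc i) := False)"
      "\<not> w (Suc (Suc i)) (Suc i)" "w (Suc (Suc i)) (Suc (Suc i))"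
      using vacb[of "Suc i"] vacb[of "Suc (Suc i)"] i by (auto simp: w_def fun_eq_iff)
    have le: "Suc (Suc i) \<le> N" "Suc (Suc i) < N" using i jN by auto
    have c: "w (Suc (Suc i)) \<in> configs N" using wc le by simp
    show "st (w (Suc (Suc i))) (w (Suc i)) (\<kappa> * (occ b i - occ b (Suc (Suc (Suc i)))))"
      by (rule stL[OF c le(1)]) (use w in \<open>auto simp: w_def\<close>)
    show "config_rank N (w (Suc i)) = config_rank N (w (Suc (Suc i))) - 6 * (occ b i - occ b (Suc (Suc (Suc i)))) - 1"
      using rank_hopL[OF N5 c le(1) w(2,3,1)] le i e3 by (simp add: w_def)
  qed
  have out0: "st t (w (Suc j)) (- \<kappa>)"
    by (rule stL[OF t'(1), of j]) (use j jN p r in \<open>auto simp: w_def b_def fun_eq_iff\<close>)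
  have rank0: "config_rank N (w (Suc j)) \<le> config_rank N t + 5"
    using rank_hopL[OF N5 t'(1), of j "w (Suc j)"] j jN p r j3 by (auto simp: w_def b_def fun_eq_iff)
  have zero: "st (w (Suc (Suc i))) (w (Suc i)) 0" "config_rank N (w (Suc i)) = config_rank N (w (Suc (Suc i))) - 1"
    if "e < i" "i < j" for i using move[of i] vacb[of i] vacb[of "Suc (Suc (Suc i))"] that by auto
  have e2j: "Suc (Suc e) \<le> j" using ep p by simp
  have "reach (- 2 * \<kappa>) t (w (Suc (Suc e))) \<and> config_rank N (w (Suc (Suc e))) \<le> config_rank N t + 5"
    using e2j
  proof (induction rule: inc_induct)
    case base
    have "st (w (Suc j)) (w j) 0" "config_rank N (w j) = config_rank N (w (Suc j)) - 1"
      using zero[of "Suc p"] p ep by auto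
    then show ?case using emit_step[OF t(2) out0] w1[of "Suc j"] jN rank0 by auto
  next
    case (step i)
    obtain q where q: "i = Suc q" using step(1) by (cases i) auto
    have z: "st (w (Suc i)) (w i) 0" "config_rank N (w i) = config_rank N (w (Suc i)) - 1"
      using zero[of q] q step(1,2) by auto
    have "reach (- 2 * \<kappa>) t (w i)"
    proof (rule walk_step[where y = "w (Suc i)" and b = b and p = q and v = True])
      show "t \<noteq> w (Suc i)" using wt[of q] q step(2) by auto
      show "reach (- 2 * \<kappa>) t (w (Suc i))" using step by blast
      show "smooth b" by (rule sm)
      show "b q = b (Suc q)" "b (Suc (Suc (Suc q))) = b (Suc (Suc (Suc (Suc q))))"
        using vacb step(1,2) q by auto
      show "w (Suc i) 1" "\<not> w (Suc i) N" using w1[of "Suc i"] jN step(2) by auto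
      show "st (w (Suc i)) (w i) 0" by (rule z)
    qed (simp add: w_def q)
    then show ?case using step z by auto
  qed
  then have r2: "reach (- 2 * \<kappa>) t (w (Suc (Suc e)))" "config_rank N (w (Suc (Suc e))) \<le> config_rank N t + 5" by auto
  have "\<not> b (Suc (Suc (Suc e)))" using vacb e2j by auto
  then have g: "st (w (Suc (Suc e))) (w (Suc e)) \<kappa>" "config_rank N (w (Suc e)) = config_rank N (w (Suc (Suc e))) - 7"
    using move[of e] e2j be by auto
  have "active (- 2 * \<kappa>) (w (Suc (Suc e)))" using reach_active[OF reach_sym[OF r2(1)]] wt[of e] e2j by auto
  moreover have "c \<le> \<kappa>" if "st (w (Suc (Suc e))) y c" for y c
    using st_le_k[OF that] w1[of "Suc (Suc e)"] e2j jN by simp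
  ultimately have "reach (- 2 * \<kappa>) (w (Suc (Suc e))) (w (Suc e))"
    using steepest_edge(1)[OF _ _ g(1)] by blast
  then show ?thesis using reach_trans[OF r2(1)] g(2) r2(2) by (intro exI[of _ "w (Suc e)"]) auto
qed

section \<open>Traps that are a single block\<close>

lemma eta_configs: "p \<le> N \<Longrightarrow> eta p q \<in> configs N"
  by (auto simp: eta_def configs_def)

lemma trap_eta:
  assumes "3 \<le> p" "p + 2 \<le> N" shows "trap (eta p 0)"
proof -
  have "eta p 0 \<in> configs N" using assms by (intro eta_configs) auto
  then show ?thesis unfolding trap_def long_runs_def using assms by (auto simp: eta_def)
qed

text \<open>By \<open>trap_lower_rank\<close> the trap of least rank has no vacancy followed by a
  particle, so it is one block.\<close>

lemma reach_eta:
  assumes x: "x \<in> configs N" "h x = 0" and a: "nactive (- 2 * \<kappa>) x"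
  obtains p where "3 \<le> p" "p + 2 \<le> N" "reach (- 2 * \<kappa>) x (eta p 0)"
proof -
  obtain t where t: "reach (- 2 * \<kappa>) x t" "trap t" "\<And>z. reach (- 2 * \<kappa>) x z \<Longrightarrow> config_rank N t \<le> config_rank N z"
    using minimal_rank[OF x(1) a] by blast
  have ht: "h t = 0" using reach_trap_h[OF x t(1,2)] .
  have mono: "t (Suc j)" if tj: "t (Suc (Suc j))" for j
  proof (rule ccontr)
    assume "\<not> t (Suc j)"
    then obtain t' where "reach (- 2 * \<kappa>) t t'" "config_rank N t' < config_rank N t"
      using trap_lower_rank[OF t(2) ht _ tj] by blast
    then show False using t(3)[of t'] reach_trans[OF t(1)] by force
  qed
  have t': "t \<in> configs N" "long_runs t" "\<not> t (N - 1)" "\<not> t N" using t by (auto simp: trap_def)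
  define p where "p = Max {i. t i}"
  have "{i. t i} \<subseteq> {1..N}" using t'(1) by (auto simp: configs_def)
  then have fin: "finite {i. t i}" by (rule finite_subset) auto
  have t3: "t 3" using t'(2) by (simp add: long_runs_def)
  have tp: "t p" using Max_in[OF fin] t3 by (auto simp: p_def)
  have le: "i \<le> p" if "t i" for i unfolding p_def using Max_ge[OF fin] that by auto
  have all: "t i" if "i \<le> p" "1 \<le> i" for i
    using that
  proof (induction rule: inc_induct)
    case (step k)
    then show ?case using mono[of "k - 1"] by (cases k) auto
  qed (use tp in simp)
  have "t = eta p 0"
    using le all configs_outside[OF t'(1)] by (auto simp: eta_def fun_eq_iff Suc_le_eq intro: gr0I)
  moreover have "3 \<le> p" using le t3 by blast
  moreover have "p \<le> N" "p \<noteq> N" "p \<noteq> N - 1" using configs_outside[OF t'(1), of p] tp t' by (force, auto)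
  ultimately show ?thesis using that t(1) by auto
qed

text \<open>The last particle of the block breaks off, walks to \<open>N\<close> and is removed
  there. \<open>w i\<close> is the shorter block with the free particle at \<open>i\<close>.\<close>

lemma eta_down:
  assumes p: "4 \<le> p" "p + 2 \<le> N" and h0: "h (eta p 0) = 0"
  shows "h (eta (p - 1) 0) = 0"
proof -
  define b where "b = eta (p - 1) 0"
  define w where "w = (\<lambda>i. b(i := True))"
  have bI: "b i \<longleftrightarrow> 1 \<le> i \<and> i < p" for i using p by (auto simp: b_def eta_def)
  have sm: "smooth b" unfolding b_def using p by (intro smooth_eta) auto
  have wc: "w i \<in> configs N" if "1 \<le> i" "i \<le> N" for i
    unfolding w_def b_def using that p by (intro configs_upd eta_configs) auto
  have w1: "w i 1" "i < N \<Longrightarrow> \<not> w i N" for i using p by (auto simp: w_def bI)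
  have move: "st (w (Suc i)) (w (Suc (Suc i))) 0" if "p \<le> i" "Suc (Suc i) \<le> N" for i
    by (rule stR[OF wc, of "Suc i" i]) (use that p in \<open>auto simp: w_def bI fun_eq_iff\<close>)
  obtain p' where p': "p = Suc p'" using p by (cases p) auto
  have out0: "st (eta p 0) (w (Suc p)) (- \<kappa>)"
    by (rule stR[OF eta_configs, of p p']) (use p p' in \<open>auto simp: w_def bI eta_def fun_eq_iff\<close>)
  have walk: "reach (- 2 * \<kappa>) (eta p 0) (w i)" if "Suc (Suc p) \<le> i" "i \<le> N" for i
    using that
  proof (induction rule: dec_induct)
    case base
    show ?case using emit_step[OF h0 out0 move] w1[of "Suc p"] p by auto
  next
    case (step i)
    obtain q where q: "i = Suc (Suc q)" using step(1) by (cases i; cases "i - 1") auto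
    have r: "reach (- 2 * \<kappa>) (eta p 0) (w i)" using step by auto
    show ?case
    proof (rule walk_step[OF r _ sm, of q True])
      show "eta p 0 \<noteq> w i" using step(1) p by (auto simp: w_def bI eta_def fun_eq_iff intro!: exI[of _ p])
      show "st (w i) (w (Suc i)) 0" using move[of "Suc q"] q step(1,4) by auto
    qed (use step(1,4) w1[of i] q in \<open>auto simp: w_def bI\<close>)
  qed
  then have r: "reach (- 2 * \<kappa>) (eta p 0) (w N)" using p by simp
  have wNc: "w N \<in> configs N" using wc p by simp
  have "\<not> b (N - 1)" using p by (auto simp: bI)
  then have e: "st (w N) b n"
    by (intro st_kill[OF wNc]) (use p in \<open>auto simp: w_def bI fun_eq_iff\<close>)
  have "eta p 0 \<noteq> w N" using p by (auto simp: w_def bI eta_def fun_eq_iff intro!: exI[of _ p])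
  then have "active (- 2 * \<kappa>) (w N)" using reach_active[OF reach_sym[OF r]] by auto
  then have "reach (- 2 * \<kappa>) (w N) b" using steepest_edge(1)[OF _ _ e] st_le_n w1(1) by blast
  then have "reach (- 2 * \<kappa>) (eta p 0) b" using reach_trans[OF r] by blast
  moreover have "trap b" unfolding b_def using p by (intro trap_eta) auto
  ultimately show ?thesis using reach_trap_h[OF eta_configs h0] p unfolding b_def by auto
qed

text \<open>The last particle moves one site to the right, and the hole it leaves walks to site 1,
  where the reservoir fills it. \<open>w i\<close> is the longer block with a hole at
  \<open>i\<close>; the last hop, from 2 to 1, has exponent \<open>\<kappa>\<close> because site 0
  is vacant.\<close>

lemma eta_up:
  assumes p: "3 \<le> p" "p + 3 \<le> N" and h0: "h (eta p 0) = 0"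
  shows "h (eta (Suc p) 0) = 0"
proof -
  define b where "b = eta (Suc p) 0"
  define w where "w = (\<lambda>i. b(i := False))"
  have bI: "b i \<longleftrightarrow> 1 \<le> i \<and> i \<le> Suc p" for i by (auto simp: b_def eta_def)
  have sm: "smooth b" unfolding b_def using p by (intro smooth_eta) auto
  have wc: "w i \<in> configs N" if "1 \<le> i" "i \<le> N" for i
    unfolding w_def b_def using that p by (intro configs_upd eta_configs) auto
  have w1: "i \<noteq> 1 \<Longrightarrow> w i 1" "\<not> w i N" for i using p by (auto simp: w_def bI)
  have move: "st (w (Suc (Suc i))) (w (Suc i)) 0" if "1 \<le> i" "Suc (Suc i) \<le> p" for i
    by (rule stR[OF wc, of "Suc (Suc i)" i]) (use that p in \<open>auto simp: w_def bI fun_eq_iff\<close>)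
  obtain p' where p': "p = Suc (Suc p')" "1 \<le> p'" using p by (intro that[of "p - 2"]) auto
  have out0: "st (eta p 0) (w p) (- \<kappa>)"
    by (rule stR[OF eta_configs, of p "Suc p'"]) (use p p' in \<open>auto simp: w_def bI eta_def fun_eq_iff\<close>)
  have ne: "eta p 0 \<noteq> w i" if "i \<le> p" for i
    using p that by (auto simp: w_def bI eta_def fun_eq_iff intro!: exI[of _ "Suc p"])
  have "2 \<le> Suc p'" using p' by simp
  then have r2: "reach (- 2 * \<kappa>) (eta p 0) (w 2)"
  proof (induction rule: inc_induct)
    case base
    show ?case using emit_step[OF h0 out0, of "w (Suc p')"] move[of p'] p' w1[of p] by auto
  next
    case (step i)
    obtain q where q: "Suc i = Suc (Suc q)" "1 \<le> q" using step(1) by (cases i) auto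
    show ?case
    proof (rule walk_step[OF step(3) _ sm, of q False])
      show "eta p 0 \<noteq> w (Suc i)" using ne step(2) p' by auto
      show "st (w (Suc i)) (w i) 0" using move[of q] q step(1,2) p' by auto
    qed (use step(1,2) w1[of "Suc i"] q p' in \<open>auto simp: w_def bI\<close>)
  qed
  have e2: "st (w 2) (w 1) \<kappa>"
    by (rule stR[OF wc, of 2 0]) (use p in \<open>auto simp: w_def bI fun_eq_iff eval_nat_numeral\<close>)
  have "active (- 2 * \<kappa>) (w 2)" using reach_active[OF reach_sym[OF r2]] ne[of 2] p by auto
  then have "reach (- 2 * \<kappa>) (w 2) (w 1)"
    using steepest_edge(1)[OF _ _ e2] st_le_k w1[of 2] by auto
  then have r1: "reach (- 2 * \<kappa>) (eta p 0) (w 1)" using reach_trans[OF r2] by blast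
  have w11: "\<not> w 1 1" "w 1 2" using p by (auto simp: w_def bI)
  have e1: "st (w 1) b (m + \<kappa>)"
    by (rule st_fill[OF wc]) (use p in \<open>auto simp: w_def bI fun_eq_iff\<close>)
  have "active (- 2 * \<kappa>) (w 1)" using reach_active[OF reach_sym[OF r1]] ne[of 1] p by auto
  then have "reach (- 2 * \<kappa>) (w 1) b"
    using steepest_edge(1)[OF _ _ e1] st_le_fill[OF _ w11 w1(2)] by blast
  then have "reach (- 2 * \<kappa>) (eta p 0) b" using reach_trans[OF r1] by blast
  moreover have "trap b" unfolding b_def using p by (intro trap_eta) auto
  ultimately show ?thesis using reach_trap_h[OF eta_configs h0] p unfolding b_def by auto
qed

lemma eta_all:
  assumes p: "3 \<le> p" "p + 2 \<le> N" "h (eta p 0) = 0" and q: "3 \<le> q" "q + 2 \<le> N"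
  shows "h (eta q 0) = 0"
proof (cases "q \<le> p")
  case True
  then show ?thesis
  proof (induction rule: inc_induct)
    case (step k)
    then show ?case using eta_down[of "Suc k"] p q by auto
  qed (use p in simp)
next
  case False
  then have "p \<le> q" by simp
  then show ?thesis
  proof (induction rule: dec_induct)
    case (step k)
    then show ?case using eta_up[of k] p q by auto
  qed (use p in simp)
qed

section \<open>Blocks with one defect\<close>

text \<open>The states through which the traps \<open>eta p 0\<close> communicate: a block at the left end,
  possibly with one hole in it or with one free particle to its right.\<close>

definition near_block :: "config \<Rightarrow> bool" where
  "near_block x \<longleftrightarrow>
     (\<exists>a. 2 \<le> a \<and> a \<le> N \<and> (\<forall>i. x i \<longleftrightarrow> 1 \<le> i \<and> i \<le> a)) \<or>
     (\<exists>g b. 1 \<le> g \<and> g < b \<and> 3 \<le> b \<and> b \<le> N \<and> (\<forall>i. x i \<longleftrightarrow> 1 \<le> i \<and> i \<le> b \<and> i \<noteq> g)) \<or>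
     (\<exists>a j. 2 \<le> a \<and> a + 3 \<le> j \<and> j \<le> N \<and> (\<forall>i. x i \<longleftrightarrow> 1 \<le> i \<and> i \<le> a \<or> i = j))"

lemma near_block_cases [consumes 1, case_names full hole free]:
  assumes "near_block x"
  obtains a where "2 \<le> a" "a \<le> N" "\<forall>i. x i \<longleftrightarrow> 1 \<le> i \<and> i \<le> a"
  | g b where "1 \<le> g" "g < b" "3 \<le> b" "b \<le> N" "\<forall>i. x i \<longleftrightarrow> 1 \<le> i \<and> i \<le> b \<and> i \<noteq> g"
  | a j where "2 \<le> a" "a + 3 \<le> j" "j \<le> N" "\<forall>i. x i \<longleftrightarrow> 1 \<le> i \<and> i \<le> a \<or> i = j"
  using assms unfolding near_block_def
proof (elim disjE exE conjE)
qed (rule that; assumption)+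

lemma near_block_full: "2 \<le> a \<Longrightarrow> a \<le> N \<Longrightarrow> (\<And>i. x i \<longleftrightarrow> 1 \<le> i \<and> i \<le> a) \<Longrightarrow> near_block x"
  unfolding near_block_def by blast

lemma near_block_hole:
  "1 \<le> g \<Longrightarrow> g < b \<Longrightarrow> 3 \<le> b \<Longrightarrow> b \<le> N \<Longrightarrow> (\<And>i. x i \<longleftrightarrow> 1 \<le> i \<and> i \<le> b \<and> i \<noteq> g) \<Longrightarrow> near_block x"
  unfolding near_block_def by blast

lemma near_block_free:
  "2 \<le> a \<Longrightarrow> a + 3 \<le> j \<Longrightarrow> j \<le> N \<Longrightarrow> (\<And>i. x i \<longleftrightarrow> 1 \<le> i \<and> i \<le> a \<or> i = j) \<Longrightarrow> near_block x"
  unfolding near_block_def by blast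

lemma hops_not_smooth:
  assumes u: "long_runs u" and y: "hops u y" shows "\<not> smooth y" "y 2"
proof -
  obtain j where j: "Suc (Suc j) \<le> N" "u (Suc j) \<noteq> u (Suc (Suc j))"
    "y = u(Suc j := u (Suc (Suc j)), Suc (Suc j) := u (Suc j))" using y unfolding hops_def by blast
  obtain p where p: "j = Suc (Suc p)" "u j = u (Suc j)" using long_runs_left[OF u j(2)] by blast
  have yj: "y j = u (Suc j)" "y (Suc j) = u (Suc (Suc j))" "y (Suc (Suc j)) = u (Suc j)"
    using p(2) by (simp_all add: j(3))
  show "\<not> smooth y"
  proof
    assume "smooth y"
    then have "y (Suc j) \<noteq> y (Suc (Suc j)) \<longrightarrow> y j = y (Suc j)" unfolding smooth_def by blast
    then show False using yj j(2) by blast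
  qed
  show "y 2" using u p(1) j(3) by (simp add: long_runs_def)
qed

text \<open>Used in the contrapositive, to place states outside all basins, where
  \<open>flux_le_outside\<close> applies.\<close>

lemma basin_shape:
  assumes t: "trap t" and x: "x \<in> basin t"
  shows "x 2" "long_runs x \<and> (x N \<longrightarrow> x (N - 1)) \<or> (\<exists>u. st x u \<kappa>) \<and> \<not> smooth x \<or> x N \<and> \<not> x (N - 1)"
proof -
  consider (core) "x \<in> core t" | (exc) u where "u \<in> core t" "hops u x" | (plus) "x = t(N := True)"
    using x by (auto simp: basin_def)
  then have "x 2 \<and> (long_runs x \<and> (x N \<longrightarrow> x (N - 1)) \<or> (\<exists>u. st x u \<kappa>) \<and> \<not> smooth x \<or> x N \<and> \<not> x (N - 1))"
  proof cases
    case core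
    then show ?thesis using core_long_runs[OF t core] by (simp add: long_runs_def)
  next
    case exc
    note l = core_long_runs[OF t exc(1)]
    show ?thesis using hops_not_smooth[OF l(2) exc(2)] hops_step_back[OF l(1,2) exc(2)] by blast
  next
    case plus
    moreover have "t 2" "\<not> t (N - 1)" using t unfolding trap_def long_runs_def by blast+
    moreover have "N \<noteq> 2" "N - 1 \<noteq> N" using N5 by auto
    ultimately show ?thesis by simp
  qed
  then show "x 2" "long_runs x \<and> (x N \<longrightarrow> x (N - 1)) \<or> (\<exists>u. st x u \<kappa>) \<and> \<not> smooth x \<or> x N \<and> \<not> x (N - 1)"
    by blast+
qed

text \<open>A neutral exit rules out long runs, and the absence of gaining exits rules out a state
  one hop from a core. Hence the state lies in no basin.\<close>

lemma zero_state_h: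
  assumes e: "st x y 0" "\<not> paired x y" and N: "\<not> x N" and le: "\<And>z c. st x z c \<Longrightarrow> c \<le> 0"
  shows "h x \<le> - 2 * \<kappa>"
proof -
  have "x \<notin> basin t" if t: "trap t" for t
  proof
    assume "x \<in> basin t"
    then have "long_runs x \<or> (\<exists>u. st x u \<kappa>)" using basin_shape(2)[OF t] N by blast
    then show False
    proof
      assume "long_runs x"
      then show False using long_runs_slow[OF _ _ e] N k0 by auto
    next
      assume "\<exists>u. st x u \<kappa>"
      then show False using le k0 by fastforce
    qed
  qed
  then show ?thesis using flux_le_outside[OF e] by auto
qed

lemma near_block_step_full:
  assumes a: "2 \<le> a" "a \<le> N" and xI: "\<And>i. x i \<longleftrightarrow> 1 \<le> i \<and> i \<le> a"
    and e: "st x y c" "- 2 * \<kappa> \<le> h x + c"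
  shows "near_block y"
  using e(1)
proof (cases rule: step.cases)
  case (hopR j)
  then have "Suc j = a" by (auto simp: xI)
  then show ?thesis using hopR a by (intro near_block_hole[of a "Suc a"]) (auto simp: xI)
next
  case (hopL j)
  then show ?thesis by (auto simp: xI)
next
  case unfill
  then have "c = - (m + \<kappa>)" using a by (simp add: xI)
  then show ?thesis using e(2) h_le unfill mk by force
next
  case kill
  then have "a = N" using a by (auto simp: xI)
  then show ?thesis using kill a N5 by (intro near_block_full[of "N - 1"]) (auto simp: xI)
next
  case create
  then have "a < N" using a by (auto simp: xI)
  then consider "a = N - 1" | "a = N - 2" | "a + 3 \<le> N" by linarith
  then show ?thesis
  proof cases
    case 1
    then show ?thesis using create a N5 by (intro near_block_full[of N]) (auto simp: xI)
  next
    case 2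
    then show ?thesis using create a N5 by (intro near_block_hole[of "N - 1" N]) (auto simp: xI)
  next
    case 3
    then show ?thesis using create a N5 by (intro near_block_free[of a N]) (auto simp: xI)
  qed
qed (use a in \<open>auto simp: xI\<close>)

text \<open>Only an exit that creates a second defect could leave the set. The bounds
  \<open>h1\<close> to \<open>h4\<close>, obtained from the moves of the hole to the left or its
  filling at site 1, make such exits too weak.\<close>

lemma near_block_step_hole:
  assumes g: "1 \<le> g" "g < b" "3 \<le> b" "b \<le> N" and xI: "\<And>i. x i \<longleftrightarrow> 1 \<le> i \<and> i \<le> b \<and> i \<noteq> g"
    and e: "st x y c" "- 2 * \<kappa> \<le> h x + c"
  shows "near_block y"
proof -
  have x: "x \<in> configs N" using e st_configs by blast
  have left: "\<exists>z. st x z (\<kappa> * (1 - occ x p)) \<and> \<not> paired x z" if p: "g = Suc (Suc p)" for p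
  proof -
    have "st x (x(Suc p := False, Suc (Suc p) := True)) (\<kappa> * (1 - occ x p))"
      by (rule stR[OF x, of p]) (use g p in \<open>auto simp: xI occ_def\<close>)
    moreover have "\<not> paired x (x(Suc p := False, Suc (Suc p) := True))"
      by (rule hopR_not_paired) (use g p in \<open>auto simp: xI\<close>)
    ultimately show ?thesis by blast
  qed
  have h1: "h x \<le> - \<kappa> - m" if "g = 1"
  proof -
    have "st x (x(1 := True)) (m + \<kappa> * occ x 2)" by (rule st_fill[OF x]) (use that in \<open>auto simp: xI\<close>)
    moreover have "\<not> paired x (x(1 := True))" using N5 that by (auto simp: paired_def fun_eq_iff xI)
    ultimately show ?thesis using flux_le[of x _ "m + \<kappa> * occ x 2"] k0 that g by (force simp: xI)
  qed
  have h2: "h x \<le> - 2 * \<kappa>" if "g = 2"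
  proof -
    have "g = Suc (Suc 0)" "occ x 0 = 0" using that by (auto simp: xI)
    then show ?thesis using left[of 0] flux_le by fastforce
  qed
  have h3: "h x \<le> - \<kappa>"
  proof -
    consider "g = 1" | p where "g = Suc (Suc p)" using g by (cases g; cases "g - 1") auto
    then show ?thesis
    proof cases
      case 1
      then show ?thesis using h1 mk k0 by linarith
    next
      case (2 p)
      then obtain z where "st x z (\<kappa> * (1 - occ x p))" "\<not> paired x z" using left by blast
      moreover have "0 \<le> \<kappa> * (1 - occ x p)" using k0 occ_bounds[of x p] by simp
      ultimately show ?thesis using flux_le by fastforce
    qed
  qed
  have h4: "h x \<le> - 2 * \<kappa>" if gb: "g + 2 \<le> b" "b < N"
  proof -
    consider "g = 1" | "g = 2" | p where "g = Suc (Suc p)" "1 \<le> p"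
      using g by (cases g; cases "g - 1"; cases "g - 2") auto
    then show ?thesis
    proof cases
      case 1
      then show ?thesis using h1 mk by linarith
    next
      case 2
      then show ?thesis using h2 by blast
    next
      case (3 p)
      have "occ x p = 1" using 3 g by (simp add: xI)
      then obtain z where z: "st x z 0" "\<not> paired x z" using left[OF 3(1)] by auto
      have eI: "\<And>i. eta b 0 i \<longleftrightarrow> 1 \<le> i \<and> i \<le> b" by (simp add: eta_def)
      have xe: "x = (eta b 0)(Suc (Suc p) := False)" using 3 by (auto simp: fun_eq_iff xI eI)
      have xN: "x 1" "\<not> x N" using gb 3 g by (auto simp: xI)
      show ?thesis
      proof (rule zero_state_h[OF z xN(2)])
        fix w d assume "st x w d"
        then show "d \<le> 0"
          using walker_le[OF smooth_eta xe, of w d] xN 3 gb g by (auto simp: eI)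
      qed
    qed
  qed
  from e(1) show ?thesis
  proof (cases rule: step.cases)
    case (hopR j)
    then have "Suc (Suc j) = g \<or> Suc j = b" by (auto simp: xI)
    then show ?thesis
    proof
      assume "Suc (Suc j) = g"
      then show ?thesis using hopR g by (intro near_block_hole[of "Suc j" b]) (auto simp: xI)
    next
      assume jb: "Suc j = b"
      then have bN: "b < N" using hopR by auto
      show ?thesis
      proof (cases "g + 2 \<le> b")
        case True
        have "c = - \<kappa>" using hopR jb True g by (simp add: xI)
        then show ?thesis using h4[OF True bN] e(2) k0 by simp
      next
        case False
        then have gb: "b = Suc g" using g by simp
        show ?thesis
        proof (cases "b = 3")
          case True
          then have g2: "g = 2" using gb by simp
          have c0: "c = 0" using hopR jb True g2 by (simp add: xI)
          have "g = Suc (Suc 0)" "occ x 0 = 0" using g2 by (auto simp: xI)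
          then obtain z where z: "st x z \<kappa>" "\<not> paired x z" using left[of 0] by auto
          \<comment> \<open>In 1010 the detaching hop is neutral and would leave a block of length
            one. Since site 2 is vacant, the state is outside all basins, and its gaining exit
            forces \<open>h x\<close> down to \<open>- 3 * \<kappa>\<close>.\<close>
          have "\<not> x 2" using g2 by (simp add: xI)
          then have "h x + \<kappa> \<le> - 2 * \<kappa>" using flux_le_outside[OF z] basin_shape(1) by blast
          then show ?thesis using c0 e(2) k0 by simp
        next
          case F: False
          then show ?thesis using hopR jb gb g
            by (intro near_block_free[of "g - 1" "Suc b"]) (auto simp: xI)
        qed
      qed
    qed
  next
    case (hopL j)
    then have jg: "Suc j = g" by (auto simp: xI)
    show ?thesis
    proof (cases "Suc g = b")
      case True
      then show ?thesis using hopL jg g by (intro near_block_full[of g]) (auto simp: xI)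
    next
      case False
      then show ?thesis using hopL jg g by (intro near_block_hole[of "Suc g" b]) (auto simp: xI)
    qed
  next
    case fill
    then have "g = 1" using g by (auto simp: xI)
    then show ?thesis using fill g by (intro near_block_full[of b]) (auto simp: xI)
  next
    case unfill
    then have g1: "g \<noteq> 1" by (auto simp: xI)
    have "h x + c < - 2 * \<kappa>"
    proof (cases "g = 2")
      case True
      then have "c = - m" using unfill by (simp add: xI)
      then show ?thesis using h2[OF True] mk k0 by simp
    next
      case False
      then have "c = - (m + \<kappa>)" using unfill g g1 by (simp add: xI)
      then show ?thesis using h3 mk k0 by simp
    qed
    then show ?thesis using e(2) by simp
  next
    case kill
    then have bN: "b = N" using g by (auto simp: xI)
    show ?thesis
    proof (cases "g = N - 1")
      case True
      then show ?thesis using kill bN N5 by (intro near_block_full[of "N - 2"]) (auto simp: xI)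
    next
      case False
      then show ?thesis using kill bN N5 g by (intro near_block_hole[of g "N - 1"]) (auto simp: xI)
    qed
  next
    case create
    then have bN: "b < N" using g by (auto simp: xI)
    show ?thesis
    proof (cases "b = N - 1")
      case True
      then show ?thesis using create bN N5 g by (intro near_block_hole[of g N]) (auto simp: xI)
    next
      case False
      then have "\<not> x (N - 1)" unfolding xI using bN by linarith
      then have "c = - n" using create by simp
      then show ?thesis using h3 e(2) nk by simp
    qed
  qed
qed

lemma near_block_step_free:
  assumes a: "2 \<le> a" "a + 3 \<le> j" "j \<le> N" and xI: "\<And>i. x i \<longleftrightarrow> 1 \<le> i \<and> i \<le> a \<or> i = j"
    and e: "st x y c" "- 2 * \<kappa> \<le> h x + c"
  shows "near_block y"
proof -
  have x: "x \<in> configs N" using e st_configs by blast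
  obtain p where p: "j = Suc (Suc p)" "a < p" using a by (intro that[of "j - 2"]) auto
  have h0: "h x \<le> - 2 * \<kappa>" if jN: "j < N"
  proof -
    define z where "z = x(Suc p := True, Suc (Suc p) := False)"
    have z: "st x z 0" by (rule stL[OF x, of p]) (use a p jN in \<open>auto simp: xI z_def occ_def\<close>)
    have np: "\<not> paired x z" unfolding z_def by (rule hopL_not_paired) (use a p jN in \<open>auto simp: xI\<close>)
    have eI: "\<And>i. eta a 0 i \<longleftrightarrow> 1 \<le> i \<and> i \<le> a" by (simp add: eta_def)
    have xe: "x = (eta a 0)(Suc (Suc p) := True)" using p by (auto simp: fun_eq_iff xI eI)
    have xN: "x 1" "\<not> x N" using jN a by (auto simp: xI)
    show ?thesis
    proof (rule zero_state_h[OF z np xN(2)])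
      fix w d assume "st x w d"
      then show "d \<le> 0"
        using walker_le[OF smooth_eta xe, of w d] xN p a by (auto simp: eI)
    qed
  qed
  have hN: "h x \<le> - \<kappa> - n" if jN: "j = N"
  proof -
    have f: "\<not> x (N - 1)" "x N" using jN a by (auto simp: xI)
    then have "st x (x(N := False)) n" "\<not> paired x (x(N := False))"
      by (auto intro!: st_kill[OF x] simp: paired_def)
    then show ?thesis using flux_le by fastforce
  qed
  have neg: False if "c \<le> - \<kappa>"
    using that e(2) h0 hN nk k0 a by (cases "j = N") auto
  from e(1) show ?thesis
  proof (cases rule: step.cases)
    case (hopR k)
    then have "Suc k = a \<or> Suc k = j" by (auto simp: xI)
    then show ?thesis
    proof
      assume k: "Suc k = a"
      then have "c = - \<kappa>" using hopR a by (simp add: xI)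
      then show ?thesis using neg by simp
    next
      assume "Suc k = j"
      then show ?thesis using hopR a by (intro near_block_free[of a "Suc j"]) (auto simp: xI)
    qed
  next
    case (hopL k)
    then have k: "Suc (Suc k) = j" by (auto simp: xI)
    show ?thesis
    proof (cases "j = a + 3")
      case True
      \<comment> \<open>At distance two from the block the particle becomes the end of a longer
        block with a hole at \<open>a + 1\<close>.\<close>
      then show ?thesis using hopL k a by (intro near_block_hole[of "a + 1" "a + 2"]) (auto simp: xI)
    next
      case False
      then show ?thesis using hopL k a by (intro near_block_free[of a "Suc k"]) (auto simp: xI)
    qed
  next
    case unfill
    then have "c = - (m + \<kappa>)" using a by (simp add: xI)
    then show ?thesis using neg mk k0 by simp
  next
    case kill
    then have "j = N" using a by (auto simp: xI)
    then show ?thesis using kill a by (intro near_block_full[of a]) (auto simp: xI)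
  next
    case create
    then have jN: "j < N" using a by (auto simp: xI)
    have "c < 0" using create nk k0 by (auto simp: occ_def)
    then show ?thesis using h0[OF jN] e(2) by simp
  qed (use a in \<open>auto simp: xI\<close>)
qed

lemma near_block_closed:
  assumes "near_block x" "reach (- 2 * \<kappa>) x y"
  shows "near_block y"
proof (rule ccontr)
  assume "\<not> near_block y"
  then obtain u v c where "near_block u" "\<not> near_block v" "st u v c" "- 2 * \<kappa> \<le> h u + c"
    using reach_leaves[OF assms(2), of "Collect near_block"] assms(1) by auto
  note e = this(3,4) and u = this(1) and v = this(2)
  from u have "near_block v"
  proof (cases rule: near_block_cases)
    case (full a)
    show ?thesis by (rule near_block_step_full[OF full(1,2) _ e]) (use full(3) in blast)
  next
    case (hole g b)
    show ?thesis by (rule near_block_step_hole[OF hole(1-4) _ e]) (use hole(5) in blast)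
  next
    case (free a j)
    show ?thesis by (rule near_block_step_free[OF free(1-3) _ e]) (use free(4) in blast)
  qed
  then show False using v by blast
qed

text \<open>With \<open>h\<close> equal to 0 any hop suffices, as its exponent is at least
  \<open>- \<kappa>\<close>. Only the full configuration allows neither a hop to the right nor a
  filling of site 1.\<close>

lemma nactive_zero:
  assumes x: "x \<in> configs N" "h x = 0" and ne: "x \<noteq> eta N 0"
  shows "nactive (- 2 * \<kappa>) x"
proof (cases "x 1")
  case False
  have "st x (x(1 := True)) (m + \<kappa> * occ x 2)" by (rule st_fill[OF x(1) False]) auto
  moreover have "\<not> paired x (x(1 := True))" using N5 False by (auto simp: paired_def fun_eq_iff)
  moreover have "- 2 * \<kappa> \<le> h x + (m + \<kappa> * occ x 2)" using x mk k0 by (auto simp: occ_def)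
  ultimately show ?thesis unfolding nactive_def by blast
next
  case x1: True
  have "\<exists>j. Suc (Suc j) \<le> N \<and> x (Suc j) \<and> \<not> x (Suc (Suc j))"
  proof (rule ccontr)
    assume no: "\<not> ?thesis"
    have all: "x i" if "1 \<le> i" "i \<le> N" for i
      using that
    proof (induction rule: dec_induct)
      case (step k)
      then show ?case using no by (cases k) auto
    qed (use x1 in simp)
    have "x i \<longleftrightarrow> 1 \<le> i \<and> i \<le> N" for i
      using all[of i] configs_outside[OF x(1), of i] by (cases "1 \<le> i \<and> i \<le> N") auto
    then have "x = eta N 0" by (simp add: eta_def fun_eq_iff)
    then show False using ne by blast
  qed
  then obtain j where j: "Suc (Suc j) \<le> N" "x (Suc j)" "\<not> x (Suc (Suc j))" by blast
  define c where "c = \<kappa> * (occ x (Suc (Suc (Suc j))) - occ x j)"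
  have "st x (x(Suc j := False, Suc (Suc j) := True)) c" by (rule stR[OF x(1) j]) (auto simp: c_def)
  moreover have "- 2 * \<kappa> \<le> h x + c" using x hop_le(2)[of x "Suc (Suc (Suc j))" j] k0 unfolding c_def by simp
  ultimately show ?thesis using hopR_not_paired[of j x, OF j] unfolding nactive_def by blast
qed

lemma zero_fast_exit:
  assumes "h x = 0" "st x y c" "\<not> paired x y" shows "c \<le> - \<kappa>"
  using flux_le[OF assms(2,3)] assms(1) by simp

text \<open>A block with a last gap of length one falls back to the trap below it, and the fluxes of order
  \<open>exp (- \<beta>\<kappa>/2)\<close> do not lead back.\<close>

lemma not_last_gap_one: "h (eta (N - 1) 0) \<noteq> 0"
proof
  assume h0: "h (eta (N - 1) 0) = 0"
  define t where "t = eta (N - 2) 0"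
  define v where "v = t(N - 1 := True)"
  have t: "trap t" unfolding t_def using N5 by (intro trap_eta) auto
  have tI: "\<And>i. t i \<longleftrightarrow> 1 \<le> i \<and> i \<le> N - 2" by (simp add: t_def eta_def)
  have veta: "v = eta (N - 1) 0" unfolding v_def using N5 by (auto simp: fun_eq_iff tI eta_def)
  have N2: "t (N - 2)" using N5 by (simp add: tI)
  note v = core_extension[OF t N2 v_def]
  have t': "t \<in> configs N" "long_runs t" "\<not> t (N - 1)" "\<not> t N" using t by (auto simp: trap_def)
  have "reach (- \<kappa>) v t"
    using slow_exit_right(1)[OF v(2,1,3,4), of "- \<kappa>"] h0 v(5) veta by simp
  then have r: "reach (- \<kappa>) t v" by (rule reach_sym)
  have "\<not> hops t v"
  proof
    assume "hops t v"
    then have "\<not> smooth v" by (rule hops_not_smooth[OF t'(2)])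
    moreover have "2 \<le> N - 1" using N5 by linarith
    ultimately show False using smooth_eta veta by blast
  qed
  \<comment> \<open>The trap together with its single hops is closed at level
    \<open>- \<kappa>\<close>: after a hop \<open>h\<close> is at most
    \<open>- 2 * \<kappa>\<close>, so only a positive exit counts, and with \<open>N\<close> vacant
    this is the way back.\<close>
  then have "v \<notin> insert t (Collect (hops t))" using v(6) by simp
  then obtain u w c where u: "u = t \<or> hops t u" and w: "w \<noteq> t" "\<not> hops t w"
    and e: "st u w c" "- \<kappa> \<le> h u + c"
    using reach_leaves[OF r, of "insert t (Collect (hops t))"] by auto
  show False
  proof (cases "u = t")
    case True
    have ht: "h t \<le> 0" using h_le t' by blast
    from e(1) show False
    proof (cases rule: step.cases)
      case (hopR j)
      then have "hops t w" unfolding hops_def True by (intro exI[of _ j]) auto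
      then show False using w by blast
    next
      case (hopL j)
      then have "hops t w" unfolding hops_def True by (intro exI[of _ j]) auto
      then show False using w by blast
    qed (use True e(2) ht t' mk nk k0 in \<open>auto simp: long_runs_def occ_def split: if_splits\<close>)
  next
    case False
    then have u': "hops t u" using u by blast
    have "h u \<le> - 2 * \<kappa>" by (rule hops_h_le[OF t'(1,2) u'])
    then have "0 < c" using e(2) k0 by linarith
    then have uN: "u N" using hops_exits[OF t'(1,2) u' e(1)] w(1) by blast
    obtain j where j: "Suc (Suc j) \<le> N" "t (Suc j) \<noteq> t (Suc (Suc j))"
      "u = t(Suc j := t (Suc (Suc j)), Suc (Suc j) := t (Suc j))" using u' unfolding hops_def by blast
    have "Suc (Suc j) = N" using uN j t' by (cases "Suc (Suc j) = N") auto
    then have "Suc j = N - 1" by simp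
    then show False using j(2) t' \<open>Suc (Suc j) = N\<close> by simp
  qed
qed

lemma not_full: "h (eta N 0) < 0"
proof -
  define t where "t = eta (N - 2) 0"
  have t: "trap t" unfolding t_def using N5 by (intro trap_eta) auto
  have tI: "\<And>i. t i \<longleftrightarrow> 1 \<le> i \<and> i \<le> N - 2" by (simp add: t_def eta_def)
  have "t (N - 2)" using N5 by (simp add: tI)
  note v = core_extension[OF t this refl]
  have "t(N - 1 := True, N := True) = eta N 0" using N5 by (auto simp: fun_eq_iff tI eta_def)
  then show ?thesis using v(7,8) by simp
qed

text \<open>This block lies in no basin, but breaking its bond has exponent only
  \<open>- \<kappa>\<close>; by the bound outside the basins \<open>h\<close> is at most
  \<open>- \<kappa>\<close>.\<close>

lemma not_first_pair: "h (eta 2 0) \<noteq> 0"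
proof
  assume h0: "h (eta 2 0) = 0"
  define x where "x = eta 2 0"
  have xI: "\<And>i. x i \<longleftrightarrow> 1 \<le> i \<and> i \<le> 2" by (simp add: x_def eta_def)
  have x: "x \<in> configs N" unfolding x_def using N5 by (intro eta_configs) auto
  define y where "y = x(Suc 1 := False, Suc (Suc 1) := True)"
  have e: "st x y (- \<kappa>)" by (rule stR[OF x, of 1]) (use N5 in \<open>auto simp: y_def xI\<close>)
  have np: "\<not> paired x y" unfolding y_def by (rule hopR_not_paired) (use N5 in \<open>auto simp: xI\<close>)
  have sm: "smooth x" unfolding x_def by (rule smooth_eta) simp
  have f: "\<not> x 3" "\<not> x N" using N5 by (auto simp: xI)
  have "x \<notin> basin t" if "trap t" for t
    using basin_shape(2)[OF that, of x] sm f unfolding long_runs_def by blast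
  then have "h x - \<kappa> \<le> - 2 * \<kappa>" using flux_le_outside[OF e np] by simp
  then show False using h0 k0 by (simp add: x_def)
qed

text \<open>Normalisation enters through \<open>z\<close>: some state has \<open>h\<close> equal to
  0, hence some block does, and \<open>eta_all\<close> spreads this to all blocks.\<close>

theorem h_zero_iff:
  assumes "z \<in> configs N" "h z = 0" and x: "x \<in> configs N"
  shows "h x = 0 \<longleftrightarrow> (\<exists>p. 3 \<le> p \<and> p + 2 \<le> N \<and> x = eta p 0)"
proof -
  have main: "\<exists>p. 3 \<le> p \<and> p + 2 \<le> N \<and> x = eta p 0" if x: "x \<in> configs N" "h x = 0" for x
  proof -
    have "x \<noteq> eta N 0" using not_full x by auto
    then have "nactive (- 2 * \<kappa>) x" by (rule nactive_zero[OF x])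
    then obtain p where p: "3 \<le> p" "p + 2 \<le> N" "reach (- 2 * \<kappa>) x (eta p 0)" by (rule reach_eta[OF x])
    have "near_block (eta p 0)" using p by (intro near_block_full[of p]) (auto simp: eta_def)
    then have "near_block x" by (rule near_block_closed[OF _ reach_sym[OF p(3)]])
    then show ?thesis
    proof (cases rule: near_block_cases)
      case (full a)
      then have xa: "x = eta a 0" by (auto simp: eta_def fun_eq_iff)
      have "a \<noteq> 2" "a \<noteq> N - 1" "a \<noteq> N"
        using not_first_pair not_last_gap_one not_full x(2) xa by auto
      then have "3 \<le> a \<and> a + 2 \<le> N" using full(1,2) by linarith
      then show ?thesis using xa by blast
    next
      case (hole g b)
      have False
      proof (cases "g = 1")
        case True
        have "st x (x(1 := True)) (m + \<kappa> * occ x 2)" by (rule st_fill[OF x(1)]) (use hole True in auto)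
        moreover have "\<not> paired x (x(1 := True))" using N5 True hole by (auto simp: paired_def fun_eq_iff)
        ultimately have "m + \<kappa> * occ x 2 \<le> - \<kappa>" by (rule zero_fast_exit[OF x(2)])
        then show False using mk k0 by (auto simp: occ_def split: if_splits)
      next
        case False
        then obtain p where p: "g = Suc (Suc p)" using hole(1) by (cases g; cases "g - 1") auto
        have "st x (x(Suc p := False, Suc (Suc p) := True)) (\<kappa> * (1 - occ x p))"
          by (rule stR[OF x(1), of p]) (use hole p in \<open>auto simp: occ_def\<close>)
        moreover have "\<not> paired x (x(Suc p := False, Suc (Suc p) := True))"
          by (rule hopR_not_paired) (use hole p in auto)
        ultimately have "\<kappa> * (1 - occ x p) \<le> - \<kappa>" by (rule zero_fast_exit[OF x(2)])
        then show False using k0 by (auto simp: occ_def split: if_splits)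
      qed
      then show ?thesis ..
    next
      case (free a j)
      obtain p where p: "j = Suc (Suc p)" "a < p" using free by (intro that[of "j - 2"]) auto
      have "st x (x(Suc p := True, Suc (Suc p) := False)) 0"
        by (rule stL[OF x(1), of p]) (use free p configs_outside[OF x(1), of "Suc j"] in \<open>auto simp: occ_def\<close>)
      moreover have "\<not> paired x (x(Suc p := True, Suc (Suc p) := False))"
        by (rule hopL_not_paired) (use free p in auto)
      ultimately have "0 \<le> - \<kappa>" by (rule zero_fast_exit[OF x(2)])
      then show ?thesis using k0 by simp
    qed
  qed
  obtain q where q: "3 \<le> q" "q + 2 \<le> N" "h (eta q 0) = 0" using main[OF assms(1,2)] assms(2) by blast
  show ?thesis using main[OF x] eta_all[OF q] by blast
qed

end

section \<open>From the stationary distribution to exponents\<close>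

lemma bonds_flip_first:
  assumes "1 \<le> N" "x \<in> configs N" "\<not> x 1"
  shows "bonds N (x(1 := True)) = bonds N x + occ x 2"
proof -
  have "occ x 0 = 0" using configs_outside[OF assms(2)] by simp
  then show ?thesis using bonds_add[of x N 0] assms by (simp add: numeral_2_eq_2)
qed

lemma bonds_flip_last:
  assumes "1 \<le> N" "x \<in> configs N" "\<not> x N"
  shows "bonds N (x(N := True)) = bonds N x + occ x (N - 1)"
proof -
  have "occ x (Suc N) = 0" using configs_outside[OF assms(2)] by simp
  then show ?thesis using bonds_add[of x N "N - 1"] assms by simp
qed

lemma swap_sites_inj:
  assumes "swap_sites x i (i + 1) = swap_sites x k (k + 1)" "x i \<noteq> x (i + 1)" "x k \<noteq> x (k + 1)"
  shows "i = k"
proof -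
  have P: "swap_sites x i (i + 1) l \<noteq> x l \<longleftrightarrow> l = i \<or> l = i + 1"
    "swap_sites x k (k + 1) l \<noteq> x l \<longleftrightarrow> l = k \<or> l = k + 1" for l
    using assms(2,3) by (auto simp: swap_sites_def)
  have "i = k \<or> i = k + 1" "k = i \<or> k = i + 1" using P(1)[of i] P(2)[of i] P(1)[of k] P(2)[of k] assms(1) by auto
  then show ?thesis by auto
qed

lemma swap_not_flip:
  assumes "x i \<noteq> x (i + 1)" shows "swap_sites x i (i + 1) \<noteq> flip_site x k"
proof
  assume "swap_sites x i (i + 1) = flip_site x k"
  then have "swap_sites x i (i + 1) i = flip_site x k i" "swap_sites x i (i + 1) (i + 1) = flip_site x k (i + 1)"
    by auto
  then show False using assms by (auto simp: swap_sites_def flip_site_def split: if_splits)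
qed

lemma flip_inj: "flip_site x i = flip_site x k \<Longrightarrow> i = k"
  unfolding flip_site_def by (metis fun_upd_other fun_upd_same)

text \<open>Different swaps of unequal neighbours give different results, and none equals a flip, so
  exactly one term of the rate survives.\<close>

lemma kaw_rate_swap:
  assumes "1 \<le> i" "i < N" "x i \<noteq> x (i + 1)" and y: "y = swap_sites x i (i + 1)"
  shows "kaw_rate N \<kappa> \<mu>L \<mu>R \<beta> x y = exp (\<beta> / 2 * (\<kappa> * (bonds N y - bonds N x)))"
proof -
  define e where "e = exp (- \<beta> / 2 * (energy \<kappa> N y - energy \<kappa> N x))"
  have "(x k \<noteq> x (k + 1) \<and> y = swap_sites x k (k + 1)) = (k = i)" for k
    using swap_sites_inj[of x i k] assms(3) y by metis
  then have "(\<Sum>k\<in>{1..<N}. if x k \<noteq> x (k+1) \<and> y = swap_sites x k (k+1) then e else 0)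
      = (\<Sum>k\<in>{1..<N}. if k = i then e else 0)"
    by presburger
  also have "\<dots> = e" using assms(1,2) by simp
  finally have "kaw_rate N \<kappa> \<mu>L \<mu>R \<beta> x y = e"
    unfolding kaw_rate_def e_def[symmetric] using swap_not_flip[of x i, OF assms(3)] y by simp
  then show ?thesis by (simp add: e_def energy_def bonds_def algebra_simps)
qed

lemma kaw_rate_flip:
  assumes "k = 1 \<or> k = N" "N \<noteq> 1" and y: "y = flip_site x k"
  shows "kaw_rate N \<kappa> \<mu>L \<mu>R \<beta> x y =
    exp (\<beta> / 2 * ((if k = 1 then \<mu>L else \<mu>R) * (1 - 2 * occ x k) + \<kappa> * (bonds N y - bonds N x)))"
proof -
  define e where "e = exp (- \<beta> / 2 * (energy \<kappa> N y - energy \<kappa> N x))"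
  have "\<not> (x i \<noteq> x (i + 1) \<and> y = swap_sites x i (i + 1))" for i
    using swap_not_flip[of x i k] y by metis
  then have s: "(\<Sum>i\<in>{1..<N}. if x i \<noteq> x (i+1) \<and> y = swap_sites x i (i+1) then e else 0) = 0"
    by (simp only: if_False sum.neutral_const)
  have f: "y = flip_site x l \<longleftrightarrow> k = l" for l
    using flip_inj[of x k l] y by metis
  have "kaw_rate N \<kappa> \<mu>L \<mu>R \<beta> x y = exp (\<beta> * (if k = 1 then \<mu>L else \<mu>R) / 2 * (1 - 2 * occ x k)) * e"
    unfolding kaw_rate_def e_def[symmetric] s f using assms(1,2) by auto
  moreover have "e = exp (\<beta> / 2 * (\<kappa> * (bonds N y - bonds N x)))"
    by (simp add: e_def energy_def bonds_def algebra_simps)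
  moreover have "\<beta> * q / 2 * z + \<beta> / 2 * d = \<beta> / 2 * (q * z + d)" for q z d
    by (simp add: algebra_simps)
  ultimately show ?thesis by (simp only: mult_exp_exp)
qed

lemma kaw_rate_step:
  assumes N: "5 \<le> N" and e: "step N \<kappa> \<mu>L (- \<mu>R) x y c"
  shows "kaw_rate N \<kappa> \<mu>L \<mu>R \<beta> x y = exp (\<beta> / 2 * c)"
  using e
proof (cases rule: step.cases)
  case (hopR j)
  then have y: "y = swap_sites x (Suc j) (Suc j + 1)" by (simp add: swap_sites_def)
  have "kaw_rate N \<kappa> \<mu>L \<mu>R \<beta> x y = exp (\<beta> / 2 * (\<kappa> * (bonds N y - bonds N x)))"
    by (rule kaw_rate_swap[OF _ _ _ y]) (use hopR in auto)
  then show ?thesis using hopR hopR_change(1)[OF hopR(3-6,1)] by simp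
next
  case (hopL j)
  then have y: "y = swap_sites x (Suc j) (Suc j + 1)" by (simp add: swap_sites_def)
  have "kaw_rate N \<kappa> \<mu>L \<mu>R \<beta> x y = exp (\<beta> / 2 * (\<kappa> * (bonds N y - bonds N x)))"
    by (rule kaw_rate_swap[OF _ _ _ y]) (use hopL in auto)
  then show ?thesis using hopL hopL_change(1)[OF hopL(3-6,1)] by simp
next
  case fill
  then have y: "y = flip_site x 1" by (simp add: flip_site_def)
  have "\<mu>L * (1 - 2 * occ x 1) + \<kappa> * (bonds N y - bonds N x) = c"
    using bonds_flip_first[of N x] N fill by simp
  then show ?thesis using kaw_rate_flip[of 1 N, OF _ _ y] N by simp
next
  case unfill
  then have y: "y = flip_site x 1" by (simp add: flip_site_def)
  have yc: "y \<in> configs N" using unfill N by (auto intro: configs_upd)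
  have x: "x = y(1 := True)" using unfill by (auto simp: fun_eq_iff)
  have "bonds N x = bonds N y + occ x 2"
    using bonds_flip_first[OF _ yc] unfill N unfolding x[symmetric] by simp
  then have "\<mu>L * (1 - 2 * occ x 1) + \<kappa> * (bonds N y - bonds N x) = c"
    using unfill by (simp add: algebra_simps)
  then show ?thesis using kaw_rate_flip[of 1 N, OF _ _ y] N by simp
next
  case kill
  then have y: "y = flip_site x N" by (simp add: flip_site_def)
  have yc: "y \<in> configs N" using kill N by (auto intro: configs_upd)
  have x: "x = y(N := True)" using kill by (auto simp: fun_eq_iff)
  have "N - Suc 0 \<noteq> N" using N by simp
  then have "bonds N x = bonds N y + occ x (N - 1)"
    using bonds_flip_last[OF _ yc] kill N unfolding x[symmetric] by simp
  then have "\<mu>R * (1 - 2 * occ x N) + \<kappa> * (bonds N y - bonds N x) = c"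
    using kill by (simp add: algebra_simps)
  then show ?thesis using kaw_rate_flip[of N N, OF _ _ y] N by simp
next
  case create
  then have y: "y = flip_site x N" by (simp add: flip_site_def)
  have "\<mu>R * (1 - 2 * occ x N) + \<kappa> * (bonds N y - bonds N x) = c"
    using bonds_flip_last[of N x] N create by (simp add: algebra_simps)
  then show ?thesis using kaw_rate_flip[of N N, OF _ _ y] N by simp
qed

lemma kaw_rate_zero:
  assumes N: "5 \<le> N" and x: "x \<in> configs N" and no: "\<And>c. \<not> step N \<kappa> \<mu>L (- \<mu>R) x y c"
  shows "kaw_rate N \<kappa> \<mu>L \<mu>R \<beta> x y = 0"
proof -
  have swap: "\<not> (x i \<noteq> x (i + 1) \<and> y = swap_sites x i (i + 1))" if iN: "i \<in> {1..<N}" for i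
  proof
    assume a: "x i \<noteq> x (i + 1) \<and> y = swap_sites x i (i + 1)"
    obtain j where j: "i = Suc j" using iN by (cases i) auto
    show False
    proof (cases "x i")
      case True
      then show False
        using a j iN step.hopR[OF x, of j \<kappa> \<mu>L "- \<mu>R"] no by (auto simp: swap_sites_def)
    next
      case False
      then show False
        using a j iN step.hopL[OF x, of j \<kappa> \<mu>L "- \<mu>R"] no by (auto simp: swap_sites_def)
    qed
  qed
  have "y \<noteq> flip_site x 1"
    using no step.fill[OF x, of \<kappa> \<mu>L "- \<mu>R"] step.unfill[OF x, of \<kappa> \<mu>L "- \<mu>R"]
    by (cases "x 1") (auto simp: flip_site_def)
  moreover have "y \<noteq> flip_site x N"
    using no step.kill[OF x, of \<kappa> \<mu>L "- \<mu>R"] step.create[OF x, of \<kappa> \<mu>L "- \<mu>R"]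
    by (cases "x N") (auto simp: flip_site_def)
  moreover have "(\<Sum>i\<in>{1..<N}. if x i \<noteq> x (i+1) \<and> y = swap_sites x i (i+1) then e else 0) = 0" for e :: real
    by (intro sum.neutral ballI if_not_P swap)
  ultimately show ?thesis unfolding kaw_rate_def by simp
qed

lemma step_sym:
  assumes N: "5 \<le> N" and e: "step N \<kappa> m n x y c"
  shows "\<exists>c'. step N \<kappa> m n y x c'"
proof -
  have y: "y \<in> configs N" using step_configs(2)[OF e] N by simp
  from e show ?thesis
  proof (cases rule: step.cases)
    case (hopR j)
    then have "x = y(Suc j := True, Suc (Suc j) := False)" by (auto simp: fun_eq_iff)
    then show ?thesis using step.hopL[OF y, of j \<kappa> m n] hopR by auto
  next
    case (hopL j)
    then have "x = y(Suc j := False, Suc (Suc j) := True)" by (auto simp: fun_eq_iff)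
    then show ?thesis using step.hopR[OF y, of j \<kappa> m n] hopL by auto
  next
    case fill
    then have "x = y(1 := False)" by (auto simp: fun_eq_iff)
    then show ?thesis using step.unfill[OF y, of \<kappa> m n] fill by auto
  next
    case unfill
    then have "x = y(1 := True)" by (auto simp: fun_eq_iff)
    then show ?thesis using step.fill[OF y, of \<kappa> m n] unfill by auto
  next
    case kill
    then have "x = y(N := True)" by (auto simp: fun_eq_iff)
    then show ?thesis using step.create[OF y, of \<kappa> m n] kill by auto
  next
    case create
    then have "x = y(N := False)" by (auto simp: fun_eq_iff)
    then show ?thesis using step.kill[OF y, of \<kappa> m n] create by auto
  qed
qed

text \<open>Moving the leftmost particle to the left and out leads every configuration to the empty one.\<close>

lemma step_invariant_set:
  assumes N: "5 \<le> N" and A: "\<And>x y c. step N \<kappa> m n x y c \<Longrightarrow> x \<in> A \<Longrightarrow> y \<in> A" and x: "x \<in> configs N"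
  shows "x \<in> A \<longleftrightarrow> (\<lambda>_. False) \<in> A"
  using x
proof (induction "\<Sum>i | x i. i" arbitrary: x rule: less_induct)
  case less
  \<comment> \<open>Every transition has a reverse, so a closed set is also closed
    backwards.\<close>
  have iff: "x \<in> A \<longleftrightarrow> y \<in> A" if "step N \<kappa> m n x y c" for y c
    using A[OF that] step_sym[OF N that] A by blast
  have fin: "finite {i. x i}"
    by (rule finite_subset[of _ "{1..N}"]) (use less.prems in \<open>auto simp: configs_def\<close>)
  show ?case
  proof (cases "{i. x i} = {}")
    case True
    then have "x = (\<lambda>_. False)" by auto
    then show ?thesis by simp
  next
    case False
    define k where "k = Min {i. x i}"
    have k: "x k" "\<And>i. x i \<Longrightarrow> k \<le> i" using Min_in[OF fin False] Min_le[OF fin] by (auto simp: k_def)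
    have kN: "1 \<le> k" "k \<le> N" using less.prems k(1) by (auto simp: configs_def)
    show ?thesis
    proof (cases "k = 1")
      case True
      define y where "y = x(1 := False)"
      have s: "step N \<kappa> m n x y (- (m + \<kappa> * occ x 2))"
        unfolding y_def by (rule step.unfill) (use less.prems k True in auto)
      have "{i. y i} = {i. x i} - {1}" by (auto simp: y_def)
      moreover have "(\<Sum>i | x i. i) = 1 + (\<Sum>i\<in>{i. x i} - {1}. i)"
        using sum.remove[OF fin, of 1 "\<lambda>i. i"] k(1) True by simp
      ultimately have "(\<Sum>i | y i. i) < (\<Sum>i | x i. i)" by simp
      then have "y \<in> A \<longleftrightarrow> (\<lambda>_. False) \<in> A" using less.hyps step_configs(2)[OF s] N by simp
      then show ?thesis using iff[OF s] by simp
    next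
      case False
      then obtain j where j: "k = Suc (Suc j)" using kN by (cases k; cases "k - 1") auto
      have nj: "\<not> x (Suc j)" using k(2)[of "Suc j"] j by auto
      define y where "y = x(Suc j := True, Suc (Suc j) := False)"
      have s: "step N \<kappa> m n x y (\<kappa> * (occ x j - occ x (Suc (Suc (Suc j)))))"
        unfolding y_def by (rule step.hopL) (use less.prems k nj j kN in auto)
      have "{i. y i} = insert (Suc j) ({i. x i} - {k})" using j by (auto simp: y_def)
      moreover have "(\<Sum>i | x i. i) = k + (\<Sum>i\<in>{i. x i} - {k}. i)"
        using sum.remove[OF fin, of k "\<lambda>i. i"] k(1) by simp
      ultimately have "(\<Sum>i | y i. i) < (\<Sum>i | x i. i)" using fin nj j by simp
      then have "y \<in> A \<longleftrightarrow> (\<lambda>_. False) \<in> A" using less.hyps step_configs(2)[OF s] N by simp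
      then show ?thesis using iff[OF s] by simp
    qed
  qed
qed

section \<open>Exponential limits and balance across cuts\<close>

lemma log_asymp_exp: "log_asymp (\<lambda>\<beta>. exp (\<beta> / 2 * c)) (c / 2)"
proof -
  have "((\<lambda>_::real. c / 2) \<longlongrightarrow> c / 2) at_top" by simp
  moreover have "eventually (\<lambda>\<beta>. c / 2 = ln (exp (\<beta> / 2 * c)) / \<beta>) at_top"
    using eventually_gt_at_top[of 0] by eventually_elim (simp add: field_simps)
  ultimately show ?thesis unfolding log_asymp_def by (rule Lim_transform_eventually)
qed

lemma log_asymp_neg_tendsto_0:
  assumes "\<And>\<beta>. \<beta> > 0 \<Longrightarrow> f \<beta> > 0" "log_asymp f a" "a < 0"
  shows "(f \<longlongrightarrow> 0) at_top"
proof -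
  have ev: "eventually (\<lambda>\<beta>. ln (f \<beta>) / \<beta> < a / 2) at_top"
    using assms(2,3) unfolding log_asymp_def by (intro order_tendstoD(2)) auto
  have "filterlim (\<lambda>\<beta>::real. a / 2 * \<beta>) at_bot at_top"
    by (rule filterlim_tendsto_neg_mult_at_bot[OF tendsto_const _ filterlim_ident]) (use assms(3) in simp)
  then have lim: "((\<lambda>\<beta>. exp (a / 2 * \<beta>)) \<longlongrightarrow> 0) at_top" by (rule filterlim_compose[OF exp_at_bot])
  show ?thesis
  proof (rule tendsto_sandwich[OF _ _ tendsto_const lim])
    show "eventually (\<lambda>\<beta>. 0 \<le> f \<beta>) at_top"
      using eventually_gt_at_top[of 0] by eventually_elim (use assms(1) less_imp_le in blast)
    show "eventually (\<lambda>\<beta>. f \<beta> \<le> exp (a / 2 * \<beta>)) at_top"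
      using ev eventually_gt_at_top[of 0]
    proof eventually_elim
      case (elim \<beta>)
      then have "ln (f \<beta>) \<le> a / 2 * \<beta>" by (simp add: field_simps)
      then show ?case using assms(1)[OF elim(2)] by (metis exp_le_cancel_iff exp_ln)
    qed
  qed
qed

text \<open>Summing the balance equations over \<open>B\<close> cancels the flux inside
  \<open>B\<close>. The zero diagonal of \<open>q\<close> lets all sums run over the whole of
  \<open>S\<close>.\<close>

lemma stationary_cut:
  fixes S :: "'a set" and w :: "'a \<Rightarrow> real" and r :: "'a \<Rightarrow> 'a \<Rightarrow> real"
  assumes "finite S" "B \<subseteq> S"
    and bal: "\<And>y. y \<in> S \<Longrightarrow> (\<Sum>x\<in>S-{y}. w x * r x y) = w y * (\<Sum>z\<in>S-{y}. r y z)"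
  shows "(\<Sum>y\<in>B. \<Sum>x\<in>S-B. w x * r x y) = (\<Sum>y\<in>B. \<Sum>z\<in>S-B. w y * r y z)"
proof -
  define q where "q = (\<lambda>x y. if x = y then 0 else w x * r x y)"
  have fB: "finite B" using assms finite_subset by blast
  have q1: "(\<Sum>x\<in>S. q x y) = (\<Sum>z\<in>S. q y z)" if "y \<in> S" for y
  proof -
    have "(\<Sum>x\<in>S. q x y) = (\<Sum>x\<in>S-{y}. w x * r x y)"
      using assms(1) that by (simp add: sum.remove[of S y] q_def)
    also have "\<dots> = (\<Sum>z\<in>S-{y}. w y * r y z)" using bal[OF that] by (simp add: sum_distrib_left)
    also have "\<dots> = (\<Sum>z\<in>S. q y z)"
      using assms(1) that by (simp add: sum.remove[of S y] q_def) (intro sum.cong, auto)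
    finally show ?thesis .
  qed
  have split: "sum f S = sum f B + sum f (S - B)" for f :: "'a \<Rightarrow> real"
    using sum.subset_diff[OF assms(2,1), of f] by simp
  have "(\<Sum>y\<in>B. (\<Sum>x\<in>B. q x y) + (\<Sum>x\<in>S-B. q x y)) = (\<Sum>y\<in>B. (\<Sum>z\<in>B. q y z) + (\<Sum>z\<in>S-B. q y z))"
    by (intro sum.cong refl) (use q1 assms(2) split in \<open>metis subsetD\<close>)
  moreover have "(\<Sum>y\<in>B. \<Sum>x\<in>B. q x y) = (\<Sum>y\<in>B. \<Sum>z\<in>B. q y z)" by (rule sum.swap)
  ultimately have "(\<Sum>y\<in>B. \<Sum>x\<in>S-B. q x y) = (\<Sum>y\<in>B. \<Sum>z\<in>S-B. q y z)"
    by (simp add: sum.distrib)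
  moreover have "(\<Sum>y\<in>B. \<Sum>x\<in>S-B. q x y) = (\<Sum>y\<in>B. \<Sum>x\<in>S-B. w x * r x y)"
    by (intro sum.cong refl) (auto simp: q_def)
  moreover have "(\<Sum>y\<in>B. \<Sum>z\<in>S-B. q y z) = (\<Sum>y\<in>B. \<Sum>z\<in>S-B. w y * r y z)"
    by (intro sum.cong refl) (auto simp: q_def)
  ultimately show ?thesis by simp
qed

theorem theorem1:
  fixes N :: nat and \<kappa> \<mu>L \<mu>R :: real and \<rho> :: "real \<Rightarrow> config \<Rightarrow> real"
  assumes "N \<ge> 5"
    and "\<mu>L > \<kappa>" and "\<kappa> > 0" and "0 > \<mu>R" and "\<bar>\<mu>R\<bar> > \<kappa>"
    and "\<And>\<beta>. \<beta> > 0 \<Longrightarrow> stationary N \<kappa> \<mu>L \<mu>R \<beta> (\<rho> \<beta>)"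
  shows "\<forall>x\<in>configs N.
           (log_asymp (\<lambda>\<beta>. \<rho> \<beta> x) 0 \<longleftrightarrow>
              (\<exists>p q. p \<ge> 3 \<and> q \<ge> 2 \<and> p + q = N \<and> x = eta p q))
         \<and> ((\<nexists>p q. p \<ge> 3 \<and> q \<ge> 2 \<and> p + q = N \<and> x = eta p q) \<longrightarrow>
              (\<exists>\<alpha>>0. log_asymp (\<lambda>\<beta>. \<rho> \<beta> x) (- \<alpha>)))"
proof -
  let ?S = "configs N"
  let ?st = "step N \<kappa> \<mu>L (- \<mu>R)"
  define r where "r = (\<lambda>x y \<beta>. kaw_rate N \<kappa> \<mu>L \<mu>R \<beta> x y)"
  define w where "w = (\<lambda>x \<beta>. \<rho> \<beta> x)"
  have rstep: "r x y \<beta> = exp (\<beta> / 2 * c)" if "?st x y c" for x y c \<beta>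
    unfolding r_def by (rule kaw_rate_step[OF assms(1) that])
  have rpos: "pos_asymp (r x y)" if "?st x y c" for x y c
    using log_asymp_exp[of c] unfolding pos_asymp_def by (auto simp: rstep[OF that, abs_def])
  have rzero: "r x y \<beta> = 0" if "x \<in> ?S" "\<And>c. \<not> ?st x y c" for x y \<beta>
    unfolding r_def by (rule kaw_rate_zero[OF assms(1) that])
  have rzoa: "zero_or_asymp (r x y)" if "x \<in> ?S" for x y
    using rpos rzero[OF that] unfolding zero_or_asymp_def by blast
  have nonneg: "w x \<beta> \<ge> 0" and one: "(\<Sum>x\<in>?S. w x \<beta>) = 1"
    and bal: "y \<in> ?S \<Longrightarrow> (\<Sum>x\<in>?S-{y}. w x \<beta> * r x y \<beta>) = w y \<beta> * (\<Sum>z\<in>?S-{y}. r y z \<beta>)"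
    if "\<beta> > 0" "x \<in> ?S" for \<beta> x y
    using assms(6)[OF that(1)] that(2) by (simp_all add: stationary_def w_def r_def)
  have empty: "(\<lambda>_. False) \<in> ?S" by (simp add: configs_def)
  have irred: "\<exists>x\<in>A. \<exists>y\<in>?S-A. pos_asymp (r x y)" if A: "A \<subset> ?S" "A \<noteq> {}" for A
  proof (rule ccontr)
    assume no: "\<not> ?thesis"
    have cl: "y \<in> A" if "?st x y c" "x \<in> A" for x y c
      using no rpos[OF that(1)] that step_configs(2)[OF that(1)] assms(1) by auto
    have "x \<in> A \<longleftrightarrow> (\<lambda>_. False) \<in> A" if "x \<in> ?S" for x
      by (rule step_invariant_set[OF assms(1) cl that])
    then show False using A by blast
  qed
  have wpa: "pos_asymp (w x)" if "x \<in> ?S" for x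
    by (rule stationary_asymp[of ?S r w])
       (use finite_configs empty rzoa irred nonneg[OF _ empty] nonneg one[OF _ empty] bal[OF _ empty] that in auto)
  then have wpos: "w x \<beta> > 0" if "x \<in> ?S" "\<beta> > 0" for x \<beta> using pos_asymp_pos that by blast
  obtain H where H: "\<And>x. x \<in> ?S \<Longrightarrow> log_asymp (w x) (H x)"
    using wpa unfolding pos_asymp_def by metis
  \<comment> \<open>The factor 2 matches the rates \<open>exp (\<beta> / 2 * c)\<close>.\<close>
  define h where "h = (\<lambda>x. 2 * H x)"
  have H_le: "H x \<le> 0" if x: "x \<in> ?S" for x
  proof (rule tendsto_upperbound)
    show "((\<lambda>\<beta>. ln (w x \<beta>) / \<beta>) \<longlongrightarrow> H x) at_top" using H[OF x] by (simp add: log_asymp_def)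
    show "eventually (\<lambda>\<beta>. ln (w x \<beta>) / \<beta> \<le> 0) at_top"
      using eventually_gt_at_top[of 0]
    proof eventually_elim
      case (elim \<beta>)
      have "w x \<beta> \<le> 1"
        using member_le_sum[OF x, of "\<lambda>x. w x \<beta>"] nonneg[OF elim] one[OF elim x] finite_configs by auto
      then show ?case using wpos[OF x elim] elim by (simp add: divide_nonpos_pos)
    qed
  qed simp
  have cut: "\<exists>x' y' c'. ?st x' y' c' \<and> x' \<notin> A \<and> y' \<in> A \<and> h x + c \<le> h x' + c'"
    if e: "?st x y c" "x \<in> A" "y \<notin> A" for x y c A
  proof (rule ccontr)
    assume no: "\<not> ?thesis"
    define B where "B = A \<inter> ?S"
    have xy: "x \<in> B" "y \<in> ?S - B" using e step_configs[OF e(1)] assms(1) by (auto simp: B_def)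
    have fin: "finite B" "finite (?S - B)" using finite_configs by (auto simp: B_def)
    \<comment> \<open>If every edge into \<open>A\<close> had a smaller exponent than the edge from
      \<open>x\<close> to \<open>y\<close>, each inward flux would be negligible against that edge,
      although cut balance makes the total inward flux at least as large.\<close>
    have t0: "((\<lambda>\<beta>. w u \<beta> * r u v \<beta> / (w x \<beta> * r x y \<beta>)) \<longlongrightarrow> 0) at_top"
      if uv: "v \<in> B" "u \<in> ?S - B" for u v
    proof (cases "\<exists>c'. ?st u v c'")
      case False
      then show ?thesis using rzero[of u v] uv by simp
    next
      case True
      then obtain c' where s: "?st u v c'" by blast
      then have lt: "h u + c' < h x + c" using no uv by (auto simp: B_def not_le)
      have pos: "w u \<beta> * r u v \<beta> > 0" "w x \<beta> * r x y \<beta> > 0" if "\<beta> > 0" for \<beta>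
        using wpos that uv xy by (auto simp: rstep[OF s] rstep[OF e(1)] B_def)
      have ipos: "inverse (w x \<beta> * r x y \<beta>) > 0" if "\<beta> > 0" for \<beta>
        using pos(2)[OF that] by (rule positive_imp_inverse_positive)
      have L1: "log_asymp (\<lambda>\<beta>. w u \<beta> * r u v \<beta>) (H u + c' / 2)"
        by (rule log_asymp_mult) (use wpos uv H log_asymp_exp in \<open>auto simp: rstep[OF s]\<close>)
      have L2: "log_asymp (\<lambda>\<beta>. w x \<beta> * r x y \<beta>) (H x + c / 2)"
        by (rule log_asymp_mult) (use wpos xy H log_asymp_exp in \<open>auto simp: rstep[OF e(1)] B_def\<close>)
      have "log_asymp (\<lambda>\<beta>. w u \<beta> * r u v \<beta> * inverse (w x \<beta> * r x y \<beta>)) (H u + c' / 2 + - (H x + c / 2))"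
        by (rule log_asymp_mult[OF pos(1) ipos L1 log_asymp_inverse[OF pos(2) L2]])
      then have "((\<lambda>\<beta>. w u \<beta> * r u v \<beta> * inverse (w x \<beta> * r x y \<beta>)) \<longlongrightarrow> 0) at_top"
        by (rule log_asymp_neg_tendsto_0[rotated]) (use lt pos ipos in \<open>auto simp: h_def intro: mult_pos_pos simp del: inverse_mult_distrib\<close>)
      then show ?thesis by (simp add: divide_inverse)
    qed
    have lim: "((\<lambda>\<beta>. \<Sum>v\<in>B. \<Sum>u\<in>?S-B. w u \<beta> * r u v \<beta> / (w x \<beta> * r x y \<beta>)) \<longlongrightarrow> (\<Sum>v\<in>B. \<Sum>u\<in>?S-B. 0)) at_top"
      by (intro tendsto_sum t0)
    have ge: "eventually (\<lambda>\<beta>. 1 \<le> (\<Sum>v\<in>B. \<Sum>u\<in>?S-B. w u \<beta> * r u v \<beta> / (w x \<beta> * r x y \<beta>))) at_top"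
      using eventually_gt_at_top[of 0]
    proof eventually_elim
      case (elim \<beta>)
      have nn: "0 \<le> w u \<beta> * r u v \<beta>" if "u \<in> ?S" for u v
        using nonneg[OF elim that] zero_or_asymp_nonneg[OF rzoa[OF that] elim] by simp
      have p: "w x \<beta> * r x y \<beta> > 0" using wpos[of x \<beta>] xy elim by (auto simp: rstep[OF e(1)] B_def)
      have "w x \<beta> * r x y \<beta> \<le> (\<Sum>z\<in>?S-B. w x \<beta> * r x z \<beta>)"
        by (rule member_le_sum[of y "?S - B" "\<lambda>z. w x \<beta> * r x z \<beta>"]) (use xy fin nn in \<open>auto simp: B_def\<close>)
      also have "\<dots> \<le> (\<Sum>v\<in>B. \<Sum>z\<in>?S-B. w v \<beta> * r v z \<beta>)"
        by (rule member_le_sum[of x B "\<lambda>v. \<Sum>z\<in>?S-B. w v \<beta> * r v z \<beta>"])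
           (use xy fin nn in \<open>auto simp: B_def intro!: sum_nonneg\<close>)
      also have "\<dots> = (\<Sum>v\<in>B. \<Sum>u\<in>?S-B. w u \<beta> * r u v \<beta>)"
        by (rule stationary_cut[symmetric, OF finite_configs])
           (use bal[OF elim empty] in \<open>auto simp: B_def\<close>)
      finally show ?case using p by (simp add: le_divide_eq flip: sum_divide_distrib)
    qed
    have "(1::real) \<le> (\<Sum>v\<in>B. \<Sum>u\<in>?S-B. 0)"
      by (rule tendsto_lowerbound[OF lim ge]) simp
    then show False by simp
  qed
  interpret kawasaki_exponents N \<kappa> \<mu>L "- \<mu>R" h
    by unfold_locales (use assms H_le cut in \<open>auto simp: h_def\<close>)
  \<comment> \<open>Finitely many weights with total one cannot all tend to zero.\<close>
  obtain z where z: "z \<in> ?S" "h z = 0"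
  proof (rule ccontr)
    assume no: "\<not> thesis"
    note witness = that
    have "(w x \<longlongrightarrow> 0) at_top" if x: "x \<in> ?S" for x
    proof (rule log_asymp_neg_tendsto_0[OF wpos[OF x] H[OF x]])
      show "H x < 0" using H_le[OF x] no witness[of x] x by (force simp: h_def)
    qed
    then have "((\<lambda>\<beta>. \<Sum>x\<in>?S. w x \<beta>) \<longlongrightarrow> (\<Sum>x\<in>?S. 0)) at_top" by (intro tendsto_sum)
    moreover have "eventually (\<lambda>\<beta>. 1 \<le> (\<Sum>x\<in>?S. w x \<beta>)) at_top"
      using eventually_gt_at_top[of 0] by eventually_elim (simp add: one[OF _ empty])
    ultimately have "(1::real) \<le> (\<Sum>x\<in>?S. 0)" by (rule tendsto_lowerbound) simp
    then show False by simp
  qed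
  have ex: "(\<exists>p q. p \<ge> 3 \<and> q \<ge> 2 \<and> p + q = N \<and> x = eta p q) \<longleftrightarrow> H x = 0" if "x \<in> ?S" for x
  proof -
    have "(\<exists>p q. p \<ge> 3 \<and> q \<ge> 2 \<and> p + q = N \<and> x = eta p q) \<longleftrightarrow> (\<exists>p. 3 \<le> p \<and> p + 2 \<le> N \<and> x = eta p 0)"
    proof
      assume "\<exists>p. 3 \<le> p \<and> p + 2 \<le> N \<and> x = eta p 0"
      then obtain p where "3 \<le> p" "p + 2 \<le> N" "x = eta p 0" by blast
      then show "\<exists>p q. p \<ge> 3 \<and> q \<ge> 2 \<and> p + q = N \<and> x = eta p q"
        by (intro exI[of _ p] exI[of _ "N - p"]) (auto simp: eta_def)
    qed (auto simp: eta_def)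
    then show ?thesis using h_zero_iff[OF z that] by (simp add: h_def)
  qed
  show ?thesis
  proof
    fix x assume x: "x \<in> ?S"
    have Hx: "log_asymp (\<lambda>\<beta>. \<rho> \<beta> x) (H x)" using H[OF x] by (simp add: w_def)
    then have "log_asymp (\<lambda>\<beta>. \<rho> \<beta> x) 0 \<longleftrightarrow> H x = 0" using log_asymp_unique by auto
    moreover have "\<exists>\<alpha>>0. log_asymp (\<lambda>\<beta>. \<rho> \<beta> x) (- \<alpha>)" if "H x \<noteq> 0"
      using H_le[OF x] that Hx by (intro exI[of _ "- H x"]) auto
    ultimately show "(log_asymp (\<lambda>\<beta>. \<rho> \<beta> x) 0 \<longleftrightarrow>
              (\<exists>p q. p \<ge> 3 \<and> q \<ge> 2 \<and> p + q = N \<and> x = eta p q))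
         \<and> ((\<nexists>p q. p \<ge> 3 \<and> q \<ge> 2 \<and> p + q = N \<and> x = eta p q) \<longrightarrow>
              (\<exists>\<alpha>>0. log_asymp (\<lambda>\<beta>. \<rho> \<beta> x) (- \<alpha>)))"
      using ex[OF x] by blast
  qed
qed

end
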